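(* Let $(M^n,g)$ be a simply connected Riemannian manifold, let $\mu\in\mathbb{R}$, and suppose that the Riemann curvature $\mathrm{Rm}\in\mathrm{Hom}(TM,F)$ is (pointwise) injective, where $F=\Lambda^2T^*M\otimes TM$. Define $D\in\mathrm{Hom}(TM,F)$ by $$D=\mathrm{Rm}\circ\check{\mathrm{Rm}}^{-1}$$ and define the vector field $K$ by $$K=\langle d\mathrm{Ric},D(\cdot)\rangle_F^\sharp .$$ Then there exists a function $f\in C^\infty(M)$ such that $\mathrm{Ric}+\nabla^2f=\mu g$ if and only if $$0=\mathrm{Ric}+\nabla K-\mu g .$$
   Context: Conventions: $\mathrm{Rm}(x,y)w=-\nabla_x\nabla_yw+\nabla_y\nabla_xw+\nabla_{[x,y]}w$, $\mathrm{Rm}(x,y,w,z)=\langle \mathrm{Rm}(x,y)w,z\rangle$, so $\mathrm{Ric}(y,z)=\sum_i\mathrm{Rm}(e_i,y,e_i,z)$ for an orthonormal basis $\{e_i\}$. $\mathrm{Rm}$ is viewed as an element of $\mathrm{Hom}(TM,F)$ by $x\mapsto\mathrm{Rm}(x):=\mathrm{Rm}(\cdot,\cdot,x,\cdot)$. For $A,B\in\mathrm{Hom}(TM,F)$ define $A\vee B\in\mathrm{End}(TM)$ by $\langle(A\vee B)(x),y\rangle=\langle A(x),B(y)\rangle_F$, where $\langle\cdot,\cdot\rangle_F$ is the metric on $F$ induced by $g$, and set $\check A=A\vee A$; if $\mathrm{Rm}$ is injective then $\check{\mathrm{Rm}}$ is invertible. $d\mathrm{Ric}(x,y,z)=\nabla_x\mathrm{Ric}(y,z)-\nabla_y\mathrm{Ric}(x,z)$,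 regarded as a section of $F$ via $g$. $\sharp:T^*M\to TM$ is the musical isomorphism, and in $\nabla K$ the vector field $K$ is identified with its dual one-form, so $\nabla K$ is a $(0,2)$-tensor. *)

theory Defs
  imports "HOL-Analysis.Analysis"
begin

section \<open>Smooth maps between open subsets of normed spaces\<close>

text \<open>Partial derivatives are taken in all directions, so \<open>Ck_on k f S\<close> is the usual
  class \<open>C\<^sup>k\<close> on an open subset \<open>S\<close> of a finite-dimensional space.\<close>

primrec Ck_on ::
  "nat \<Rightarrow> ('a::real_normed_vector \<Rightarrow> 'b::real_normed_vector) \<Rightarrow> 'a set \<Rightarrow> bool" where
  "Ck_on 0 f S \<longleftrightarrow> continuous_on S f"
| "Ck_on (Suc k) f S \<longleftrightarrow>
     (\<forall>x\<in>S. f differentiable (at x)) \<and>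
     (\<forall>v. Ck_on k (\<lambda>x. frechet_derivative f (at x) v) S)"

definition smooth_on ::
  "'a::real_normed_vector set \<Rightarrow> ('a \<Rightarrow> 'b::real_normed_vector) \<Rightarrow> bool" where
  "smooth_on S f \<longleftrightarrow> open S \<and> (\<forall>k. Ck_on k f S)"


section \<open>Smooth manifolds and Riemannian metrics\<close>

text \<open>A chart is a pair of a domain and a coordinate map; the coordinate map is only meaningful
  on the domain.  The manifold is a subset \<open>M\<close> of a Hausdorff second countable space, carrying
  the subspace topology; \<open>M\<close> may be the whole type.\<close>

type_synonym ('a, 'n) chart = "'a set \<times> ('a \<Rightarrow> (real, 'n) vec)"

definition chart_dom :: "('a, 'n::finite) chart \<Rightarrow> 'a set" where
  "chart_dom c = fst c"

definition chart_map :: "('a, 'n::finite) chart \<Rightarrow> 'a \<Rightarrow> real ^ 'n" where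
  "chart_map c = snd c"

definition chart_ran :: "('a, 'n::finite) chart \<Rightarrow> (real ^ 'n) set" where
  "chart_ran c = chart_map c ` chart_dom c"

definition chart_inv :: "('a, 'n::finite) chart \<Rightarrow> real ^ 'n \<Rightarrow> 'a" where
  "chart_inv c = inv_into (chart_dom c) (chart_map c)"

definition transition ::
  "('a, 'n::finite) chart \<Rightarrow> ('a, 'n) chart \<Rightarrow> real ^ 'n \<Rightarrow> real ^ 'n" where
  "transition c c' = chart_map c' \<circ> chart_inv c"

definition smooth_manifold ::
  "'a::{t2_space, second_countable_topology} set \<Rightarrow> ('a, 'n::finite) chart set \<Rightarrow> bool" where
  "smooth_manifold M A \<longleftrightarrow>
     (\<Union>c\<in>A. chart_dom c) = M \<and>
     (\<forall>c\<in>A. openin (top_of_set M) (chart_dom c) \<and> open (chart_ran c) \<and>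
        homeomorphism (chart_dom c) (chart_ran c) (chart_map c) (chart_inv c)) \<and>
     (\<forall>c\<in>A. \<forall>c'\<in>A. smooth_on (chart_map c ` (chart_dom c \<inter> chart_dom c')) (transition c c'))"

definition smooth_function ::
  "('a, 'n::finite) chart set \<Rightarrow> ('a \<Rightarrow> real) \<Rightarrow> bool" where
  "smooth_function A f \<longleftrightarrow> (\<forall>c\<in>A. smooth_on (chart_ran c) (f \<circ> chart_inv c))"

text \<open>A tensor field is given by its coordinate expression in every chart.  The expression of a
  metric is a bilinear form \<open>G x\<close> depending on the coordinate point \<open>x\<close>, i.e.
  \<open>G x u v = \<Sum>\<^sub>i\<^sub>j g\<^sub>i\<^sub>j(x) u\<^sup>i v\<^sup>j\<close>; expressions in overlapping charts are related by the
  transformation law in the last clause of the following definition.\<close>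

type_synonym 'n bilin = "(real, 'n) vec \<Rightarrow> (real, 'n) vec \<Rightarrow> real"
type_synonym 'n metric = "(real, 'n) vec \<Rightarrow> 'n bilin"

definition riemannian_manifold ::
  "'a::{t2_space, second_countable_topology} set \<Rightarrow> ('a, 'n::finite) chart set \<Rightarrow>
   (('a, 'n) chart \<Rightarrow> 'n metric) \<Rightarrow> bool" where
  "riemannian_manifold M A g \<longleftrightarrow>
     smooth_manifold M A \<and>
     (\<forall>c\<in>A.
        (\<forall>u v. smooth_on (chart_ran c) (\<lambda>x. g c x u v)) \<and>
        (\<forall>x\<in>chart_ran c. bilinear (g c x) \<and> (\<forall>u v. g c x u v = g c x v u) \<and>
                         (\<forall>v. v \<noteq> 0 \<longrightarrow> g c x v v > 0))) \<and>
     (\<forall>c\<in>A. \<forall>c'\<in>A. \<forall>p \<in> chart_dom c \<inter> chart_dom c'.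
        let J = frechet_derivative (transition c c') (at (chart_map c p)) in
        \<forall>u v. g c (chart_map c p) u v = g c' (chart_map c' p) (J u) (J v))"


section \<open>Linear algebra in a tangent space\<close>

text \<open>Here \<open>b\<close> is the inner product on a single tangent space.\<close>

definition flat :: "'n bilin \<Rightarrow> real ^ 'n::finite \<Rightarrow> real ^ 'n \<Rightarrow> real" where
  "flat b v = (\<lambda>w. b v w)"

definition sharp :: "'n bilin \<Rightarrow> (real ^ 'n::finite \<Rightarrow> real) \<Rightarrow> real ^ 'n" where
  "sharp b \<alpha> = (THE v. \<forall>w. b v w = \<alpha> w)"

definition orthonormal_frame :: "'n bilin \<Rightarrow> ('n::finite \<Rightarrow> real ^ 'n) \<Rightarrow> bool" where
  "orthonormal_frame b e \<longleftrightarrow> (\<forall>i j. b (e i) (e j) = (if i = j then 1 else 0))"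

text \<open>Both traces below do not depend on the chosen frame.\<close>

definition some_frame :: "'n bilin \<Rightarrow> 'n::finite \<Rightarrow> real ^ 'n" where
  "some_frame b = (SOME e. orthonormal_frame b e)"

text \<open>Elements of (the fibre of) \<open>F = \<Lambda>\<^sup>2T\<^sup>*M \<otimes> TM\<close> are represented as alternating bilinear maps
  with values in the tangent space.\<close>

type_synonym 'n Fvec = "(real, 'n) vec \<Rightarrow> (real, 'n) vec \<Rightarrow> (real, 'n) vec"

text \<open>The induced inner product is the sum over \<open>i < j\<close> of the inner products of the values on
  \<open>(e\<^sub>i, e\<^sub>j)\<close>, which by antisymmetry is half of the full double sum.\<close>

definition F_inner :: "'n bilin \<Rightarrow> 'n::finite Fvec \<Rightarrow> 'n Fvec \<Rightarrow> real" where
  "F_inner b P Q =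
     (let e = some_frame b in
      1 / 2 * (\<Sum>i\<in>UNIV. \<Sum>j\<in>UNIV. b (P (e i) (e j)) (Q (e i) (e j))))"

definition vee ::
  "'n bilin \<Rightarrow> (real ^ 'n::finite \<Rightarrow> 'n Fvec) \<Rightarrow> (real ^ 'n \<Rightarrow> 'n Fvec) \<Rightarrow> real ^ 'n \<Rightarrow> real ^ 'n"
  where "vee b P Q x = sharp b (\<lambda>y. F_inner b (P x) (Q y))"

definition check ::
  "'n bilin \<Rightarrow> (real ^ 'n::finite \<Rightarrow> 'n Fvec) \<Rightarrow> real ^ 'n \<Rightarrow> real ^ 'n" where
  "check b P = vee b P P"


section \<open>Connection and curvature in a chart\<close>

text \<open>\<open>G\<close> is the coordinate expression of the metric.  Vector fields, one-forms and bilinear forms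
  are likewise functions of the coordinate point.  Tangent vectors are extended to vector fields
  with constant coefficients whenever a derivative has to be taken; the resulting expressions are
  tensorial.  \<open>christoffel G x u v\<close> is the vector \<open>\<Sum>\<^sub>i\<^sub>j\<^sub>k \<Gamma>\<^sup>k\<^sub>i\<^sub>j(x) u\<^sup>i v\<^sup>j \<partial>\<^sub>k\<close>.\<close>

definition christoffel :: "'n metric \<Rightarrow> real ^ 'n::finite \<Rightarrow> 'n Fvec" where
  "christoffel G x u v =
     sharp (G x) (\<lambda>w. 1 / 2 *
       (frechet_derivative (\<lambda>y. G y v w) (at x) u
      + frechet_derivative (\<lambda>y. G y u w) (at x) v
      - frechet_derivative (\<lambda>y. G y u v) (at x) w))"

text \<open>The Levi-Civita derivative of \<open>Y\<close> along \<open>X\<close>.\<close>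

definition nabla ::
  "'n metric \<Rightarrow> (real ^ 'n::finite \<Rightarrow> real ^ 'n) \<Rightarrow> (real ^ 'n \<Rightarrow> real ^ 'n) \<Rightarrow> real ^ 'n \<Rightarrow> real ^ 'n"
  where "nabla G X Y x = frechet_derivative Y (at x) (X x) + christoffel G x (X x) (Y x)"

definition lie_bracket ::
  "(real ^ 'n::finite \<Rightarrow> real ^ 'n) \<Rightarrow> (real ^ 'n \<Rightarrow> real ^ 'n) \<Rightarrow> real ^ 'n \<Rightarrow> real ^ 'n" where
  "lie_bracket X Y x = frechet_derivative Y (at x) (X x) - frechet_derivative X (at x) (Y x)"

definition nabla_oneform ::
  "'n metric \<Rightarrow> (real ^ 'n::finite \<Rightarrow> real ^ 'n \<Rightarrow> real) \<Rightarrow> real ^ 'n \<Rightarrow> 'n bilin" where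
  "nabla_oneform G \<alpha> x u v =
     frechet_derivative (\<lambda>y. \<alpha> y v) (at x) u - \<alpha> x (nabla G (\<lambda>_. u) (\<lambda>_. v) x)"

text \<open>\<open>nabla_form2 G T x u v w\<close> is \<open>(\<nabla>\<^sub>u T)(v, w)\<close>.\<close>

definition nabla_form2 ::
  "'n metric \<Rightarrow> (real ^ 'n::finite \<Rightarrow> 'n bilin) \<Rightarrow> real ^ 'n \<Rightarrow> real ^ 'n \<Rightarrow> 'n bilin" where
  "nabla_form2 G T x u v w =
     frechet_derivative (\<lambda>y. T y v w) (at x) u
     - T x (nabla G (\<lambda>_. u) (\<lambda>_. v) x) w - T x v (nabla G (\<lambda>_. u) (\<lambda>_. w) x)"

text \<open>Curvature endomorphism: \<open>Rm_op G x u v w\<close> is \<open>Rm(u, v)w\<close>.\<close>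

definition Rm_op ::
  "'n metric \<Rightarrow> real ^ 'n::finite \<Rightarrow> real ^ 'n \<Rightarrow> real ^ 'n \<Rightarrow> real ^ 'n \<Rightarrow> real ^ 'n" where
  "Rm_op G x u v w =
     (let U = (\<lambda>_. u); V = (\<lambda>_. v); W = (\<lambda>_. w) in
      - nabla G U (nabla G V W) x + nabla G V (nabla G U W) x + nabla G (lie_bracket U V) W x)"

definition Rm4 ::
  "'n metric \<Rightarrow> real ^ 'n::finite \<Rightarrow> real ^ 'n \<Rightarrow> real ^ 'n \<Rightarrow> real ^ 'n \<Rightarrow> real ^ 'n \<Rightarrow> real" where
  "Rm4 G x u v w z = G x (Rm_op G x u v w) z"

definition Ric :: "'n metric \<Rightarrow> real ^ 'n::finite \<Rightarrow> 'n bilin" where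
  "Ric G x y z = (let e = some_frame (G x) in \<Sum>i\<in>UNIV. Rm4 G x (e i) y (e i) z)"

text \<open>\<open>Rm\<close> as an element of \<open>Hom(TM, F)\<close>: \<open>w\<close> is sent to \<open>Rm(\<cdot>, \<cdot>, w, \<cdot>)\<close>, the last slot being
  turned into a tangent vector by the metric.\<close>

definition Rm :: "'n metric \<Rightarrow> real ^ 'n::finite \<Rightarrow> real ^ 'n \<Rightarrow> 'n Fvec" where
  "Rm G x w = (\<lambda>u v. sharp (G x) (Rm4 G x u v w))"

definition dRic :: "'n metric \<Rightarrow> real ^ 'n::finite \<Rightarrow> real ^ 'n \<Rightarrow> 'n bilin" where
  "dRic G p x y z = nabla_form2 G (Ric G) p x y z - nabla_form2 G (Ric G) p y x z"

definition dRic_F :: "'n metric \<Rightarrow> real ^ 'n::finite \<Rightarrow> 'n Fvec" where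
  "dRic_F G p = (\<lambda>x y. sharp (G p) (dRic G p x y))"

definition D_field :: "'n metric \<Rightarrow> real ^ 'n::finite \<Rightarrow> real ^ 'n \<Rightarrow> 'n Fvec" where
  "D_field G x = Rm G x \<circ> inv (check (G x) (Rm G x))"

definition K_field :: "'n metric \<Rightarrow> real ^ 'n::finite \<Rightarrow> real ^ 'n" where
  "K_field G x = sharp (G x) (\<lambda>v. F_inner (G x) (dRic_F G x) (D_field G x v))"

definition nabla_K :: "'n metric \<Rightarrow> real ^ 'n::finite \<Rightarrow> 'n bilin" where
  "nabla_K G = nabla_oneform G (\<lambda>x. flat (G x) (K_field G x))"

text \<open>\<open>\<nabla>\<^sup>2h = \<nabla>(dh)\<close> for a function \<open>h\<close> of the coordinates.\<close>

definition Hess :: "'n metric \<Rightarrow> (real ^ 'n::finite \<Rightarrow> real) \<Rightarrow> real ^ 'n \<Rightarrow> 'n bilin" where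
  "Hess G h = nabla_oneform G (\<lambda>x. frechet_derivative h (at x))"

end

theory Submission
  imports Defs
begin

text \<open>For a one-form \<open>a\<close> with \<open>Ric + \<nabla>a = \<mu>g\<close> the Ricci identity gives \<open>dRic = Rm(a\<^sup>\<sharp>)\<close> in \<open>F\<close>.  The field \<open>K\<close> is
  the vector with \<open>\<langle>Rm(K), Rm(w)\<rangle> = \<langle>dRic, Rm(w)\<rangle>\<close> for all \<open>w\<close>, so injectivity of \<open>Rm\<close> forces
  \<open>K = \<nabla>f\<close> whenever \<open>Ric + \<nabla>\<^sup>2f = \<mu>g\<close>.  Conversely, \<open>Ric + \<nabla>K = \<mu>g\<close> makes \<open>\<nabla>K\<close> symmetric because
  \<open>Ric\<close> is, hence the dual one-form of \<open>K\<close> is closed in every chart; it is the same form in all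
  charts by naturality of the Levi-Civita connection, and on a simply connected manifold its local
  primitives glue to a potential \<open>f\<close>, for which \<open>\<nabla>\<^sup>2f = \<nabla>K\<close>.\<close>

section \<open>Gluing local primitives on a simply connected space\<close>

text \<open>Three obstacles shape the development. Traces and \<open>F_inner\<close> use a frame
  picked by \<open>SOME\<close> separately at each point, so their smoothness cannot be read off;
  they are rewritten against the coordinate basis and its metric dual, a smooth field because
  \<open>sharp\<close> obeys Cramer's rule. Likewise the inverse of \<open>check\<close> in the
  definition of K is eliminated: K is a Riesz representative for the inner product
  \<open>Rm_form\<close>, and both its smoothness and its behaviour under maps follow from that.
  Next, tensors are given chart by chart, so that K is a single vector field needs proof; transition
  maps are isometries, and the transformation law is carried from \<open>christoffel\<close> through
  \<open>Rm_op\<close>, \<open>Ric\<close> and \<open>dRic\<close> to K. Finally, simple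
  connectedness speaks of merely continuous homotopies, along which a one-form cannot be integrated;
  instead the values of local primitives are continued along continuous maps from an interval or a
  square. This gluing is purely topological and is carried out for an abstract predicate.\<close>

locale local_primitives =
  fixes M :: "'a::topological_space set"
    and P :: "'a set \<Rightarrow> ('a \<Rightarrow> real) \<Rightarrow> bool"
  assumes openin_dom: "P V F \<Longrightarrow> openin (top_of_set M) V"
    and shift: "P V F \<Longrightarrow> P V (\<lambda>x. F x + c)"
    and cover: "p \<in> M \<Longrightarrow> \<exists>V F. P V F \<and> p \<in> V \<and> path_connected V"
    and germ: "P V F \<Longrightarrow> P V' F' \<Longrightarrow> p \<in> V \<Longrightarrow> p \<in> V' \<Longrightarrow> F p = F' p \<Longrightarrow>
       \<exists>W. openin (top_of_set M) W \<and> p \<in> W \<and> W \<subseteq> V \<inter> V' \<and> (\<forall>x\<in>W. F x = F' x)"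
begin

text \<open>Read \<open>P V F\<close> as: F is a primitive on V of one fixed closed one-form. Then h
  continues values of primitives along H; in other words it is a lift of H to the covering space of
  germs of primitives, which is never constructed. The conditions at z are listed separately because
  the filter \<open>at z within S\<close> leaves out z.\<close>

definition lift :: "'b::topological_space set \<Rightarrow> ('b \<Rightarrow> 'a) \<Rightarrow> ('b \<Rightarrow> real) \<Rightarrow> bool" where
  "lift S H h \<longleftrightarrow> (\<forall>z\<in>S. \<exists>V F. P V F \<and> H z \<in> V \<and> h z = F (H z) \<and>
      (\<forall>\<^sub>F w in at z within S. H w \<in> V \<and> h w = F (H w)))"

lemma liftD:
  assumes "lift S H h" "z \<in> S"
  obtains V F where "P V F" "H z \<in> V" "h z = F (H z)"
    "\<forall>\<^sub>F w in at z within S. H w \<in> V \<and> h w = F (H w)"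
  using assms unfolding lift_def by blast

lemma eventually_in_openin:
  assumes "continuous_on S H" "H ` S \<subseteq> M" "z \<in> S" "openin (top_of_set M) W" "H z \<in> W"
  shows "\<forall>\<^sub>F w in at z within S. H w \<in> W"
proof -
  obtain T where T: "open T" "W = M \<inter> T"
    using assms(4) by (auto simp: openin_open)
  have "(H \<longlongrightarrow> H z) (at z within S)"
    using assms(1,3) by (auto simp: continuous_on_def)
  then have "\<forall>\<^sub>F w in at z within S. H w \<in> T"
    using T assms(5) by (auto dest: topological_tendstoD)
  moreover have "\<forall>\<^sub>F w in at z within S. w \<in> S"
    by (simp add: eventually_at_filter)
  ultimately show ?thesis
    by eventually_elim (use T assms(2) in auto)
qed

lemma lift_subset:
  assumes "lift S H h" "T \<subseteq> S"
  shows "lift T H h"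
  unfolding lift_def
proof
  fix z assume "z \<in> T"
  then have "z \<in> S" using assms(2) by blast
  with assms(1) obtain V F where "P V F" "H z \<in> V" "h z = F (H z)"
    "\<forall>\<^sub>F w in at z within S. H w \<in> V \<and> h w = F (H w)"
    by (rule liftD)
  then show "\<exists>V F. P V F \<and> H z \<in> V \<and> h z = F (H z) \<and>
      (\<forall>\<^sub>F w in at z within T. H w \<in> V \<and> h w = F (H w))"
    using at_le[OF assms(2)] by (meson filter_leD)
qed

lemma lift_cong:
  assumes "lift S H h" "\<And>z. z \<in> S \<Longrightarrow> H z = H' z"
  shows "lift S H' h"
  unfolding lift_def
proof
  fix z assume z: "z \<in> S"
  have *: "\<forall>\<^sub>F w in at z within S. w \<in> S" by (simp add: eventually_at_filter)
  from assms(1) z obtain V F where F: "P V F" "H z \<in> V" "h z = F (H z)"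
    "\<forall>\<^sub>F w in at z within S. H w \<in> V \<and> h w = F (H w)"
    by (rule liftD)
  have "\<forall>\<^sub>F w in at z within S. H' w \<in> V \<and> h w = F (H' w)"
    using F(4) * by eventually_elim (use assms(2) in auto)
  with F assms(2)[OF z] show "\<exists>V F. P V F \<and> H' z \<in> V \<and> h z = F (H' z) \<and>
      (\<forall>\<^sub>F w in at z within S. H' w \<in> V \<and> h w = F (H' w))"
    by auto
qed

lemma lift_add_const:
  assumes "lift S H h"
  shows "lift S H (\<lambda>z. h z + c)"
  unfolding lift_def
proof
  fix z assume "z \<in> S"
  with assms obtain V F where F: "P V F" "H z \<in> V" "h z = F (H z)"
    "\<forall>\<^sub>F w in at z within S. H w \<in> V \<and> h w = F (H w)"
    by (rule liftD)
  have "\<forall>\<^sub>F w in at z within S. H w \<in> V \<and> h w + c = F (H w) + c"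
    using F(4) by eventually_elim auto
  with F shift[OF F(1), of c] show "\<exists>V F. P V F \<and> H z \<in> V \<and> h z + c = F (H z) \<and>
      (\<forall>\<^sub>F w in at z within S. H w \<in> V \<and> h w + c = F (H w))"
    by (intro exI[of _ V] exI[of _ "\<lambda>x. F x + c"]) simp
qed

lemma lift_compose:
  assumes "lift S H h" "continuous_on T k" "k ` T \<subseteq> S"
  shows "lift T (H \<circ> k) (h \<circ> k)"
  unfolding lift_def
proof
  fix z assume z: "z \<in> T"
  then have "k z \<in> S" using assms(3) by blast
  with assms(1) obtain V F where F: "P V F" "H (k z) \<in> V" "h (k z) = F (H (k z))"
    "\<forall>\<^sub>F w in at (k z) within S. H w \<in> V \<and> h w = F (H w)"
    by (rule liftD)
  then obtain U where U: "open U" "k z \<in> U"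
    "\<forall>w\<in>U. w \<noteq> k z \<longrightarrow> w \<in> S \<longrightarrow> H w \<in> V \<and> h w = F (H w)"
    unfolding eventually_at_topological by blast
  have "(k \<longlongrightarrow> k z) (at z within T)"
    using assms(2) z by (auto simp: continuous_on_def)
  then have "\<forall>\<^sub>F w in at z within T. k w \<in> U"
    using U by (auto dest: topological_tendstoD)
  moreover have "\<forall>\<^sub>F w in at z within T. w \<in> T"
    by (simp add: eventually_at_filter)
  ultimately have "\<forall>\<^sub>F w in at z within T. (H \<circ> k) w \<in> V \<and> (h \<circ> k) w = F ((H \<circ> k) w)"
    by eventually_elim (use U F assms(3) in \<open>auto simp: image_subset_iff\<close>)
  with F show "\<exists>V F. P V F \<and> (H \<circ> k) z \<in> V \<and> (h \<circ> k) z = F ((H \<circ> k) z) \<and>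
      (\<forall>\<^sub>F w in at z within T. (H \<circ> k) w \<in> V \<and> (h \<circ> k) w = F ((H \<circ> k) w))"
    by auto
qed

text \<open>By \<open>shift\<close> and \<open>germ\<close> two local primitives around
  \<open>H z\<close> differ by a constant near it, so \<open>h - h'\<close> is locally constant,
  hence constant on a connected set.\<close>

lemma lift_unique:
  assumes S: "connected S" "continuous_on S H" "H ` S \<subseteq> M"
    and h: "lift S H h" "lift S H h'" and ab: "a \<in> S" "b \<in> S"
  shows "h a - h' a = h b - h' b"
proof (rule connected_local_const[OF S(1) ab], intro ballI)
  fix z assume z: "z \<in> S"
  obtain V F where F: "P V F" "H z \<in> V" "h z = F (H z)"
    "\<forall>\<^sub>F w in at z within S. H w \<in> V \<and> h w = F (H w)"
    using h(1) z by (rule liftD)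
  obtain V' F' where F': "P V' F'" "H z \<in> V'" "h' z = F' (H z)"
    "\<forall>\<^sub>F w in at z within S. H w \<in> V' \<and> h' w = F' (H w)"
    using h(2) z by (rule liftD)
  obtain W where W: "openin (top_of_set M) W" "H z \<in> W"
      "\<forall>x\<in>W. F x = F' x + (h z - h' z)"
    using germ[OF F(1) shift[OF F'(1)] F(2) F'(2), of "h z - h' z"] F(3) F'(3) by auto
  have "\<forall>\<^sub>F w in at z within S. H w \<in> W"
    using eventually_in_openin S z W by blast
  with F(4) F'(4) show "\<forall>\<^sub>F w in at z within S. h z - h' z = h w - h' w"
    by eventually_elim (use W in auto)
qed

text \<open>On the connected overlap the two lifts differ by one constant, which is absorbed into
  the second. Closedness gives a point outside one of the sets a neighbourhood missing that set, so
  only points of the overlap see both lifts.\<close>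

lemma lift_glue:
  assumes S: "closed S" "closed T" "connected (S \<inter> T)"
    and H: "continuous_on (S \<union> T) H" "H ` (S \<union> T) \<subseteq> M"
    and h: "lift S H h" "lift T H h'"
  shows "\<exists>k. lift (S \<union> T) H k"
proof -
  have "\<exists>c. \<forall>z\<in>S \<inter> T. h z = h' z + c"
  proof (cases "S \<inter> T = {}")
    case False
    then obtain a where a: "a \<in> S \<inter> T" by blast
    have "h z = h' z + (h a - h' a)" if "z \<in> S \<inter> T" for z
    proof -
      have "h a - h' a = h z - h' z"
        using H
        by (intro lift_unique[OF S(3) _ _ _ _ a that, of H] lift_subset[OF h(1)] lift_subset[OF h(2)])
          (auto intro: continuous_on_subset)
      then show ?thesis by simp
    qed
    then show ?thesis by blast
  qed auto
  then obtain c where c: "\<And>z. z \<in> S \<Longrightarrow> z \<in> T \<Longrightarrow> h z = h' z + c" by blast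
  define k where "k z = (if z \<in> S then h z else h' z + c)" for z
  have kT: "k z = h' z + c" if "z \<in> T" for z
    using c that by (auto simp: k_def)
  have kS: "k z = h z" if "z \<in> S" for z
    using that by (auto simp: k_def)
  have inS: "\<forall>\<^sub>F w in at z within S. w \<in> S" and inT: "\<forall>\<^sub>F w in at z within T. w \<in> T" for z
    by (simp_all add: eventually_at_filter)
  have lS: "lift S H k"
  proof -
    { fix z assume z: "z \<in> S"
      obtain V F where F: "P V F" "H z \<in> V" "h z = F (H z)"
        "\<forall>\<^sub>F w in at z within S. H w \<in> V \<and> h w = F (H w)"
        using h(1) z by (rule liftD)
      have "\<forall>\<^sub>F w in at z within S. H w \<in> V \<and> k w = F (H w)"
        using F(4) inS by eventually_elim (auto simp: kS)
      then have "\<exists>V F. P V F \<and> H z \<in> V \<and> k z = F (H z) \<and>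
          (\<forall>\<^sub>F w in at z within S. H w \<in> V \<and> k w = F (H w))"
        using F kS[OF z] by auto }
    then show ?thesis by (simp add: lift_def)
  qed
  have lT: "lift T H k"
  proof -
    { fix z assume z: "z \<in> T"
      obtain V F where F: "P V F" "H z \<in> V" "h' z + c = F (H z)"
        "\<forall>\<^sub>F w in at z within T. H w \<in> V \<and> h' w + c = F (H w)"
        using lift_add_const[OF h(2)] z by (rule liftD)
      have "\<forall>\<^sub>F w in at z within T. H w \<in> V \<and> k w = F (H w)"
        using F(4) inT by eventually_elim (auto simp: kT)
      then have "\<exists>V F. P V F \<and> H z \<in> V \<and> k z = F (H z) \<and>
          (\<forall>\<^sub>F w in at z within T. H w \<in> V \<and> k w = F (H w))"
        using F kT[OF z] by auto }
    then show ?thesis by (simp add: lift_def)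
  qed
  have "lift (S \<union> T) H k"
    unfolding lift_def
  proof
    fix z assume "z \<in> S \<union> T"
    then consider "z \<in> S" "z \<in> T" | "z \<in> S" "z \<notin> T" | "z \<in> T" "z \<notin> S" by blast
    then show "\<exists>V F. P V F \<and> H z \<in> V \<and> k z = F (H z) \<and>
        (\<forall>\<^sub>F w in at z within S \<union> T. H w \<in> V \<and> k w = F (H w))"
    proof cases
      case 1
      obtain V F where F: "P V F" "H z \<in> V" "k z = F (H z)"
        "\<forall>\<^sub>F w in at z within S. H w \<in> V \<and> k w = F (H w)"
        using lS 1(1) by (rule liftD)
      obtain V' F' where F': "P V' F'" "H z \<in> V'" "k z = F' (H z)"
        "\<forall>\<^sub>F w in at z within T. H w \<in> V' \<and> k w = F' (H w)"
        using lT 1(2) by (rule liftD)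
      \<comment> \<open>Both primitives take the value \<open>k z\<close> at \<open>H z\<close>, so
        they agree on W and F alone serves for both sides.\<close>
      obtain W where W: "openin (top_of_set M) W" "H z \<in> W" "W \<subseteq> V \<inter> V'" "\<forall>x\<in>W. F x = F' x"
        using germ[OF F(1) F'(1) F(2) F'(2)] F(3) F'(3) by auto
      have "\<forall>\<^sub>F w in at z within T. H w \<in> W"
        using H W 1(2)
        by (intro eventually_in_openin[where W = W]) (auto intro: continuous_on_subset)
      with F'(4) have "\<forall>\<^sub>F w in at z within T. H w \<in> V \<and> k w = F (H w)"
        by eventually_elim (use W in auto)
      with F show ?thesis
        by (auto simp: at_within_union eventually_sup)
    next
      case 2
      have "\<forall>\<^sub>F w in at z within T. False"
        unfolding eventually_at_topological
        by (rule exI[of _ "-T"]) (use 2 S in auto)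
      then have "at z within T = bot" by (simp add: trivial_limit_def)
      then show ?thesis
        using lS 2 by (simp add: lift_def at_within_union)
    next
      case 3
      have "\<forall>\<^sub>F w in at z within S. False"
        unfolding eventually_at_topological
        by (rule exI[of _ "-S"]) (use 3 S in auto)
      then have "at z within S = bot" by (simp add: trivial_limit_def)
      then show ?thesis
        using lT 3 by (simp add: lift_def at_within_union)
    qed
  qed
  then show ?thesis by blast
qed

text \<open>One primitive F around \<open>H z\<close> already gives the lift
  \<open>F \<circ> H\<close> on a neighbourhood of z.\<close>

lemma lift_local:
  assumes H: "continuous_on S H" "H ` S \<subseteq> M" and z: "z \<in> S"
  obtains U h where "open U" "z \<in> U" "lift (S \<inter> U) H h"
proof -
  obtain V F where F: "P V F" "H z \<in> V" using cover H z by blast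
  have "\<forall>\<^sub>F w in at z within S. H w \<in> V"
    using eventually_in_openin H z openin_dom F by blast
  then obtain U where U: "open U" "z \<in> U" "\<forall>w\<in>U. w \<noteq> z \<longrightarrow> w \<in> S \<longrightarrow> H w \<in> V"
    unfolding eventually_at_topological by blast
  have V: "H w \<in> V" if "w \<in> S \<inter> U" for w
    using that U F by (cases "w = z") auto
  have "lift (S \<inter> U) H (F \<circ> H)"
    unfolding lift_def
  proof
    fix w assume w: "w \<in> S \<inter> U"
    have "\<forall>\<^sub>F w' in at w within S \<inter> U. H w' \<in> V \<and> (F \<circ> H) w' = F (H w')"
      using V by (auto simp: eventually_at_filter)
    with F V[OF w] show "\<exists>V' F'. P V' F' \<and> H w \<in> V' \<and> (F \<circ> H) w = F' (H w) \<and>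
        (\<forall>\<^sub>F w' in at w within S \<inter> U. H w' \<in> V' \<and> (F \<circ> H) w' = F' (H w'))"
      by fastforce
  qed
  with U that show ?thesis by blast
qed

text \<open>Subdivision is replaced by two nested applications of the bisection principle
  \<open>Bolzano\<close>, one for each side of the square.\<close>

lemma lift_square_exists:
  fixes H :: "real \<times> real \<Rightarrow> 'a"
  assumes H: "continuous_on ({0..1} \<times> {0..1}) H" "H ` ({0..1} \<times> {0..1}) \<subseteq> M"
  shows "\<exists>h. lift ({0..1} \<times> {0..1}) H h"
proof -
  \<comment> \<open>Cutting down to the unit interval lets the bisection speak of arbitrary
    intervals around a point, including those that stick out of the square.\<close>
  define I where "I a b = {a..b} \<inter> {0..1::real}" for a b
  define good where "good a b c d \<longleftrightarrow> (\<exists>h. lift (I a b \<times> I c d) H h)" for a b c d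
  have I_un: "I a c = I a b \<union> I b c" if "a \<le> b" "b \<le> c" for a b c
    using that by (auto simp: I_def)
  have I_conn: "connected (I a b)" "closed (I a b)" for a b
    by (auto simp: I_def intro!: convex_connected convex_Int closed_Int)
  have I01: "I a b \<subseteq> {0..1}" for a b by (auto simp: I_def)
  have rect: "continuous_on X H" "H ` X \<subseteq> M" if "X \<subseteq> {0..1} \<times> {0..1}" for X
    using that H by (auto intro: continuous_on_subset)
  \<comment> \<open>Two rectangles stacked on each other meet in a common edge or not at all, so the
    overlap is connected and \<open>lift_glue\<close> applies.\<close>
  have vert: "good a b c e" if "good a b c d" "good a b d e" "c \<le> d" "d \<le> e" for a b c d e
  proof -
    have eq: "I a b \<times> I c e = I a b \<times> I c d \<union> I a b \<times> I d e"
      using I_un[of c d e] that by auto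
    have con: "connected (I a b \<times> I c d \<inter> I a b \<times> I d e)"
    proof -
      have "I a b \<times> I c d \<inter> I a b \<times> I d e = I a b \<times> (I c d \<inter> I d e)" by auto
      also have "I c d \<inter> I d e = {d..d} \<inter> {0..1}" using that by (auto simp: I_def)
      finally show ?thesis
        by (auto intro!: connected_Times I_conn convex_connected convex_Int)
    qed
    show ?thesis
      using that(1,2) unfolding good_def eq
      by (elim exE, intro lift_glue[OF _ _ con] rect)
        (use I01 in \<open>auto intro: closed_Times I_conn\<close>)
  qed
  have horiz: "good a e c d" if "good a b c d" "good b e c d" "a \<le> b" "b \<le> e" for a b c d e
  proof -
    have eq: "I a e \<times> I c d = I a b \<times> I c d \<union> I b e \<times> I c d"
      using I_un[of a b e] that by auto
    have con: "connected (I a b \<times> I c d \<inter> I b e \<times> I c d)"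
    proof -
      have "I a b \<times> I c d \<inter> I b e \<times> I c d = (I a b \<inter> I b e) \<times> I c d" by auto
      also have "I a b \<inter> I b e = {b..b} \<inter> {0..1}" using that by (auto simp: I_def)
      finally show ?thesis
        by (auto intro!: connected_Times I_conn convex_connected convex_Int)
    qed
    show ?thesis
      using that(1,2) unfolding good_def eq
      by (elim exE, intro lift_glue[OF _ _ con] rect)
        (use I01 in \<open>auto intro: closed_Times I_conn\<close>)
  qed
  have loc: "\<exists>d>0. \<forall>a b a' b'. a \<le> x \<and> x \<le> b \<and> b - a < d \<and> a' \<le> y \<and> y \<le> b' \<and> b' - a' < d
      \<longrightarrow> good a b a' b'" if "x \<in> {0..1}" "y \<in> {0..1}" for x y
  proof -
    have "(x, y) \<in> {0..1} \<times> {0..1}" using that by simp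
    with H obtain U h where U: "open U" "(x,y) \<in> U" "lift ({0..1} \<times> {0..1} \<inter> U) H h"
      by (rule lift_local)
    then obtain X Y where XY: "open X" "open Y" "x \<in> X" "y \<in> Y" "X \<times> Y \<subseteq> U"
      using open_prod_elim[OF U(1,2)] by (metis mem_Sigma_iff)
    obtain d1 where d1: "d1 > 0" "ball x d1 \<subseteq> X"
      using XY(1,3) by (rule openE)
    obtain d2 where d2: "d2 > 0" "ball y d2 \<subseteq> Y"
      using XY(2,4) by (rule openE)
    note d = d1 d2
    show ?thesis
    proof (rule exI[of _ "min d1 d2"], intro conjI allI impI)
      fix a b a' b' assume *: "a \<le> x \<and> x \<le> b \<and> b - a < min d1 d2 \<and> a' \<le> y \<and> y \<le> b' \<and> b' - a' < min d1 d2"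
      have "{a..b} \<subseteq> ball x d1" using * by (auto simp: dist_real_def)
      moreover have "{a'..b'} \<subseteq> ball y d2" using * by (auto simp: dist_real_def)
      ultimately have "{a..b} \<subseteq> X" "{a'..b'} \<subseteq> Y" using d by auto
      then have "I a b \<times> I a' b' \<subseteq> {0..1} \<times> {0..1} \<inter> U"
        using XY unfolding I_def by blast
      then show "good a b a' b'" unfolding good_def using U lift_subset by blast
    qed (use d in auto)
  qed
  \<comment> \<open>For fixed x the bisection runs over the second coordinate. The admissible width
    d depends on the vertical interval, and joining two intervals keeps the smaller width.\<close>
  have strip: "\<exists>d>0. \<forall>a b. a \<le> x \<and> x \<le> b \<and> b - a < d \<longrightarrow> good a b 0 1" if x: "0 \<le> x" "x \<le> 1" for x
  proof (rule Bolzano[of 0 1 "\<lambda>c e. \<exists>d>0. \<forall>a b. a \<le> x \<and> x \<le> b \<and> b - a < d \<longrightarrow> good a b c e"])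
    fix c e f :: real
    assume "\<exists>d>0. \<forall>a b. a \<le> x \<and> x \<le> b \<and> b - a < d \<longrightarrow> good a b c e"
      and "\<exists>d>0. \<forall>a b. a \<le> x \<and> x \<le> b \<and> b - a < d \<longrightarrow> good a b e f" and le: "c \<le> e" "e \<le> f"
    then obtain d1 d2 where "d1 > 0" "\<forall>a b. a \<le> x \<and> x \<le> b \<and> b - a < d1 \<longrightarrow> good a b c e"
       "d2 > 0" "\<forall>a b. a \<le> x \<and> x \<le> b \<and> b - a < d2 \<longrightarrow> good a b e f" by blast
    then show "\<exists>d>0. \<forall>a b. a \<le> x \<and> x \<le> b \<and> b - a < d \<longrightarrow> good a b c f"
      by (intro exI[of _ "min d1 d2"]) (auto intro: vert[OF _ _ le])
  next
    fix y :: real assume "0 \<le> y" "y \<le> 1"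
    then obtain d where "d > 0"
       "\<And>a b a' b'. a \<le> x \<Longrightarrow> x \<le> b \<Longrightarrow> b - a < d \<Longrightarrow> a' \<le> y \<Longrightarrow> y \<le> b' \<Longrightarrow> b' - a' < d \<Longrightarrow> good a b a' b'"
      using loc[of x y] x by auto
    then show "\<exists>d>0. \<forall>a b. a \<le> y \<and> y \<le> b \<and> b - a < d \<longrightarrow>
         (\<exists>d>0. \<forall>a' b'. a' \<le> x \<and> x \<le> b' \<and> b' - a' < d \<longrightarrow> good a' b' a b)"
      by blast
  qed auto
  have "good 0 1 0 1"
  proof (rule Bolzano[of 0 1 "\<lambda>a b. good a b 0 1"])
    show "good a e 0 1" if "good a b 0 1" "good b e 0 1" "a \<le> b" "b \<le> e" for a b e
      using that by (rule horiz)
    show "\<exists>d>0. \<forall>a b. a \<le> x \<and> x \<le> b \<and> b - a < d \<longrightarrow> good a b 0 1" if "0 \<le> x" "x \<le> 1" for x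
      using that by (rule strip)
  qed simp
  then show ?thesis by (simp add: good_def I_def)
qed

section \<open>Continuation along paths and loops\<close>

lemma lift_path_exists:
  fixes \<gamma> :: "real \<Rightarrow> 'a"
  assumes \<gamma>: "continuous_on {0..1} \<gamma>" "\<gamma> ` {0..1} \<subseteq> M"
  shows "\<exists>h. lift {0..1} \<gamma> h"
proof -
  \<comment> \<open>The path is treated as a square that is constant in the second
    coordinate.\<close>
  have "continuous_on ({0..1} \<times> {0..1::real}) (\<gamma> \<circ> fst)"
    by (rule continuous_on_compose) (auto intro: continuous_on_subset[OF \<gamma>(1)] continuous_intros)
  moreover have "(\<gamma> \<circ> fst) ` ({0..1} \<times> {0..1::real}) \<subseteq> M" using \<gamma>(2) by auto
  ultimately have "\<exists>h. lift ({0..1} \<times> {0..1::real}) (\<gamma> \<circ> fst) h"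
    by (rule lift_square_exists)
  then obtain h where "lift ({0..1} \<times> {0..1::real}) (\<gamma> \<circ> fst) h" ..
  then have "lift {0..1} ((\<gamma> \<circ> fst) \<circ> (\<lambda>t. (t, 0::real))) (h \<circ> (\<lambda>t. (t, 0)))"
    by (rule lift_compose) (auto intro!: continuous_intros)
  then show ?thesis by (auto simp: o_def)
qed

lemma lift_const_path:
  assumes "lift S (\<lambda>_. p) h" "connected S" "p \<in> M" "a \<in> S" "b \<in> S"
  shows "h a = h b"
proof -
  obtain V F where "P V F" "p \<in> V" using cover assms by blast
  then have "lift S (\<lambda>_. p) (\<lambda>_. F p)"
    unfolding lift_def by (intro ballI exI[of _ V] exI[of _ F]) simp
  from lift_unique[OF assms(2) _ _ assms(1) this assms(4,5)] assms(3) show ?thesis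
    by auto
qed

text \<open>A null homotopy H of the loop is lifted over the square; in \<open>H (s, t)\<close> the
  variable s is the homotopy parameter. The edges \<open>t = 0\<close> and \<open>t = 1\<close>
  carry the same path, so the lift has the same increment on both; the edge \<open>s = 1\<close>
  carries a constant path and has increment zero. Going round the boundary leaves increment zero for
  the edge \<open>s = 0\<close>, which is the loop.\<close>

lemma lift_loop:
  assumes sc: "simply_connected M"
    and \<gamma>: "path \<gamma>" "path_image \<gamma> \<subseteq> M" "pathstart \<gamma> = pathfinish \<gamma>"
    and h: "lift {0..1} \<gamma> h"
  shows "h 0 = h 1"
proof -
  define p where "p = \<gamma> 0"
  have p: "p \<in> M" using \<gamma>(2) by (auto simp: p_def path_image_def)
  have "homotopic_loops M \<gamma> (\<lambda>_. p)"
  proof -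
    have "path (\<lambda>_. p)" "path_image (\<lambda>_. p) \<subseteq> M" "pathfinish (\<lambda>_. p) = pathstart (\<lambda>_. p)"
      using p by (auto simp: path_def path_image_def pathstart_def pathfinish_def)
    then show ?thesis
      using sc \<gamma> unfolding simply_connected_def by simp
  qed
  then obtain H where H: "continuous_on ({0..1} \<times> {0..1}) H" "H ` ({0..1::real} \<times> {0..1}) \<subseteq> M"
      "\<forall>t\<in>{0..1}. H (0, t) = \<gamma> t" "\<forall>t\<in>{0..1}. H (1, t) = p"
      "\<forall>s\<in>{0..1}. H (s, 0) = H (s, 1)"
    unfolding homotopic_loops pathstart_def pathfinish_def by (fastforce simp: image_subset_iff_funcset)
  obtain k where k: "lift ({0..1} \<times> {0..1}) H k"
    using lift_square_exists[OF H(1,2)] ..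
  have comp: "lift {0..1} (H \<circ> j) (k \<circ> j)" "continuous_on {0..1} (H \<circ> j)" "(H \<circ> j) ` {0..1} \<subseteq> M"
    if "continuous_on {0..1} j" "j ` {0..1} \<subseteq> {0..1} \<times> {0..1}" for j :: "real \<Rightarrow> real \<times> real"
  proof -
    show "lift {0..1} (H \<circ> j) (k \<circ> j)" using lift_compose[OF k that] .
    show "continuous_on {0..1} (H \<circ> j)"
      using that by (intro continuous_on_compose) (auto intro: continuous_on_subset[OF H(1)])
    show "(H \<circ> j) ` {0..1} \<subseteq> M"
      using that H(2) unfolding image_comp[symmetric] by blast
  qed
  have l0: "lift {0..1} (H \<circ> Pair 0) (k \<circ> Pair 0)"
    by (rule comp; auto intro!: continuous_intros)+
  have l1: "lift {0..1} (H \<circ> Pair 1) (k \<circ> Pair 1)"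
    by (rule comp; auto intro!: continuous_intros)+
  have lb: "lift {0..1} (H \<circ> (\<lambda>s. (s,0))) (k \<circ> (\<lambda>s. (s,0)))"
    and cb: "continuous_on {0..1} (H \<circ> (\<lambda>s. (s,0)))" "(H \<circ> (\<lambda>s. (s,0))) ` {0..1} \<subseteq> M"
    by (rule comp; auto intro!: continuous_intros)+
  have lt: "lift {0..1} (H \<circ> (\<lambda>s. (s,1))) (k \<circ> (\<lambda>s. (s,1)))"
    by (rule comp; auto intro!: continuous_intros)+
  have "lift {0..1} \<gamma> (k \<circ> Pair 0)"
    by (rule lift_cong[OF l0]) (use H in auto)
  then have "h 0 - (k \<circ> Pair 0) 0 = h 1 - (k \<circ> Pair 0) 1"
    using \<gamma> by (intro lift_unique[OF _ _ _ h, of "k \<circ> Pair 0"]) (auto simp: path_def path_image_def)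
  moreover have "lift {0..1} (\<lambda>_. p) (k \<circ> Pair 1)"
    by (rule lift_cong[OF l1]) (use H in auto)
  then have "(k \<circ> Pair 1) 0 = (k \<circ> Pair 1) 1"
    by (rule lift_const_path[OF _ _ p]) auto
  moreover have "lift {0..1} (H \<circ> (\<lambda>s. (s,0))) (k \<circ> (\<lambda>s. (s,1)))"
    by (rule lift_cong[OF lt]) (use H in auto)
  then have "(k \<circ> (\<lambda>s. (s,0))) 0 - (k \<circ> (\<lambda>s. (s,1))) 0 = (k \<circ> (\<lambda>s. (s,0))) 1 - (k \<circ> (\<lambda>s. (s,1))) 1"
    by (intro lift_unique[OF _ cb lb, of "k \<circ> (\<lambda>s. (s, 1))"]) auto
  ultimately show ?thesis by simp
qed

text \<open>\<open>simply_connected\<close> makes any two loops homotopic as loops, in particular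
  two constant ones; the track of a single parameter value is a path between them.\<close>

lemma path_connected_M:
  assumes "simply_connected M"
  shows "path_connected M"
  unfolding path_connected_def
proof (intro ballI)
  fix x y assume xy: "x \<in> M" "y \<in> M"
  have "path (\<lambda>_. p)" "path_image (\<lambda>_. p) \<subseteq> M" "pathfinish (\<lambda>_. p) = pathstart (\<lambda>_. p)"
    if "p \<in> M" for p
    using that by (auto simp: path_def path_image_def pathstart_def pathfinish_def)
  then have "homotopic_loops M (\<lambda>_. x) (\<lambda>_. y)"
    using assms xy unfolding simply_connected_def by simp
  then obtain H where H: "continuous_on ({0..1} \<times> {0..1}) H" "H ` ({0..1::real} \<times> {0..1}) \<subseteq> M"
      "\<forall>t\<in>{0..1}. H (0, t) = x" "\<forall>t\<in>{0..1::real}. H (1, t) = y"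
    unfolding homotopic_loops by (fastforce simp: image_subset_iff_funcset)
  have "continuous_on {0..1} (H \<circ> (\<lambda>s. (s, 0)))"
    by (intro continuous_on_compose continuous_on_subset[OF H(1)]) (auto intro!: continuous_intros)
  then have "path (H \<circ> (\<lambda>s. (s, 0)))" by (simp add: path_def)
  moreover have "path_image (H \<circ> (\<lambda>s. (s, 0))) \<subseteq> M"
    using H(2) by (auto simp: path_image_def)
  moreover have "pathstart (H \<circ> (\<lambda>s. (s, 0))) = x" "pathfinish (H \<circ> (\<lambda>s. (s, 0))) = y"
    using H(3,4) by (auto simp: pathstart_def pathfinish_def)
  ultimately show "\<exists>g. path g \<and> path_image g \<subseteq> M \<and> pathstart g = x \<and> pathfinish g = y"
    by blast
qed

text \<open>The value f p is the increment of a lift along a chosen path from a base point to p. The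
  choice may jump with p, but the loop made of the chosen path to p, a path inside V from p to q and
  the chosen path to q backwards has increment zero by \<open>lift_loop\<close>, which forces f to
  differ from F by a constant on V.\<close>

lemma global_primitive:
  assumes sc: "simply_connected M"
  shows "\<exists>f. \<forall>p\<in>M. \<exists>V F. P V F \<and> p \<in> V \<and> (\<forall>q\<in>V. f q = F q)"
proof (cases "M = {}")
  case False
  then obtain p0 where p0: "p0 \<in> M" by blast
  have "\<forall>p. \<exists>\<gamma>. p \<in> M \<longrightarrow> path \<gamma> \<and> path_image \<gamma> \<subseteq> M \<and> pathstart \<gamma> = p0 \<and> pathfinish \<gamma> = p"
    using path_connected_M[OF sc] p0 unfolding path_connected_def by blast
  then obtain \<gamma> where \<gamma>: "\<And>p. p \<in> M \<Longrightarrow> path (\<gamma> p)" "\<And>p. p \<in> M \<Longrightarrow> path_image (\<gamma> p) \<subseteq> M"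
      "\<And>p. p \<in> M \<Longrightarrow> pathstart (\<gamma> p) = p0" "\<And>p. p \<in> M \<Longrightarrow> pathfinish (\<gamma> p) = p"
    by metis
  have "\<exists>h. lift {0..1} (\<gamma> p) h" if "p \<in> M" for p
    using \<gamma>(1,2)[OF that] by (intro lift_path_exists) (auto simp: path_def path_image_def)
  then obtain h where h: "\<And>p. p \<in> M \<Longrightarrow> lift {0..1} (\<gamma> p) (h p)"
    by metis
  define f where "f p = h p 1 - h p 0" for p
  have "\<exists>V F. P V F \<and> p \<in> V \<and> (\<forall>q\<in>V. f q = F q)" if p: "p \<in> M" for p
  proof -
    obtain V F where F: "P V F" "p \<in> V" "path_connected V"
      using cover[OF p] by blast
    have VM: "V \<subseteq> M" using openin_dom[OF F(1)] by (simp add: openin_imp_subset)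
    have "f q = F q + (f p - F p)" if q: "q \<in> V" for q
    proof -
      have qM: "q \<in> M" using q VM by blast
      obtain \<delta> where \<delta>: "path \<delta>" "path_image \<delta> \<subseteq> V" "pathstart \<delta> = p" "pathfinish \<delta> = q"
        using F(2,3) q unfolding path_connected_def by blast
      let ?a = "\<gamma> p +++ \<delta>"
      \<comment> \<open>The nested join runs through \<open>\<gamma> p\<close> on [0, 1/4], through
        \<open>\<delta>\<close> on [1/4, 1/2] and through the reverse of \<open>\<gamma> q\<close>
        on [1/2, 1]. This fixes the reparametrisations \<open>t/4\<close>, \<open>1/4 + t/4\<close>
        and \<open>1 - t/2\<close> below, the last of which runs along \<open>\<gamma> q\<close>
        forwards.\<close>
      let ?l = "?a +++ reversepath (\<gamma> q)"
      have l: "path ?l" "pathstart ?l = pathfinish ?l"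
        using \<gamma>[OF p] \<gamma>[OF qM] \<delta> by auto
      have lM: "path_image ?l \<subseteq> M"
        using \<gamma>[OF p] \<gamma>[OF qM] \<delta> VM by (intro subset_path_image_join) auto
      have "\<exists>k. lift {0..1} ?l k"
        using l(1) lM by (intro lift_path_exists) (simp_all add: path_def path_image_def)
      then obtain k where k: "lift {0..1} ?l k" ..
      have k01: "k 0 = k 1" using sc l(1) lM l(2) k by (rule lift_loop)
      \<comment> \<open>Restricting k to a piece of the loop gives a lift of that piece, so by
        uniqueness its increment can be computed with any other lift g.\<close>
      have seg: "k (s 0) - k (s 1) = g 0 - g 1"
        if "continuous_on {0..1} s" "s ` {0..1} \<subseteq> {0..1}" "path \<beta>" "path_image \<beta> \<subseteq> M"
          "lift {0..1} \<beta> g" "\<And>t. t \<in> {0..1} \<Longrightarrow> ?l (s t) = \<beta> t" for s \<beta> g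
      proof -
        have "lift {0..1} (?l \<circ> s) (k \<circ> s)"
          using k that(1,2) by (rule lift_compose)
        then have "lift {0..1} \<beta> (k \<circ> s)"
          by (rule lift_cong) (use that(6) in auto)
        then have "(k \<circ> s) 0 - g 0 = (k \<circ> s) 1 - g 1"
          using that(3-5)
          by (intro lift_unique[of "{0..1}" \<beta> "k \<circ> s" g]) (auto simp: path_def path_image_def)
        then show ?thesis by simp
      qed
      have "lift {0..1} \<delta> (F \<circ> \<delta>)"
        unfolding lift_def
      proof
        fix z :: real assume z: "z \<in> {0..1}"
        have "\<forall>\<^sub>F w in at z within {0..1}. w \<in> {0..1}" by (simp add: eventually_at_filter)
        then have "\<forall>\<^sub>F w in at z within {0..1}. \<delta> w \<in> V \<and> (F \<circ> \<delta>) w = F (\<delta> w)"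
          by eventually_elim (use \<delta>(2) in \<open>auto simp: path_image_def\<close>)
        then show "\<exists>V F'. P V F' \<and> \<delta> z \<in> V \<and> (F \<circ> \<delta>) z = F' (\<delta> z) \<and>
            (\<forall>\<^sub>F w in at z within {0..1}. \<delta> w \<in> V \<and> (F \<circ> \<delta>) w = F' (\<delta> w))"
          using F(1) \<delta>(2) z by (intro exI[of _ V] exI[of _ F]) (auto simp: path_image_def)
      qed
      then have "k (1/4 + 0/4) - k (1/4 + 1/4) = (F \<circ> \<delta>) 0 - (F \<circ> \<delta>) 1"
        using \<delta> VM \<gamma>(4)[OF p]
        by (intro seg[of "\<lambda>t. 1/4 + t/4" \<delta> "F \<circ> \<delta>"])
          (auto intro!: continuous_intros simp: joinpaths_def pathstart_def pathfinish_def)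
      then have 1: "k (1/4) - k (1/2) = F p - F q"
        using \<delta>(3,4) by (simp add: pathstart_def pathfinish_def)
      have "k (0/4) - k (1/4) = h p 0 - h p 1"
        using \<gamma>[OF p] h[OF p]
        by (intro seg[of "\<lambda>t. t/4" "\<gamma> p" "h p"])
          (auto intro!: continuous_intros simp: joinpaths_def)
      then have 2: "k 0 - k (1/4) = - f p" by (simp add: f_def)
      have "k (1 - 0/2) - k (1 - 1/2) = h q 0 - h q 1"
        using \<gamma>[OF qM] h[OF qM] \<delta>(4)
        by (intro seg[of "\<lambda>t. 1 - t/2" "\<gamma> q" "h q"])
          (auto intro!: continuous_intros
            simp: joinpaths_def reversepath_def pathfinish_def field_simps)
      then have 3: "k 1 - k (1/2) = - f q" by (simp add: f_def)
      from 1 2 3 k01 show ?thesis by linarith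
    qed
    with shift[OF F(1), of "f p - F p"] F(2) show ?thesis by blast
  qed
  then show ?thesis by blast
qed auto

end

section \<open>Smooth maps\<close>

abbreviation dd :: "('a::real_normed_vector \<Rightarrow> 'b::real_normed_vector) \<Rightarrow> 'a \<Rightarrow> 'a \<Rightarrow> 'b" where
  "dd f x u \<equiv> frechet_derivative f (at x) u"

text \<open>Differentiability is not assumed: \<open>frechet_derivative\<close> chooses from the set
  of derivatives, and both functions have the same set, so the choices coincide.\<close>

lemma frechet_derivative_cong_open:
  assumes "open S" "x \<in> S" "\<And>y. y \<in> S \<Longrightarrow> f y = g y"
  shows "frechet_derivative f (at x) = frechet_derivative g (at x)"
proof -
  have "(f has_derivative D) (at x) \<longleftrightarrow> (g has_derivative D) (at x)" for D
    using assms by (metis has_derivative_transform_within_open)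
  then show ?thesis unfolding frechet_derivative_def by presburger
qed

lemma differentiable_cong_open:
  assumes "open S" "x \<in> S" "\<And>y. y \<in> S \<Longrightarrow> f y = g y"
  shows "f differentiable (at x) \<longleftrightarrow> g differentiable (at x)"
  using assms unfolding differentiable_def by (metis has_derivative_transform_within_open)

lemma has_derivative_imp_dd: "(f has_derivative D) (at x) \<Longrightarrow> dd f x u = D u"
  using frechet_derivative_at by metis

section \<open>Closure properties of C^k and smooth maps\<close>

lemma Ck_on_cong:
  assumes "open S" "\<And>y. y \<in> S \<Longrightarrow> f y = g y"
  shows "Ck_on k f S \<longleftrightarrow> Ck_on k g S"
  using assms(2)
proof (induction k arbitrary: f g)
  case (Suc k)
  have "Ck_on k (\<lambda>x. dd f x v) S \<longleftrightarrow> Ck_on k (\<lambda>x. dd g x v) S" for v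
    by (rule Suc.IH) (metis frechet_derivative_cong_open assms(1) Suc.prems)
  moreover have "\<forall>x\<in>S. f differentiable (at x) \<longleftrightarrow> g differentiable (at x)"
    using differentiable_cong_open assms(1) Suc.prems by blast
  ultimately show ?case by simp
qed (simp cong: continuous_on_cong)

lemma Ck_on_subset: "Ck_on k f S \<Longrightarrow> T \<subseteq> S \<Longrightarrow> Ck_on k f T"
  by (induction k arbitrary: f) (auto intro: continuous_on_subset)

lemma Ck_on_imp_continuous_on:
  assumes "Ck_on k f S"
  shows "continuous_on S f"
  using assms
  by (cases k) (auto intro!: continuous_at_imp_continuous_on differentiable_imp_continuous_within)

lemma Ck_on_Suc_D: "Ck_on (Suc k) f S \<Longrightarrow> Ck_on k f S"
proof (induction k arbitrary: f)
  case 0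
  then show ?case using Ck_on_imp_continuous_on[of "Suc 0"] by auto
next
  case (Suc k)
  then show ?case using Ck_on.simps(2) by blast
qed

lemma smooth_on_open: "smooth_on S f \<Longrightarrow> open S"
  by (simp add: smooth_on_def)

lemma smooth_on_differentiable:
  assumes "smooth_on S f" "x \<in> S"
  shows "f differentiable (at x)"
  using assms unfolding smooth_on_def by (metis Ck_on.simps(2))

lemma smooth_on_has_derivative:
  assumes "smooth_on S f" "x \<in> S"
  shows "(f has_derivative frechet_derivative f (at x)) (at x)"
  using smooth_on_differentiable[OF assms] frechet_derivative_works by blast

lemma smooth_on_dd:
  assumes "smooth_on S f"
  shows "smooth_on S (\<lambda>x. dd f x v)"
  using assms unfolding smooth_on_def by (metis Ck_on.simps(2))

lemma smooth_on_continuous_on: "smooth_on S f \<Longrightarrow> continuous_on S f"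
  by (auto simp: smooth_on_def intro: Ck_on_imp_continuous_on)

text \<open>Smoothness of all directional derivatives gives \<open>Ck_on (Suc k)\<close> for each k,
  and the order is then lowered by one.\<close>

lemma smooth_onI:
  assumes "open S" "\<And>x. x \<in> S \<Longrightarrow> f differentiable (at x)" "\<And>v. smooth_on S (\<lambda>x. dd f x v)"
  shows "smooth_on S f"
  unfolding smooth_on_def
proof (intro conjI allI)
  fix k
  have "Ck_on (Suc k) f S"
    using assms by (auto simp: smooth_on_def)
  then show "Ck_on k f S" by (rule Ck_on_Suc_D)
qed fact

lemma smooth_on_cong:
  assumes "\<And>x. x \<in> S \<Longrightarrow> f x = g x"
  shows "smooth_on S f \<longleftrightarrow> smooth_on S g"
  using Ck_on_cong[of S f g] assms by (auto simp: smooth_on_def)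

lemma Ck_on_const: "Ck_on k (\<lambda>_. c) S"
  by (induction k arbitrary: c) (auto simp: frechet_derivative_const)

lemma smooth_on_const: "open S \<Longrightarrow> smooth_on S (\<lambda>_. c)"
  by (auto simp: smooth_on_def Ck_on_const)

lemma Ck_on_add:
  assumes "open S" "Ck_on k f S" "Ck_on k g S"
  shows "Ck_on k (\<lambda>x. f x + g x) S"
  using assms(2,3)
proof (induction k arbitrary: f g)
  case (Suc k)
  have "Ck_on k (\<lambda>x. dd (\<lambda>x. f x + g x) x v) S" for v
  proof (subst Ck_on_cong[OF assms(1)])
    fix x assume "x \<in> S"
    then have "(f has_derivative dd f x) (at x)" "(g has_derivative dd g x) (at x)"
      using Suc.prems by (auto simp: frechet_derivative_works)
    then show "dd (\<lambda>x. f x + g x) x v = dd f x v + dd g x v"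
      by (intro has_derivative_imp_dd has_derivative_add)
  qed (use Suc in auto)
  with Suc.prems show ?case by auto
qed (auto intro: continuous_intros)

lemma Ck_on_bounded_linear:
  assumes "open S" "bounded_linear L" "Ck_on k f S"
  shows "Ck_on k (\<lambda>x. L (f x)) S"
  using assms(3)
proof (induction k arbitrary: f)
  case 0
  then show ?case using assms(2) by (auto intro: bounded_linear.continuous_on)
next
  case (Suc k)
  have D: "((\<lambda>x. L (f x)) has_derivative (\<lambda>v. L (dd f x v))) (at x)" if "x \<in> S" for x
    using Suc.prems that assms(2)
    by (auto simp: frechet_derivative_works intro: bounded_linear.has_derivative)
  have "Ck_on k (\<lambda>x. dd (\<lambda>x. L (f x)) x v) S" for v
    by (subst Ck_on_cong[OF assms(1) has_derivative_imp_dd[OF D]]) (use Suc in auto)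
  with D show ?case by (auto simp: differentiable_def)
qed

lemma Ck_on_bilinear:
  assumes "open S" "bounded_bilinear pr" "Ck_on k f S" "Ck_on k g S"
  shows "Ck_on k (\<lambda>x. pr (f x) (g x)) S"
  using assms(3,4)
proof (induction k arbitrary: f g)
  case 0
  then show ?case using assms(2) by (auto intro: bounded_bilinear.continuous_on)
next
  case (Suc k)
  have D: "((\<lambda>x. pr (f x) (g x)) has_derivative (\<lambda>v. pr (f x) (dd g x v) + pr (dd f x v) (g x))) (at x)"
    if "x \<in> S" for x
    using Suc.prems that assms(2)
    by (auto simp: frechet_derivative_works intro: bounded_bilinear.FDERIV)
  have "Ck_on k (\<lambda>x. dd (\<lambda>x. pr (f x) (g x)) x v) S" for v
  proof (subst Ck_on_cong[OF assms(1) has_derivative_imp_dd[OF D]])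
    have "Ck_on k f S" "Ck_on k g S" using Suc.prems Ck_on_Suc_D by auto
    then show "Ck_on k (\<lambda>x. pr (f x) (dd g x v) + pr (dd f x v) (g x)) S"
      using Suc.prems by (intro Ck_on_add[OF assms(1)] Suc.IH) auto
  qed
  with D show ?case by (auto simp: differentiable_def)
qed

lemma smooth_on_add:
  "smooth_on S f \<Longrightarrow> smooth_on S g \<Longrightarrow> smooth_on S (\<lambda>x. f x + g x)"
  by (auto simp: smooth_on_def intro: Ck_on_add)

lemma smooth_on_bounded_linear:
  "bounded_linear L \<Longrightarrow> smooth_on S f \<Longrightarrow> smooth_on S (\<lambda>x. L (f x))"
  by (auto simp: smooth_on_def intro: Ck_on_bounded_linear)

lemma smooth_on_scaleR:
  "smooth_on S f \<Longrightarrow> smooth_on S g \<Longrightarrow> smooth_on S (\<lambda>x. f x *\<^sub>R g x)"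
  by (auto simp: smooth_on_def intro: Ck_on_bilinear[OF _ bounded_bilinear_scaleR])

lemma smooth_on_mult:
  fixes f g :: "'a::real_normed_vector \<Rightarrow> real"
  shows "smooth_on S f \<Longrightarrow> smooth_on S g \<Longrightarrow> smooth_on S (\<lambda>x. f x * g x)"
  using smooth_on_scaleR[of S f g] by simp

lemma smooth_on_minus: "smooth_on S f \<Longrightarrow> smooth_on S (\<lambda>x. - f x)"
  by (rule smooth_on_bounded_linear[OF bounded_linear_minus[OF bounded_linear_ident]])

lemma smooth_on_diff:
  "smooth_on S f \<Longrightarrow> smooth_on S g \<Longrightarrow> smooth_on S (\<lambda>x. f x - g x)"
  using smooth_on_add[OF _ smooth_on_minus] by fastforce

lemma smooth_on_sum:
  assumes "open S" "\<And>i. i \<in> I \<Longrightarrow> smooth_on S (f i)"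
  shows "smooth_on S (\<lambda>x. \<Sum>i\<in>I. f i x)"
  using assms(2)
  by (induction I rule: infinite_finite_induct) (auto intro: smooth_on_const smooth_on_add assms(1))

lemma smooth_on_prod:
  fixes f :: "'i \<Rightarrow> 'a::real_normed_vector \<Rightarrow> real"
  assumes "open S" "\<And>i. i \<in> I \<Longrightarrow> smooth_on S (f i)"
  shows "smooth_on S (\<lambda>x. \<Prod>i\<in>I. f i x)"
  using assms(2)
  by (induction I rule: infinite_finite_induct) (auto intro: smooth_on_const smooth_on_mult assms(1))

text \<open>The derivative of \<open>inverse (f x)\<close> is again a product of
  \<open>inverse (f x)\<close> and \<open>dd f x v\<close>, so the induction on k runs with f
  fixed.\<close>

lemma Ck_on_inverse:
  fixes f :: "'a::real_normed_vector \<Rightarrow> real"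
  assumes "open S" "\<And>x. x \<in> S \<Longrightarrow> f x \<noteq> 0" "Ck_on k f S"
  shows "Ck_on k (\<lambda>x. inverse (f x)) S"
  using assms(3)
proof (induction k)
  case 0
  then show ?case using assms(2) by (auto intro: continuous_intros)
next
  case (Suc k)
  have D: "((\<lambda>x. inverse (f x)) has_derivative (\<lambda>v. - (inverse (f x) * dd f x v * inverse (f x)))) (at x)"
    if "x \<in> S" for x
    using Suc.prems that assms(2)
    by (auto simp: frechet_derivative_works intro!: has_derivative_inverse)
  have "Ck_on k (\<lambda>x. dd (\<lambda>x. inverse (f x)) x v) S" for v
  proof (subst Ck_on_cong[OF assms(1) has_derivative_imp_dd[OF D]])
    have *: "Ck_on k (\<lambda>x. inverse (f x)) S" "Ck_on k (\<lambda>x. dd f x v) S"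
      using Suc Ck_on_Suc_D by auto
    show "Ck_on k (\<lambda>x. - (inverse (f x) * dd f x v * inverse (f x))) S"
      by (intro Ck_on_bounded_linear[OF assms(1) bounded_linear_minus[OF bounded_linear_ident]]
          Ck_on_bilinear[OF assms(1) bounded_bilinear_mult] *)
  qed
  with D show ?case by (auto simp: differentiable_def)
qed

lemma smooth_on_divide:
  fixes f g :: "'a::real_normed_vector \<Rightarrow> real"
  assumes "smooth_on S f" "smooth_on S g" "\<And>x. x \<in> S \<Longrightarrow> g x \<noteq> 0"
  shows "smooth_on S (\<lambda>x. f x / g x)"
  unfolding divide_inverse
  using assms by (intro smooth_on_mult) (auto simp: smooth_on_def intro: Ck_on_inverse)

lemma smooth_on_vec_nth:
  "smooth_on S f \<Longrightarrow> smooth_on S (\<lambda>x. f x $ i)"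
  by (rule smooth_on_bounded_linear[OF bounded_linear_vec_nth])

lemma smooth_on_vecI:
  fixes f :: "'a::real_normed_vector \<Rightarrow> real ^ 'n"
  assumes "open S" "\<And>i. smooth_on S (\<lambda>x. f x $ i)"
  shows "smooth_on S f"
proof -
  have "f = (\<lambda>x. \<Sum>i\<in>UNIV. (f x $ i) *\<^sub>R axis i 1)"
    by (simp add: basis_expansion flip: scalar_mult_eq_scaleR)
  moreover have "smooth_on S (\<lambda>x. \<Sum>i\<in>UNIV. (f x $ i) *\<^sub>R axis i (1::real) :: real ^ 'n)"
    using assms by (intro smooth_on_sum smooth_on_scaleR smooth_on_const)
  ultimately show ?thesis by simp
qed

section \<open>Tensor fields applied to varying arguments\<close>

lemma linear_axis_expansion:
  fixes L :: "real ^ 'n \<Rightarrow> 'b::real_vector"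
  assumes "linear L"
  shows "L v = (\<Sum>i\<in>UNIV. (v $ i) *\<^sub>R L (axis i 1))"
proof -
  have "L v = L (\<Sum>i\<in>UNIV. (v $ i) *\<^sub>R axis i 1)"
    by (simp add: basis_expansion flip: scalar_mult_eq_scaleR)
  then show ?thesis
    by (simp add: linear_sum[OF assms] linear_cmul[OF assms])
qed

text \<open>Tensor fields are known to be smooth only on fixed vectors; expanding the argument in
  the standard basis reduces a varying argument to a finite sum of products.\<close>

lemma smooth_on_linear_apply:
  fixes X :: "'a::real_normed_vector \<Rightarrow> real ^ 'n"
  assumes "\<And>y. y \<in> S \<Longrightarrow> linear (L y)" "\<And>v. smooth_on S (\<lambda>y. L y v)" "smooth_on S X"
  shows "smooth_on S (\<lambda>y. L y (X y))"
proof (subst smooth_on_cong)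
  show "L y (X y) = (\<Sum>i\<in>UNIV. (X y $ i) *\<^sub>R L y (axis i 1))" if "y \<in> S" for y
    by (rule linear_axis_expansion) (use that assms in auto)
  show "smooth_on S (\<lambda>y. \<Sum>i\<in>UNIV. (X y $ i) *\<^sub>R L y (axis i 1))"
    using assms by (intro smooth_on_sum smooth_on_scaleR smooth_on_vec_nth smooth_on_open[OF assms(3)])
qed

lemma smooth_on_bilinear_apply:
  fixes X :: "'a::real_normed_vector \<Rightarrow> real ^ 'n" and Y :: "'a \<Rightarrow> real ^ 'm"
  assumes "\<And>y. y \<in> S \<Longrightarrow> bilinear (T y)" "\<And>u v. smooth_on S (\<lambda>y. T y u v)"
    "smooth_on S X" "smooth_on S Y"
  shows "smooth_on S (\<lambda>y. T y (X y) (Y y))"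
proof (rule smooth_on_linear_apply)
  fix w show "smooth_on S (\<lambda>y. T y (X y) w)"
    by (rule smooth_on_linear_apply[where L = "\<lambda>y u. T y u w"]) (use assms in \<open>auto simp: bilinear_def\<close>)
qed (use assms in \<open>auto simp: bilinear_def\<close>)

text \<open>Product rule for a field of linear maps whose differentiability is known on each fixed
  vector only; coordinates reduce it to products with scalar functions.\<close>

lemma has_derivative_linear_apply:
  fixes X :: "'a::real_normed_vector \<Rightarrow> real ^ 'n" and L :: "'a \<Rightarrow> real ^ 'n \<Rightarrow> 'b::real_normed_vector"
  assumes S: "open S" "x \<in> S" and L: "\<And>y. y \<in> S \<Longrightarrow> linear (L y)"
    "\<And>v. (\<lambda>y. L y v) differentiable (at x)" and X: "(X has_derivative X') (at x)"
  shows "((\<lambda>y. L y (X y)) has_derivative (\<lambda>h. dd (\<lambda>y. L y (X x)) x h + L x (X' h))) (at x)"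
proof -
  have D: "((\<lambda>y. L y v) has_derivative dd (\<lambda>y. L y v) x) (at x)" for v
    using L(2) frechet_derivative_works by blast
  have *: "((\<lambda>y. \<Sum>i\<in>UNIV. (Z y $ i) *\<^sub>R L y (axis i 1)) has_derivative
      (\<lambda>h. \<Sum>i\<in>UNIV. (Z x $ i) *\<^sub>R dd (\<lambda>y. L y (axis i 1)) x h + (Z' h $ i) *\<^sub>R L x (axis i 1))) (at x)"
    if "(Z has_derivative Z') (at x)" for Z Z'
    by (intro has_derivative_sum has_derivative_scaleR D
        bounded_linear.has_derivative[OF bounded_linear_vec_nth] that)
  have **: "((\<lambda>y. L y (Z y)) has_derivative
      (\<lambda>h. (\<Sum>i\<in>UNIV. (Z x $ i) *\<^sub>R dd (\<lambda>y. L y (axis i 1)) x h) + L x (Z' h))) (at x)"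
    if "(Z has_derivative Z') (at x)" for Z Z'
  proof -
    have "((\<lambda>y. L y (Z y)) has_derivative
      (\<lambda>h. \<Sum>i\<in>UNIV. (Z x $ i) *\<^sub>R dd (\<lambda>y. L y (axis i 1)) x h + (Z' h $ i) *\<^sub>R L x (axis i 1))) (at x)"
      by (rule has_derivative_transform_within_open[OF *[OF that] S])
        (use linear_axis_expansion L(1) in metis)
    then show ?thesis
      by (simp add: sum.distrib linear_axis_expansion[OF L(1)[OF S(2)], of "Z' _"])
  qed
  \<comment> \<open>The expansion applied to the constant field \<open>X x\<close> identifies the
    sum over the basis with the derivative of L at a frozen argument.\<close>
  have "linear (L x)" using L S by blast
  then have "dd (\<lambda>y. L y (X x)) x h = (\<Sum>i\<in>UNIV. (X x $ i) *\<^sub>R dd (\<lambda>y. L y (axis i 1)) x h)" for h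
    using has_derivative_imp_dd[OF **[OF has_derivative_const, of "X x"], of h]
    by (simp add: linear_0)
  with **[OF X] show ?thesis by simp
qed

lemma has_derivative_bilinear_apply:
  fixes X :: "'a::real_normed_vector \<Rightarrow> real ^ 'n" and Y :: "'a \<Rightarrow> real ^ 'm"
    and T :: "'a \<Rightarrow> real ^ 'n \<Rightarrow> real ^ 'm \<Rightarrow> 'b::real_normed_vector"
  assumes S: "open S" "x \<in> S" and T: "\<And>y. y \<in> S \<Longrightarrow> bilinear (T y)"
    "\<And>u v. (\<lambda>y. T y u v) differentiable (at x)"
    and X: "(X has_derivative X') (at x)" and Y: "(Y has_derivative Y') (at x)"
  shows "((\<lambda>y. T y (X y) (Y y)) has_derivative
    (\<lambda>h. dd (\<lambda>y. T y (X x) (Y x)) x h + T x (X' h) (Y x) + T x (X x) (Y' h))) (at x)"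
proof -
  have 1: "((\<lambda>y. T y (X y) w) has_derivative (\<lambda>h. dd (\<lambda>y. T y (X x) w) x h + T x (X' h) w)) (at x)" for w
    by (rule has_derivative_linear_apply[where L = "\<lambda>y u. T y u w", OF S _ _ X])
      (use T in \<open>auto simp: bilinear_def\<close>)
  have "((\<lambda>y. T y (X y) (Y y)) has_derivative
      (\<lambda>h. dd (\<lambda>y. T y (X y) (Y x)) x h + T x (X x) (Y' h))) (at x)"
    by (rule has_derivative_linear_apply[where L = "\<lambda>y w. T y (X y) w", OF S _ _ Y])
      (use T differentiableI[OF 1] in \<open>auto simp: bilinear_def\<close>)
  then show ?thesis by (simp add: has_derivative_imp_dd[OF 1])
qed

section \<open>Symmetry of second derivatives\<close>

lemma DERIV_along_line:
  fixes f :: "'a::real_normed_vector \<Rightarrow> real"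
  assumes "f differentiable (at (a + s *\<^sub>R u))"
  shows "DERIV (\<lambda>s. f (a + s *\<^sub>R u)) s :> dd f (a + s *\<^sub>R u) u"
proof -
  have f: "(f has_derivative dd f (a + s *\<^sub>R u)) (at (a + s *\<^sub>R u))"
    using assms by (simp add: frechet_derivative_works)
  have "((\<lambda>s. a + s *\<^sub>R u) has_derivative (\<lambda>h. h *\<^sub>R u)) (at s)"
    by (auto intro!: derivative_eq_intros)
  from has_derivative_compose[OF this f]
  have "((\<lambda>s. f (a + s *\<^sub>R u)) has_derivative (\<lambda>h. dd f (a + s *\<^sub>R u) (h *\<^sub>R u))) (at s)" .
  moreover have "dd f (a + s *\<^sub>R u) (h *\<^sub>R u) = dd f (a + s *\<^sub>R u) u * h" for h
    using linear_cmul[OF has_derivative_linear[OF f]] by simp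
  ultimately show ?thesis by (simp add: has_field_derivative_def)
qed

text \<open>The mean value theorem is used twice: in direction u for the difference of f at points
  shifted by \<open>t *\<^sub>R v\<close>, then in direction v for \<open>dd f y u\<close>. The
  intermediate point stays unknown; only the parallelogram containing it is recorded.\<close>

lemma second_difference:
  fixes f :: "'a::real_normed_vector \<Rightarrow> real"
  assumes f: "smooth_on S f" and t: "t > 0"
    and S: "\<And>s s'. 0 \<le> s \<Longrightarrow> s \<le> t \<Longrightarrow> 0 \<le> s' \<Longrightarrow> s' \<le> t \<Longrightarrow> x + s *\<^sub>R u + s' *\<^sub>R v \<in> S"
  shows "\<exists>s s'. 0 \<le> s \<and> s \<le> t \<and> 0 \<le> s' \<and> s' \<le> t \<and>
    f (x + t *\<^sub>R u + t *\<^sub>R v) - f (x + t *\<^sub>R u) - f (x + t *\<^sub>R v) + f x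
      = t * t * dd (\<lambda>y. dd f y u) (x + s *\<^sub>R u + s' *\<^sub>R v) v"
proof -
  define g where "g s = f (x + t *\<^sub>R v + s *\<^sub>R u) - f (x + s *\<^sub>R u)" for s
  have S': "x + t *\<^sub>R v + s *\<^sub>R u \<in> S" "x + s *\<^sub>R u \<in> S" if "0 \<le> s" "s \<le> t" for s
    using S[of s t] S[of s 0] that t by (simp_all add: algebra_simps)
  have "\<exists>z>0. z < t \<and> g t - g 0 = (t - 0) * (dd f (x + t *\<^sub>R v + z *\<^sub>R u) u - dd f (x + z *\<^sub>R u) u)"
    unfolding g_def
    by (rule MVT2[OF t], intro DERIV_diff DERIV_along_line)
      (use S' smooth_on_differentiable[OF f] in auto)
  then obtain z where z: "0 < z" "z < t"
    "g t - g 0 = t * (dd f (x + t *\<^sub>R v + z *\<^sub>R u) u - dd f (x + z *\<^sub>R u) u)" by auto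
  define h where "h s' = dd f (x + z *\<^sub>R u + s' *\<^sub>R v) u" for s'
  have "\<exists>w>0. w < t \<and> h t - h 0 = (t - 0) * dd (\<lambda>y. dd f y u) (x + z *\<^sub>R u + w *\<^sub>R v) v"
    unfolding h_def
    by (rule MVT2[OF t], intro DERIV_along_line)
      (use S z smooth_on_differentiable[OF smooth_on_dd[OF f]] in auto)
  then obtain w where w: "0 < w" "w < t"
    "h t - h 0 = t * dd (\<lambda>y. dd f y u) (x + z *\<^sub>R u + w *\<^sub>R v) v" by auto
  have "g t - g 0 = t * (h t - h 0)" using z(3) by (simp add: h_def algebra_simps)
  then have "f (x + t *\<^sub>R u + t *\<^sub>R v) - f (x + t *\<^sub>R u) - f (x + t *\<^sub>R v) + f x
      = t * t * dd (\<lambda>y. dd f y u) (x + z *\<^sub>R u + w *\<^sub>R v) v"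
    using w(3) by (simp add: g_def algebra_simps)
  then show ?thesis using z w by (intro exI[of _ z] exI[of _ w]) auto
qed

text \<open>The second difference is unchanged when u and v are exchanged, so
  \<open>second_difference\<close> gives two points near x at which the two mixed derivatives have
  equal values; continuity brings both points to x.\<close>

lemma dd_dd_commute_real:
  fixes f :: "'a::real_normed_vector \<Rightarrow> real"
  assumes f: "smooth_on S f" and x: "x \<in> S"
  shows "dd (\<lambda>y. dd f y u) x v = dd (\<lambda>y. dd f y v) x u"
proof (rule ccontr)
  define a where "a y = dd (\<lambda>y. dd f y u) y v" for y
  define b where "b y = dd (\<lambda>y. dd f y v) y u" for y
  assume "\<not> ?thesis"
  \<comment> \<open>Half the supposed gap serves as the tolerance: two errors below it cannot bridge
    the gap.\<close>
  then have e: "\<bar>a x - b x\<bar> / 2 > 0" by (simp add: a_def b_def)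
  have cont: "continuous_on S a" "continuous_on S b"
    unfolding a_def b_def by (intro smooth_on_continuous_on smooth_on_dd f)+
  have "(a \<longlongrightarrow> a x) (nhds x)" "(b \<longlongrightarrow> b x) (nhds x)"
    using cont x smooth_on_open[OF f]
    by (auto simp: continuous_on_eq_continuous_at isCont_def tendsto_at_iff_tendsto_nhds)
  from tendstoD[OF this(1) e] tendstoD[OF this(2) e]
  have "\<forall>\<^sub>F y in nhds x. y \<in> S \<and> \<bar>a y - a x\<bar> < \<bar>a x - b x\<bar> / 2 \<and>
      \<bar>b y - b x\<bar> < \<bar>a x - b x\<bar> / 2"
    using eventually_nhds_in_open[OF smooth_on_open[OF f] x]
    by eventually_elim (simp add: dist_real_def)
  then obtain d where d: "d > 0" "\<And>y. dist y x < d \<Longrightarrow> y \<in> S"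
      "\<And>y. dist y x < d \<Longrightarrow> \<bar>a y - a x\<bar> < \<bar>a x - b x\<bar> / 2"
      "\<And>y. dist y x < d \<Longrightarrow> \<bar>b y - b x\<bar> < \<bar>a x - b x\<bar> / 2"
    unfolding eventually_nhds_metric by metis
  \<comment> \<open>With this t the parallelogram stays within d/2 of x; the summand 1 avoids a zero
    denominator.\<close>
  define t where "t = d / (2 * (norm u + norm v + 1))"
  have N: "norm u + norm v + 1 > 0" by (smt (verit) norm_ge_zero)
  have t: "t > 0" using d N by (simp add: t_def)
  have near: "dist (x + s *\<^sub>R u + s' *\<^sub>R v) x < d"
    if "0 \<le> s" "s \<le> t" "0 \<le> s'" "s' \<le> t" for s s'
  proof -
    have "dist (x + s *\<^sub>R u + s' *\<^sub>R v) x = norm (s *\<^sub>R u + s' *\<^sub>R v)"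
      by (simp add: dist_norm)
    also have "\<dots> \<le> s * norm u + s' * norm v"
      using norm_triangle_ineq[of "s *\<^sub>R u" "s' *\<^sub>R v"] that by simp
    also have "\<dots> \<le> t * norm u + t * norm v"
      using that by (intro add_mono mult_right_mono) auto
    also have "\<dots> \<le> t * (norm u + norm v + 1)"
      using t by (simp add: algebra_simps)
    also have "\<dots> = d / 2" using N by (simp add: t_def field_simps)
    finally show ?thesis using d by simp
  qed
  have near': "dist (x + s *\<^sub>R v + s' *\<^sub>R u) x < d"
    if "0 \<le> s" "s \<le> t" "0 \<le> s'" "s' \<le> t" for s s'
    using near[of s' s] that by (simp add: algebra_simps)
  have "\<exists>s s'. 0 \<le> s \<and> s \<le> t \<and> 0 \<le> s' \<and> s' \<le> t \<and>
    f (x + t *\<^sub>R u + t *\<^sub>R v) - f (x + t *\<^sub>R u) - f (x + t *\<^sub>R v) + f x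
      = t * t * a (x + s *\<^sub>R u + s' *\<^sub>R v)"
    unfolding a_def by (rule second_difference[OF f t]) (intro d(2) near)
  then obtain s1 s1' where s1: "0 \<le> s1" "s1 \<le> t" "0 \<le> s1'" "s1' \<le> t"
    "f (x + t *\<^sub>R u + t *\<^sub>R v) - f (x + t *\<^sub>R u) - f (x + t *\<^sub>R v) + f x
      = t * t * a (x + s1 *\<^sub>R u + s1' *\<^sub>R v)"
    by (elim exE conjE)
  have "\<exists>s s'. 0 \<le> s \<and> s \<le> t \<and> 0 \<le> s' \<and> s' \<le> t \<and>
    f (x + t *\<^sub>R v + t *\<^sub>R u) - f (x + t *\<^sub>R v) - f (x + t *\<^sub>R u) + f x
      = t * t * b (x + s *\<^sub>R v + s' *\<^sub>R u)"
    unfolding b_def by (rule second_difference[OF f t]) (intro d(2) near')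
  then obtain s2 s2' where s2: "0 \<le> s2" "s2 \<le> t" "0 \<le> s2'" "s2' \<le> t"
    "f (x + t *\<^sub>R v + t *\<^sub>R u) - f (x + t *\<^sub>R v) - f (x + t *\<^sub>R u) + f x
      = t * t * b (x + s2 *\<^sub>R v + s2' *\<^sub>R u)"
    by (elim exE conjE)
  define y1 where "y1 = x + s1 *\<^sub>R u + s1' *\<^sub>R v"
  define y2 where "y2 = x + s2 *\<^sub>R v + s2' *\<^sub>R u"
  have y: "dist y1 x < d" "dist y2 x < d"
    unfolding y1_def y2_def using near[OF s1(1-4)] near'[OF s2(1-4)] .
  have swap: "x + t *\<^sub>R v + t *\<^sub>R u = x + t *\<^sub>R u + t *\<^sub>R v" by simp
  have "t * t * a y1 = t * t * b y2"
    using s1(5) s2(5)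
    unfolding y1_def[symmetric] y2_def[symmetric] swap by linarith
  then have "a y1 = b y2" using t by simp
  then have "\<bar>a x - b x\<bar> \<le> \<bar>a y1 - a x\<bar> + \<bar>b y2 - b x\<bar>" by simp
  with d(3)[OF y(1)] d(4)[OF y(2)] show False by simp
qed

lemma dd_bounded_linear:
  assumes "f differentiable (at x)" "bounded_linear L"
  shows "dd (\<lambda>y. L (f y)) x v = L (dd f x v)"
proof -
  have "(f has_derivative dd f x) (at x)"
    using assms(1) by (simp add: frechet_derivative_works)
  from has_derivative_imp_dd[OF bounded_linear.has_derivative[OF assms(2) this]]
  show ?thesis .
qed

lemma dd_dd_commute:
  fixes f :: "'a::real_normed_vector \<Rightarrow> real ^ 'n"
  assumes f: "smooth_on S f" and x: "x \<in> S"
  shows "dd (\<lambda>y. dd f y u) x v = dd (\<lambda>y. dd f y v) x u"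
proof -
  have "dd (\<lambda>y. dd f y u) x v $ i = dd (\<lambda>y. dd (\<lambda>y. f y $ i) y u) x v" for u v i
  proof -
    have "dd (\<lambda>y. dd (\<lambda>y. f y $ i) y u) x v = dd (\<lambda>y. dd f y u $ i) x v"
      using dd_bounded_linear[OF smooth_on_differentiable[OF f] bounded_linear_vec_nth]
      by (intro fun_cong[OF frechet_derivative_cong_open[OF smooth_on_open[OF f] x]]) simp
    also have "\<dots> = dd (\<lambda>y. dd f y u) x v $ i"
      using smooth_on_differentiable[OF smooth_on_dd[OF f] x]
      by (intro dd_bounded_linear bounded_linear_vec_nth)
    finally show ?thesis ..
  qed
  then show ?thesis
    using dd_dd_commute_real[OF smooth_on_vec_nth[OF f] x] by (simp add: vec_eq_iff)
qed

text \<open>The primitive is the integral of a along the segment from x0 to x. Differentiating under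
  the integral gives the integrand \<open>F x t h\<close>; closedness exchanges h with
  \<open>x - x0\<close> in it and turns it into the t-derivative of \<open>t * a (z x t) h\<close>,
  which integrates to \<open>a x h\<close>.\<close>

lemma Poincare_lemma:
  fixes a :: "real ^ 'n \<Rightarrow> real ^ 'n \<Rightarrow> real"
  assumes U: "open U" "convex U" "x0 \<in> U"
    and lin: "\<And>y. y \<in> U \<Longrightarrow> linear (a y)"
    and smooth: "\<And>v. smooth_on U (\<lambda>y. a y v)"
    and closed: "\<And>y u v. y \<in> U \<Longrightarrow> dd (\<lambda>y. a y u) y v = dd (\<lambda>y. a y v) y u"
  shows "\<exists>P. \<forall>x\<in>U. (P has_derivative a x) (at x)"
proof -
  define z where "z x t = x0 + t *\<^sub>R (x - x0)" for x and t :: real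
  have z: "z x t \<in> U" if "x \<in> U" "t \<in> {0..1}" for x t
  proof -
    have "z x t = (1 - t) *\<^sub>R x0 + t *\<^sub>R x" by (simp add: z_def algebra_simps)
    then show ?thesis using U that by (simp add: convexD)
  qed
  define F where "F x t h = t * dd (\<lambda>y. a y (x - x0)) (z x t) h + a (z x t) h" for x t h
  have ddlin: "linear (dd (\<lambda>y. a y v) y)" if "y \<in> U" for y v
    using has_derivative_linear[OF smooth_on_has_derivative[OF smooth that]] .
  have bl: "bounded_linear (F x t)" if "x \<in> U" "t \<in> {0..1}" for x t
  proof -
    have "linear (F x t)"
      unfolding F_def using lin[OF z[OF that]] ddlin[OF z[OF that]]
      by (intro linear_compose_add linear_compose_scale_right[where 'b = real, simplified]) auto
    then show ?thesis by (simp add: linear_conv_bounded_linear)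
  qed
  have contz: "continuous_on (U \<times> {0..1}) (\<lambda>p. z (fst p) (snd p))"
    unfolding z_def by (intro continuous_intros)
  have comp: "continuous_on (U \<times> {0..1}) (\<lambda>p. k (z (fst p) (snd p)))" if "continuous_on U k"
    for k :: "real ^ 'n \<Rightarrow> real"
    using z by (intro continuous_on_compose2[OF that contz]) auto
  \<comment> \<open>The slot vector \<open>x - x0\<close> varies with x; pulling out its coordinates
    leaves derivatives of a on fixed vectors, which gives joint continuity of F in x and t.\<close>
  have expand: "dd (\<lambda>y. a y w) y h = (\<Sum>i\<in>UNIV. (w $ i) *\<^sub>R dd (\<lambda>y. a y (axis i 1)) y h)"
    if "y \<in> U" for y w h
  proof -
    have "((\<lambda>y. \<Sum>i\<in>UNIV. (w $ i) *\<^sub>R a y (axis i 1)) has_derivative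
        (\<lambda>h. \<Sum>i\<in>UNIV. (w $ i) *\<^sub>R dd (\<lambda>y. a y (axis i 1)) y h)) (at y)"
      by (intro has_derivative_sum has_derivative_scaleR_right
          smooth_on_has_derivative[OF smooth that])
    then have "((\<lambda>y. a y w) has_derivative
        (\<lambda>h. \<Sum>i\<in>UNIV. (w $ i) *\<^sub>R dd (\<lambda>y. a y (axis i 1)) y h)) (at y)"
      by (rule has_derivative_transform_within_open[OF _ U(1) that])
        (use linear_axis_expansion lin in metis)
    then show ?thesis by (rule has_derivative_imp_dd)
  qed
  have contF: "continuous_on (U \<times> {0..1}) (\<lambda>p. F (fst p) (snd p) h)" for h
  proof -
    have "continuous_on (U \<times> {0..1}) (\<lambda>p. snd p *
        (\<Sum>i\<in>UNIV. ((fst p - x0) $ i) *\<^sub>R dd (\<lambda>y. a y (axis i 1)) (z (fst p) (snd p)) h)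
        + a (z (fst p) (snd p)) h)"
      by (intro continuous_intros comp[of "\<lambda>y. dd (\<lambda>y. a y (axis _ 1)) y h"] comp[of "\<lambda>y. a y h"]
          smooth_on_continuous_on smooth_on_dd smooth)
    then show ?thesis
      by (rule continuous_on_eq) (auto simp: F_def expand z)
  qed
  define fx where "fx x t = Blinfun (F x t)" for x t
  have fx: "blinfun_apply (fx x t) = F x t" if "x \<in> U" "t \<in> {0..1}" for x t
    using bl[OF that] by (simp add: fx_def bounded_linear_Blinfun_apply)
  \<comment> \<open>The rule for differentiating under the integral asks for a derivative that is
    continuous as an operator; in finite dimension it suffices to test it on single vectors.\<close>
  have contfx: "continuous_on (U \<times> cbox 0 1) (\<lambda>(x, t). fx x t)"
  proof (rule continuous_on_blinfun_componentwise)
    fix i :: "real ^ 'n"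
    show "continuous_on (U \<times> cbox 0 1) (\<lambda>p. blinfun_apply (case p of (x, t) \<Rightarrow> fx x t) i)"
      unfolding cbox_interval
      by (rule continuous_on_eq[OF contF[of i]]) (auto simp: fx)
  qed
  define P where "P x = integral (cbox 0 1) (\<lambda>t. a (z x t) (x - x0))" for x
  have "(P has_derivative a x) (at x)" if x: "x \<in> U" for x
  proof -
    have "((\<lambda>x. integral (cbox 0 1) (\<lambda>t. a (z x t) (x - x0))) has_derivative
        blinfun_apply (integral (cbox 0 1) (fx x))) (at x within U)"
    proof (rule leibniz_rule[OF _ _ contfx x U(2)])
      fix x t assume xt: "x \<in> U" "t \<in> cbox 0 (1::real)"
      have "((\<lambda>x. a (z x t) (x - x0)) has_derivative F x t) (at x)"
      proof -
        have zd: "((\<lambda>x. z x t) has_derivative (\<lambda>h. t *\<^sub>R h)) (at x)"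
          unfolding z_def by (auto intro!: derivative_eq_intros)
        have c: "((\<lambda>x. a (z x t) w) has_derivative (\<lambda>h. dd (\<lambda>y. a y w) (z x t) (t *\<^sub>R h))) (at x)" for w
          using has_derivative_compose[OF zd smooth_on_has_derivative[OF smooth z]] xt
          by (auto simp: cbox_interval)
        let ?V = "(\<lambda>x. z x t) -` U"
        have "open ?V" unfolding z_def using U(1) by (intro open_vimage continuous_intros) auto
        moreover have "x \<in> ?V" using z xt by (simp add: cbox_interval)
        moreover have "((\<lambda>x. x - x0) has_derivative (\<lambda>h. h)) (at x)"
          by (auto intro!: derivative_eq_intros)
        ultimately have "((\<lambda>x. a (z x t) (x - x0)) has_derivative
           (\<lambda>h. dd (\<lambda>x'. a (z x' t) (x - x0)) x h + a (z x t) h)) (at x)"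
          using c lin by (intro has_derivative_linear_apply[where L = "\<lambda>x. a (z x t)" and S = ?V])
            (auto simp: differentiable_def)
        moreover have "dd (\<lambda>x'. a (z x' t) (x - x0)) x h = t * dd (\<lambda>y. a y (x - x0)) (z x t) h" for h
          using has_derivative_imp_dd[OF c] linear_cmul[OF ddlin[OF z]] xt
          by (simp add: cbox_interval)
        ultimately show ?thesis by (simp add: F_def[abs_def])
      qed
      then show "((\<lambda>x. a (z x t) (x - x0)) has_derivative blinfun_apply (fx x t)) (at x within U)"
        using fx xt by (simp add: cbox_interval has_derivative_at_withinI)
    next
      fix x assume x: "x \<in> U"
      have "continuous_on (cbox 0 1) (\<lambda>t. a (z x t) (x - x0))"
        unfolding cbox_interval
        using x z by (intro continuous_on_compose2[OF smooth_on_continuous_on[OF smooth]])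
           (auto simp: z_def intro!: continuous_intros)
      then show "(\<lambda>t. a (z x t) (x - x0)) integrable_on cbox 0 1"
        by (rule integrable_continuous)
    qed
    then have "(P has_derivative blinfun_apply (integral (cbox 0 1) (fx x))) (at x)"
      unfolding P_def using at_within_open[OF x U(1)] by metis
    moreover have "blinfun_apply (integral (cbox 0 1) (fx x)) h = a x h" for h
    proof -
      have "continuous_on (cbox 0 1) (fx x)"
        using continuous_on_compose2[OF contfx, of "cbox 0 1" "Pair x"] x
        by (fastforce intro!: continuous_intros)
      then have "fx x integrable_on cbox 0 1" by (rule integrable_continuous)
      then have "blinfun_apply (integral (cbox 0 1) (fx x)) h = integral {0..1} (\<lambda>t. blinfun_apply (fx x t) h)"
        by (simp add: blinfun_apply_integral cbox_interval)
      also have "\<dots> = integral {0..1} (\<lambda>t. F x t h)"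
        using x by (intro integral_cong) (simp add: fx)
      also have "((\<lambda>t. F x t h) has_integral (1 * a (z x 1) h - 0 * a (z x 0) h)) {0..1}"
      proof (rule fundamental_theorem_of_calculus)
        fix t :: real assume t: "t \<in> {0..1}"
        note zt = z[OF x t]
        have "DERIV (\<lambda>s. a (x0 + s *\<^sub>R (x - x0)) h) t :> dd (\<lambda>y. a y h) (x0 + t *\<^sub>R (x - x0)) (x - x0)"
          using smooth_on_differentiable[OF smooth zt]
          by (intro DERIV_along_line) (simp add: z_def)
        then have "DERIV (\<lambda>s. a (z x s) h) t :> dd (\<lambda>y. a y h) (z x t) (x - x0)"
          by (simp add: z_def)
        from DERIV_mult[OF DERIV_ident this]
        have "DERIV (\<lambda>s. s * a (z x s) h) t :> F x t h"
          using closed[OF zt] by (simp add: F_def algebra_simps)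
        then show "((\<lambda>s. s * a (z x s) h) has_vector_derivative F x t h) (at t within {0..1})"
          by (simp add: has_real_derivative_iff_has_vector_derivative has_vector_derivative_at_within)
      qed simp
      then have "integral {0..1} (\<lambda>t. F x t h) = a x h"
        by (auto simp: z_def dest: integral_unique)
      finally show ?thesis .
    qed
    then have "blinfun_apply (integral (cbox 0 1) (fx x)) = a x" ..
    ultimately show ?thesis by simp
  qed
  then show ?thesis by blast
qed

section \<open>Inner products on the tangent space\<close>

locale inner_form =
  fixes b :: "'n::finite bilin"
  assumes bilin: "bilinear b"
    and sym: "b u v = b v u"
    and pos: "v \<noteq> 0 \<Longrightarrow> b v v > 0"
begin

lemmas form_simps = bilinear_ladd[OF bilin] bilinear_radd[OF bilin] bilinear_lmul[OF bilin]
  bilinear_rmul[OF bilin] bilinear_lneg[OF bilin] bilinear_rneg[OF bilin] bilinear_lzero[OF bilin]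
  bilinear_rzero[OF bilin] bilinear_lsub[OF bilin] bilinear_rsub[OF bilin]

lemma linear_right: "linear (b u)" and linear_left: "linear (\<lambda>u. b u v)"
  using bilin by (auto simp: bilinear_def)

lemma sum_left: "b (\<Sum>i\<in>I. f i) v = (\<Sum>i\<in>I. b (f i) v)"
  using linear_sum[OF linear_left] .

lemma nondegenerate:
  assumes "\<And>w. b u w = b v w"
  shows "u = v"
proof -
  have "b (u - v) (u - v) = 0" by (simp add: bilinear_lsub[OF bilin] assms)
  then show ?thesis using pos[of "u - v"] by force
qed

lemma sharp_eqI:
  assumes "\<And>w. b v w = \<alpha> w"
  shows "sharp b \<alpha> = v"
  unfolding sharp_def
proof (rule the_equality)
  show "\<forall>w. b v w = \<alpha> w" using assms by blast
  show "u = v" if "\<forall>w. b u w = \<alpha> w" for u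
    by (rule nondegenerate) (simp add: assms that)
qed

text \<open>Riesz representation: the map T sending v to the components of \<open>b v\<close> is
  injective by nondegeneracy, hence onto by dimension.\<close>

lemma sharp_works:
  assumes "linear \<alpha>"
  shows "b (sharp b \<alpha>) w = \<alpha> w"
proof -
  define T where "T v = (\<chi> i. b v (axis i 1))" for v
  have lin: "linear T"
    unfolding T_def by (rule linearI) (auto simp: vec_eq_iff form_simps)
  have expand: "b v w = (\<Sum>i\<in>UNIV. w $ i * T v $ i)" for v w
    using linear_axis_expansion[OF linear_right, of v w] by (simp add: T_def)
  have "inj T"
    unfolding linear_injective_0[OF lin]
  proof (intro allI impI)
    fix v assume "T v = 0"
    then show "v = 0" by (intro nondegenerate) (simp add: expand[of v] form_simps)
  qed
  then have "surj T" using lin linear_injective_imp_surjective by blast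
  then obtain v where v: "T v = (\<chi> i. \<alpha> (axis i 1))" by (metis surjD)
  have *: "b v w = \<alpha> w" for w
    using linear_axis_expansion[OF assms, of w] by (simp add: expand v)
  then have "sharp b \<alpha> = v" by (rule sharp_eqI)
  with * show ?thesis by simp
qed

lemma sharp_form: "sharp b (b v) = v"
  by (rule sharp_eqI) simp

lemma sharp_linear:
  assumes "\<And>u. linear (\<alpha> u)" "\<And>w. linear (\<lambda>u. \<alpha> u w)"
  shows "linear (\<lambda>u. sharp b (\<alpha> u))"
proof (rule linearI)
  show "sharp b (\<alpha> (u + v)) = sharp b (\<alpha> u) + sharp b (\<alpha> v)" for u v
    by (rule sharp_eqI) (simp add: form_simps sharp_works assms(1) linear_add[OF assms(2)])
  show "sharp b (\<alpha> (c *\<^sub>R u)) = c *\<^sub>R sharp b (\<alpha> u)" for c u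
    by (rule sharp_eqI) (simp add: form_simps sharp_works assms(1) linear_cmul[OF assms(2)])
qed

section \<open>Orthonormal frames and traces\<close>

lemma orthonormal_set_exists:
  assumes "k \<le> CARD('n)"
  shows "\<exists>E. finite E \<and> card E = k \<and> (\<forall>u\<in>E. \<forall>v\<in>E. b u v = (if u = v then 1 else 0))"
  using assms
proof (induction k)
  case 0
  show ?case by (rule exI[of _ "{}"]) auto
next
  case (Suc k)
  then obtain E where E: "finite E" "card E = k"
    "\<And>u v. u \<in> E \<Longrightarrow> v \<in> E \<Longrightarrow> b u v = (if u = v then 1 else 0)" by auto
  \<comment> \<open>Fewer than n vectors do not span, so there is a vector v to which the
    Gram-Schmidt step below can be applied.\<close>
  have "dim E < CARD('n)" using dim_le_card'[OF E(1)] E(2) Suc.prems by linarith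
  then have "span E \<noteq> UNIV" using dim_span[of E] by force
  then obtain v where v: "v \<notin> span E" by blast
  define w where "w = v - (\<Sum>e\<in>E. b v e *\<^sub>R e)"
  have "(\<Sum>e\<in>E. b v e *\<^sub>R e) \<in> span E" by (intro span_sum span_scale span_base)
  then have "w \<noteq> 0" using v by (auto simp: w_def)
  then have bw: "b w w > 0" by (rule pos)
  have we: "b w e = 0" if "e \<in> E" for e
  proof -
    have "b w e = b v e - (\<Sum>e'\<in>E. b v e' * b e' e)" by (simp add: w_def form_simps sum_left)
    also have "(\<Sum>e'\<in>E. b v e' * b e' e) = (\<Sum>e'\<in>E. if e' = e then b v e else 0)"
      by (rule sum.cong) (use E that in auto)
    also have "\<dots> = b v e" using E that by simp
    finally show ?thesis by simp
  qed
  define u where "u = (1 / sqrt (b w w)) *\<^sub>R w"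
  have uu: "b u u = 1" using bw by (simp add: u_def form_simps flip: power2_eq_square)
  have ue: "b u e = 0" "b e u = 0" if "e \<in> E" for e
    using we[OF that] sym[of e u] by (simp_all add: u_def form_simps)
  then have "u \<notin> E" using uu by force
  then show ?case
    by (intro exI[of _ "insert u E"]) (use E uu ue in auto)
qed

lemma orthonormal_frame_exists: "\<exists>e. orthonormal_frame b e"
proof -
  obtain E where E: "finite E" "card E = CARD('n)"
    "\<And>u v. u \<in> E \<Longrightarrow> v \<in> E \<Longrightarrow> b u v = (if u = v then 1 else 0)"
    using orthonormal_set_exists[of "CARD('n)"] by auto
  then obtain e where e: "bij_betw e (UNIV :: 'n set) E"
    using finite_same_card_bij[OF finite_class.finite_UNIV E(1)] by metis
  then have "orthonormal_frame b e"
    unfolding orthonormal_frame_def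
    using E(3)[OF bij_betw_apply[OF e] bij_betw_apply[OF e]] inj_eq[OF bij_betw_imp_inj_on[OF e]]
    by simp
  then show ?thesis by auto
qed

lemma orthonormal_some_frame: "orthonormal_frame b (some_frame b)"
  unfolding some_frame_def using orthonormal_frame_exists by (rule someI_ex)

text \<open>Spanning comes from a dimension count: the map T from coefficients to combinations is
  injective because \<open>b (T c) (e j)\<close> recovers the coefficients, so it is onto.\<close>

lemma frame_expansion:
  assumes "orthonormal_frame b e"
  shows "v = (\<Sum>i\<in>UNIV. b v (e i) *\<^sub>R e i)"
proof -
  define T where "T c = (\<Sum>i\<in>UNIV. (c $ i) *\<^sub>R e i)" for c :: "real ^ 'n"
  have lin: "linear T"
    by (rule linearI) (auto simp: T_def scaleR_add_left sum.distrib scaleR_sum_right)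
  have bT: "b (T c) (e j) = c $ j" for c j
  proof -
    have "b (T c) (e j) = (\<Sum>i\<in>UNIV. if i = j then c $ j else 0)"
      unfolding T_def sum_left using assms
      by (intro sum.cong) (auto simp: form_simps orthonormal_frame_def)
    then show ?thesis by simp
  qed
  have "inj T"
    unfolding linear_injective_0[OF lin]
  proof (intro allI impI)
    fix c assume "T c = 0"
    then have "c $ j = 0" for j using bT[of c j] by (simp only: form_simps)
    then show "c = 0" by (simp add: vec_eq_iff)
  qed
  then have "surj T" using lin linear_injective_imp_surjective by blast
  then obtain c where "v = T c" by (metis surjD)
  with bT show ?thesis by (simp add: T_def)
qed

text \<open>The gradient of the a-th coordinate, whose components form a row of the inverse metric
  matrix. Unlike an orthonormal frame picked at each point, it varies smoothly with the
  metric.\<close>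

definition dual_axis :: "'n \<Rightarrow> real ^ 'n" where
  "dual_axis a = sharp b (\<lambda>w. w $ a)"

lemma dual_axis: "b (dual_axis a) w = w $ a"
  unfolding dual_axis_def by (rule sharp_works) (rule bounded_linear.linear[OF bounded_linear_vec_nth])

text \<open>Expanding \<open>dual_axis a\<close> in the frame and summing over a rebuilds
  \<open>e i\<close> in the second slot. The right-hand side, the contraction of B with the inverse
  metric, shows independence of the frame and is accessible to differentiation.\<close>

lemma frame_trace:
  assumes e: "orthonormal_frame b e" and B: "bilinear (B :: 'n bilin)"
  shows "(\<Sum>i\<in>UNIV. B (e i) (e i)) = (\<Sum>a\<in>UNIV. B (dual_axis a) (axis a 1))"
proof -
  have l: "linear (\<lambda>u. B u v)" "linear (B u)" for u v
    using B by (auto simp: bilinear_def)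
  have "B (dual_axis a) v = (\<Sum>i\<in>UNIV. e i $ a * B (e i) v)" for a v
  proof -
    have "B (dual_axis a) v = B (\<Sum>i\<in>UNIV. b (dual_axis a) (e i) *\<^sub>R e i) v"
      by (subst (1) frame_expansion[OF e]) simp
    then show ?thesis by (simp add: dual_axis linear_sum[OF l(1)] linear_cmul[OF l(1)])
  qed
  then have "(\<Sum>a\<in>UNIV. B (dual_axis a) (axis a 1)) = (\<Sum>a\<in>UNIV. \<Sum>i\<in>UNIV. e i $ a * B (e i) (axis a 1))"
    by simp
  also have "\<dots> = (\<Sum>i\<in>UNIV. \<Sum>a\<in>UNIV. e i $ a * B (e i) (axis a 1))"
    by (rule sum.swap)
  also have "\<dots> = (\<Sum>i\<in>UNIV. B (e i) (e i))"
  proof -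
    have "B (e i) (e i) = (\<Sum>a\<in>UNIV. e i $ a * B (e i) (axis a 1))" for i
      using linear_axis_expansion[OF l(2)[of "e i"], of "e i"] by simp
    then show ?thesis by simp
  qed
  finally show ?thesis ..
qed

lemma bilinear_sum:
  assumes "\<And>i. i \<in> I \<Longrightarrow> bilinear (B i :: 'n bilin)"
  shows "bilinear (\<lambda>u v. \<Sum>i\<in>I. B i u v)"
proof -
  have "linear (B i u)" "linear (\<lambda>u. B i u v)" if "i \<in> I" for i u v
    using assms[OF that] unfolding bilinear_def by blast+
  then show ?thesis unfolding bilinear_def by (auto intro!: linear_compose_sum)
qed

lemma bilinear_form_comp:
  assumes "linear f" "linear h"
  shows "bilinear (\<lambda>u v. b (f u) (h v))"
  using linear_compose[OF assms(2) linear_right] linear_compose[OF assms(1) linear_left]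
  unfolding bilinear_def o_def by blast

lemma double_frame_trace:
  assumes e: "orthonormal_frame b e" and P: "bilinear P" and Q: "bilinear Q"
  shows "(\<Sum>i\<in>UNIV. \<Sum>j\<in>UNIV. b (P (e i) (e j)) (Q (e i) (e j)))
    = (\<Sum>a\<in>UNIV. \<Sum>c\<in>UNIV. b (P (dual_axis a) (dual_axis c)) (Q (axis a 1) (axis c 1)))"
proof -
  have l: "linear (P u)" "linear (\<lambda>u. P u v)" "linear (Q u)" "linear (\<lambda>u. Q u v)" for u v
    using P Q by (auto simp: bilinear_def)
  have "(\<Sum>j\<in>UNIV. b (P (e i) (e j)) (Q (e i) (e j)))
      = (\<Sum>c\<in>UNIV. b (P (e i) (dual_axis c)) (Q (e i) (axis c 1)))" for i
    by (rule frame_trace[OF e, of "\<lambda>u v. b (P (e i) u) (Q (e i) v)"])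
      (intro bilinear_form_comp l)
  then have "(\<Sum>i\<in>UNIV. \<Sum>j\<in>UNIV. b (P (e i) (e j)) (Q (e i) (e j)))
      = (\<Sum>i\<in>UNIV. (\<Sum>c\<in>UNIV. b (P (e i) (dual_axis c)) (Q (e i) (axis c 1))))" by simp
  also have "\<dots> = (\<Sum>a\<in>UNIV. \<Sum>c\<in>UNIV. b (P (dual_axis a) (dual_axis c)) (Q (axis a 1) (axis c 1)))"
    by (rule frame_trace[OF e, of "\<lambda>u v. \<Sum>c\<in>UNIV. b (P u (dual_axis c)) (Q v (axis c 1))"])
      (intro bilinear_sum bilinear_form_comp l)
  finally show ?thesis .
qed

text \<open>Both sides equal the frame-free contraction of \<open>double_frame_trace\<close>. The
  freedom of frame is what allows a frame to be transported by an isometry.\<close>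

lemma F_inner_frame:
  assumes "orthonormal_frame b e" "bilinear P" "bilinear Q"
  shows "F_inner b P Q = 1 / 2 * (\<Sum>i\<in>UNIV. \<Sum>j\<in>UNIV. b (P (e i) (e j)) (Q (e i) (e j)))"
  unfolding F_inner_def Let_def
  unfolding double_frame_trace[OF orthonormal_some_frame assms(2,3)] double_frame_trace[OF assms] ..

lemma F_inner_coords:
  assumes "bilinear P" "bilinear Q"
  shows "F_inner b P Q =
    1 / 2 * (\<Sum>a\<in>UNIV. \<Sum>c\<in>UNIV. b (P (dual_axis a) (dual_axis c)) (Q (axis a 1) (axis c 1)))"
  unfolding F_inner_def Let_def
  unfolding double_frame_trace[OF orthonormal_some_frame assms] ..

lemma F_inner_commute: "F_inner b P Q = F_inner b Q P"
  unfolding F_inner_def Let_def sym[of "P _ _"] ..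

lemma F_inner_linear:
  assumes "\<And>u v. linear (\<lambda>w. Q w u v)"
  shows "linear (\<lambda>w. F_inner b P (Q w))"
proof (rule linearI)
  show "F_inner b P (Q (w + w')) = F_inner b P (Q w) + F_inner b P (Q w')" for w w'
    unfolding F_inner_def Let_def by (simp add: linear_add[OF assms] form_simps sum.distrib algebra_simps)
  show "F_inner b P (Q (c *\<^sub>R w)) = c *\<^sub>R F_inner b P (Q w)" for w c
    unfolding F_inner_def Let_def by (simp add: linear_cmul[OF assms] form_simps sum_distrib_left algebra_simps)
qed

text \<open>A nonpositive sum of squares forces all components in the frame to vanish.\<close>

lemma F_inner_pos:
  assumes P: "bilinear P" and "F_inner b P P \<le> 0"
  shows "P u v = 0"
proof -
  define e where "e = some_frame b"
  have e: "orthonormal_frame b e" unfolding e_def by (rule orthonormal_some_frame)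
  have nn: "b w w \<ge> 0" for w using pos[of w] by (cases "w = 0") (auto simp: form_simps)
  have "(\<Sum>i\<in>UNIV. \<Sum>j\<in>UNIV. b (P (e i) (e j)) (P (e i) (e j))) = 0"
  proof (rule antisym)
    show "(\<Sum>i\<in>UNIV. \<Sum>j\<in>UNIV. b (P (e i) (e j)) (P (e i) (e j))) \<le> 0"
      using assms(2) unfolding F_inner_def Let_def e_def[symmetric] by simp
  qed (intro sum_nonneg nn)
  then have "b (P (e i) (e j)) (P (e i) (e j)) = 0" for i j
    by (simp add: sum_nonneg_eq_0_iff sum_nonneg nn)
  then have 0: "P (e i) (e j) = 0" for i j using pos by force
  have l: "linear (P u)" "linear (\<lambda>u. P u v)" for u v
    using P by (auto simp: bilinear_def)
  have 1: "P (e i) v = 0" for i v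
    by (subst frame_expansion[OF e, of v]) (simp add: linear_sum[OF l(1)] linear_cmul[OF l(1)] 0)
  show ?thesis
    by (subst frame_expansion[OF e, of u]) (simp add: linear_sum[OF l(2)] linear_cmul[OF l(2)] 1)
qed

end

section \<open>Smooth dependence of \<open>sharp\<close> on the metric\<close>

lemma smooth_on_det:
  fixes A :: "'a::real_normed_vector \<Rightarrow> real ^ 'n ^ 'n"
  assumes "open S" "\<And>i j. smooth_on S (\<lambda>x. A x $ i $ j)"
  shows "smooth_on S (\<lambda>x. det (A x))"
  unfolding det_def
  by (intro smooth_on_sum[OF assms(1)] smooth_on_mult[OF smooth_on_const[OF assms(1)]]
      smooth_on_prod[OF assms(1)] assms(2))

text \<open>Cramer's rule writes the coordinates of \<open>sharp\<close> as quotients of determinants.\<close>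

lemma smooth_on_sharp:
  fixes G :: "'a::real_normed_vector \<Rightarrow> 'n::finite bilin"
  assumes S: "open S" and G: "\<And>y. y \<in> S \<Longrightarrow> inner_form (G y)" "\<And>u v. smooth_on S (\<lambda>y. G y u v)"
    and \<alpha>: "\<And>y. y \<in> S \<Longrightarrow> linear (\<alpha> y)" "\<And>v. smooth_on S (\<lambda>y. \<alpha> y v)"
  shows "smooth_on S (\<lambda>y. sharp (G y) (\<alpha> y))"
proof -
  define A where "A y = (\<chi> i j. G y (axis j 1) (axis i 1))" for y
  define c where "c y = (\<chi> i. \<alpha> y (axis i 1))" for y
  have Av: "(A y *v v) $ i = G y v (axis i 1)" if "y \<in> S" for y v i
  proof -
    interpret inner_form "G y" using G(1) that .
    have "G y v (axis i 1) = (\<Sum>j\<in>UNIV. v $ j * G y (axis j 1) (axis i 1))"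
      using linear_axis_expansion[OF linear_left[of "axis i 1"], of v] by simp
    then show ?thesis by (simp add: A_def matrix_vector_mult_def mult.commute)
  qed
  have det: "det (A y) \<noteq> 0" if y: "y \<in> S" for y
  proof -
    interpret inner_form "G y" using G(1) that .
    have "v = 0" if "A y *v v = 0" for v
    proof (rule nondegenerate)
      fix w
      have "G y v (axis i 1) = 0" for i using Av[OF y, of v i] that by simp
      then show "G y v w = G y 0 w"
        using linear_axis_expansion[OF linear_right, of v w] by (simp add: form_simps)
    qed
    then show ?thesis
      using matrix_left_invertible_ker[of "A y"] invertible_left_inverse[of "A y"]
        invertible_det_nz[of "A y"] by auto
  qed
  have eq: "sharp (G y) (\<alpha> y) $ k = det (\<chi> i j. if j = k then c y $ i else A y $ i $ j) / det (A y)"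
    if y: "y \<in> S" for y k
  proof -
    interpret inner_form "G y" using G(1) that .
    have "A y *v sharp (G y) (\<alpha> y) = c y"
      using Av[OF y] \<alpha>(1)[OF y] by (simp add: vec_eq_iff c_def sharp_works)
    then show ?thesis using cramer[OF det[OF y]] by simp
  qed
  show ?thesis
  proof (rule smooth_on_vecI[OF S])
    fix k
    have "smooth_on S (\<lambda>y. det (\<chi> i j. if j = k then c y $ i else A y $ i $ j) / det (A y))"
    proof (intro smooth_on_divide smooth_on_det S)
      fix i j
      show "smooth_on S (\<lambda>x. (\<chi> i j. if j = k then c x $ i else A x $ i $ j) $ i $ j)"
        using G(2) \<alpha>(2) by (cases "j = k") (simp_all add: c_def A_def)
      show "smooth_on S (\<lambda>x. A x $ i $ j)" using G(2) by (simp add: A_def)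
    qed (use det in auto)
    then show "smooth_on S (\<lambda>y. sharp (G y) (\<alpha> y) $ k)"
      using eq by (subst smooth_on_cong) auto
  qed
qed

section \<open>Curvature in a chart\<close>

lemma linear_dd:
  assumes S: "open S" "x \<in> S" and L: "\<And>y. y \<in> S \<Longrightarrow> linear (L y)"
    "\<And>v. (\<lambda>y. L y v) differentiable (at x)"
  shows "linear (\<lambda>v. dd (\<lambda>y. L y v) x h)"
proof (rule linearI)
  have D: "((\<lambda>y. L y v) has_derivative dd (\<lambda>y. L y v) x) (at x)" for v
    using L(2) frechet_derivative_works by blast
  show "dd (\<lambda>y. L y (v + w)) x h = dd (\<lambda>y. L y v) x h + dd (\<lambda>y. L y w) x h" for v w
    by (intro has_derivative_imp_dd
        has_derivative_transform_within_open[OF has_derivative_add[OF D D] S])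
      (simp add: linear_add[OF L(1)])
  show "dd (\<lambda>y. L y (c *\<^sub>R v)) x h = c *\<^sub>R dd (\<lambda>y. L y v) x h" for c v
    by (intro has_derivative_imp_dd
        has_derivative_transform_within_open[OF has_derivative_scaleR_right[OF D] S])
      (simp add: linear_cmul[OF L(1)])
qed

lemma linear_dd_right:
  assumes "f differentiable (at x)"
  shows "linear (dd f x)"
  using assms by (simp add: linear_frechet_derivative)

lemma bilinearI:
  assumes "\<And>u. linear (f u)" "\<And>v. linear (\<lambda>u. f u v)"
  shows "bilinear f"
  using assms by (simp add: bilinear_def)

lemma bilinearD:
  assumes "bilinear f"
  shows "linear (f u)" "linear (\<lambda>u. f u v)"
  using assms by (simp_all add: bilinear_def)

lemma linear_comp: "linear f \<Longrightarrow> linear g \<Longrightarrow> linear (\<lambda>x. g (f x))"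
  using linear_compose[of f g] by (simp add: o_def)

locale chart_metric =
  fixes S :: "(real ^ 'n::finite) set" and G :: "'n metric"
  assumes open_S: "open S"
    and smooth_G: "smooth_on S (\<lambda>x. G x u v)"
    and form: "x \<in> S \<Longrightarrow> inner_form (G x)"
begin

lemma bilinear_G: "x \<in> S \<Longrightarrow> bilinear (G x)"
  using form inner_form.bilin by blast

lemma G_sym: "x \<in> S \<Longrightarrow> G x u v = G x v u"
  using form inner_form.sym by blast

lemmas G_linear = bilinearD[OF bilinear_G]
lemmas diff_G = smooth_on_differentiable[OF smooth_G]

lemmas smooth_on_G_apply = smooth_on_bilinear_apply[OF bilinear_G smooth_G]

lemma dd_G_sym: "x \<in> S \<Longrightarrow> dd (\<lambda>y. G y u v) x w = dd (\<lambda>y. G y v u) x w"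
  by (rule fun_cong[OF frechet_derivative_cong_open[OF open_S]]) (auto intro: G_sym)

text \<open>The Koszul formula for constant coefficient fields, whose brackets vanish; in
  coordinates these are the Christoffel symbols of the first kind.\<close>

definition koszul :: "real ^ 'n \<Rightarrow> real ^ 'n \<Rightarrow> real ^ 'n \<Rightarrow> real ^ 'n \<Rightarrow> real" where
  "koszul x u v w = 1 / 2 * (dd (\<lambda>y. G y v w) x u + dd (\<lambda>y. G y u w) x v - dd (\<lambda>y. G y u v) x w)"

lemma dd_G_linear:
  assumes "x \<in> S"
  shows "linear (\<lambda>v. dd (\<lambda>y. G y v w) x u)" "linear (\<lambda>w. dd (\<lambda>y. G y v w) x u)"
    "linear (\<lambda>u. dd (\<lambda>y. G y v w) x u)"
  using assms
  by (auto intro!: linear_dd[OF open_S] linear_dd_right diff_G G_linear)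

lemma koszul_linear:
  assumes "x \<in> S"
  shows "linear (koszul x u v)" "linear (\<lambda>v. koszul x u v w)" "linear (\<lambda>u. koszul x u v w)"
  unfolding koszul_def
  by (intro linear_compose_scale_right[where 'b = real, simplified] linear_compose_add
      linear_compose_sub dd_G_linear assms)+

lemma smooth_koszul: "smooth_on S (\<lambda>x. koszul x u v w)"
  unfolding koszul_def
  by (intro smooth_on_mult smooth_on_const open_S smooth_on_add smooth_on_diff smooth_on_dd smooth_G)

lemma christoffel_koszul: "christoffel G x u v = sharp (G x) (koszul x u v)"
  unfolding christoffel_def koszul_def ..

lemma G_christoffel: "x \<in> S \<Longrightarrow> G x (christoffel G x u v) w = koszul x u v w"
  unfolding christoffel_koszul by (intro inner_form.sharp_works form koszul_linear)

lemma christoffel_sym: "x \<in> S \<Longrightarrow> christoffel G x u v = christoffel G x v u"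
  unfolding christoffel_koszul koszul_def using dd_G_sym[of x u v] by (simp add: add.commute)

lemma bilinear_christoffel:
  assumes "x \<in> S"
  shows "bilinear (christoffel G x)"
  unfolding christoffel_koszul
  by (intro bilinearI inner_form.sharp_linear form koszul_linear assms)

lemmas christoffel_linear = bilinearD[OF bilinear_christoffel]

lemma smooth_christoffel: "smooth_on S (\<lambda>x. christoffel G x u v)"
  unfolding christoffel_koszul
  by (intro smooth_on_sharp open_S form smooth_G koszul_linear smooth_koszul)

lemmas diff_christoffel = smooth_on_differentiable[OF smooth_christoffel]

text \<open>This is \<nabla>g = 0: in the sum of the two Koszul expressions the derivatives along v
  and w cancel.\<close>

lemma metric_compatible:
  assumes "x \<in> S"
  shows "dd (\<lambda>y. G y v w) x u = G x (christoffel G x u v) w + G x v (christoffel G x u w)"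
  using dd_G_sym[OF assms] 
  unfolding G_christoffel[OF assms] G_sym[OF assms, of v] koszul_def by (simp add: field_simps)

section \<open>The curvature operator and its symmetries\<close>

lemma nabla_const: "nabla G (\<lambda>_. u) (\<lambda>_. v) x = christoffel G x u v"
  by (simp add: nabla_def)

text \<open>The iterated derivative of w along v and then along u, all extended with constant
  coefficients. The brackets vanish, so the curvature is the antisymmetrisation in u and v, with the
  sign fixed by the convention for \<open>Rm_op\<close>.\<close>

definition nabla_nabla :: "real ^ 'n \<Rightarrow> real ^ 'n \<Rightarrow> real ^ 'n \<Rightarrow> real ^ 'n \<Rightarrow> real ^ 'n" where
  "nabla_nabla x u v w = dd (\<lambda>y. christoffel G y v w) x u + christoffel G x u (christoffel G x v w)"

lemma Rm_op_eq:
  assumes "x \<in> S"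
  shows "Rm_op G x u v w = nabla_nabla x v u w - nabla_nabla x u v w"
proof -
  have n: "nabla G (\<lambda>_. a) (\<lambda>_. b) = (\<lambda>x. christoffel G x a b)" for a b
    by (rule ext) (simp add: nabla_const)
  have "nabla G (lie_bracket (\<lambda>_. u) (\<lambda>_. v)) (\<lambda>_. w) x = 0"
    using linear_0[OF christoffel_linear(2)[OF assms]] by (simp add: nabla_def lie_bracket_def)
  then show ?thesis
    unfolding Rm_op_def Let_def n nabla_nabla_def by (simp add: nabla_def)
qed

lemma nabla_nabla_linear:
  assumes x: "x \<in> S"
  shows "linear (nabla_nabla x u v)" "linear (\<lambda>v. nabla_nabla x u v w)" "linear (\<lambda>u. nabla_nabla x u v w)"
proof -
  show "linear (nabla_nabla x u v)"
    unfolding nabla_nabla_def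
    by (intro linear_compose_add linear_dd[OF open_S x] linear_comp[OF _ christoffel_linear(1)[OF x]]
        christoffel_linear diff_christoffel x)
  show "linear (\<lambda>v. nabla_nabla x u v w)"
    unfolding nabla_nabla_def
    by (intro linear_compose_add linear_dd[OF open_S x] linear_comp[OF _ christoffel_linear(1)[OF x]]
        christoffel_linear diff_christoffel x)
  show "linear (\<lambda>u. nabla_nabla x u v w)"
    unfolding nabla_nabla_def
    by (intro linear_compose_add linear_dd_right christoffel_linear diff_christoffel x)
qed

lemma smooth_nabla_nabla: "smooth_on S (\<lambda>x. nabla_nabla x u v w)"
  unfolding nabla_nabla_def
  by (intro smooth_on_add smooth_on_dd smooth_christoffel
      smooth_on_bilinear_apply[OF bilinear_christoffel smooth_christoffel] smooth_on_const open_S)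

lemma Rm_op_linear:
  assumes "x \<in> S"
  shows "linear (Rm_op G x u v)" "linear (\<lambda>v. Rm_op G x u v w)" "linear (\<lambda>u. Rm_op G x u v w)"
  unfolding Rm_op_eq[OF assms]
  by (auto intro!: linear_compose_sub nabla_nabla_linear assms simp: Rm_op_eq[OF assms, abs_def])

lemma smooth_Rm_op: "smooth_on S (\<lambda>x. Rm_op G x u v w)"
  by (subst smooth_on_cong[OF Rm_op_eq], assumption) (intro smooth_on_diff smooth_nabla_nabla)

lemma Rm_eq: "x \<in> S \<Longrightarrow> Rm G x w u v = Rm_op G x u v w"
  unfolding Rm_def Rm4_def[abs_def] by (simp add: inner_form.sharp_form form)

lemma Rm4_linear:
  assumes "x \<in> S"
  shows "linear (Rm4 G x u v w)" "linear (\<lambda>w. Rm4 G x u v w z)"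
    "linear (\<lambda>v. Rm4 G x u v w z)" "linear (\<lambda>u. Rm4 G x u v w z)"
  unfolding Rm4_def
  by (intro G_linear linear_comp[OF _ G_linear(2)] Rm_op_linear assms)+

lemma smooth_Rm4: "smooth_on S (\<lambda>x. Rm4 G x u v w z)"
  unfolding Rm4_def
  by (intro smooth_on_G_apply smooth_Rm_op smooth_on_const open_S)

lemma Rm4_antisym: "x \<in> S \<Longrightarrow> Rm4 G x u v w z = - Rm4 G x v u w z"
  unfolding Rm4_def by (simp add: Rm_op_eq linear_diff[OF G_linear(2)])

lemma dd_christoffel_sym: "x \<in> S \<Longrightarrow> dd (\<lambda>y. christoffel G y u v) x w = dd (\<lambda>y. christoffel G y v u) x w"
  by (rule fun_cong[OF frechet_derivative_cong_open[OF open_S]]) (auto intro: christoffel_sym)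

lemma nabla_nabla_sym: "x \<in> S \<Longrightarrow> nabla_nabla x u v w = nabla_nabla x u w v"
  unfolding nabla_nabla_def using dd_christoffel_sym[of x v w u] christoffel_sym[of x v w] by simp

text \<open>Torsion freeness makes \<open>nabla_nabla\<close> symmetric in its last two vectors, so
  the six terms of the cyclic sum cancel in pairs.\<close>

lemma Rm_op_Bianchi:
  assumes "x \<in> S"
  shows "Rm_op G x u v w + Rm_op G x v w u + Rm_op G x w u v = 0"
  using nabla_nabla_sym[OF assms, of u v w] nabla_nabla_sym[OF assms, of v w u]
    nabla_nabla_sym[OF assms, of w u v]
  by (simp add: Rm_op_eq[OF assms])

lemma Rm4_Bianchi:
  assumes "x \<in> S"
  shows "Rm4 G x u v w z + Rm4 G x v w u z + Rm4 G x w u v z = 0"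
proof -
  have "Rm4 G x u v w z + Rm4 G x v w u z + Rm4 G x w u v z
      = G x (Rm_op G x u v w + Rm_op G x v w u + Rm_op G x w u v) z"
    unfolding Rm4_def by (simp add: linear_add[OF G_linear(2)[OF assms]])
  then show ?thesis
    by (simp add: Rm_op_Bianchi[OF assms] linear_0[OF G_linear(2)[OF assms]])
qed

lemma dd_G_bilinear_apply:
  assumes x: "x \<in> S" and X: "X differentiable (at x)" and Y: "Y differentiable (at x)"
  shows "dd (\<lambda>y. G y (X y) (Y y)) x h
    = dd (\<lambda>y. G y (X x) (Y x)) x h + G x (dd X x h) (Y x) + G x (X x) (dd Y x h)"
  by (intro has_derivative_imp_dd has_derivative_bilinear_apply[OF open_S x bilinear_G diff_G])
    (use assms in \<open>auto simp: frechet_derivative_works\<close>)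

text \<open>Differentiating \<open>\<nabla>g = 0\<close> once more and commuting the second derivatives of \<open>g\<close>.\<close>

lemma Rm4_antisym_last:
  assumes x: "x \<in> S"
  shows "Rm4 G x u v w z = - Rm4 G x u v z w"
proof -
  let ?C = "christoffel G"
  have eq: "dd (\<lambda>y. dd (\<lambda>y. G y w z) y v) x u =
     G x (nabla_nabla x u v w) z + G x w (nabla_nabla x u v z)
      + G x (?C x v w) (?C x u z) + G x (?C x u w) (?C x v z)" for u v
  proof -
    have "dd (\<lambda>y. dd (\<lambda>y. G y w z) y v) x u
        = dd (\<lambda>y. G y (?C y v w) z + G y w (?C y v z)) x u"
      by (rule fun_cong[OF frechet_derivative_cong_open[OF open_S x]]) (rule metric_compatible)
    also have "\<dots> = dd (\<lambda>y. G y (?C y v w) z) x u + dd (\<lambda>y. G y w (?C y v z)) x u"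
    proof (intro has_derivative_imp_dd has_derivative_add)
      have "smooth_on S (\<lambda>y. G y (?C y v w) z)" "smooth_on S (\<lambda>y. G y w (?C y v z))"
        by (auto intro!: smooth_on_G_apply smooth_christoffel smooth_on_const open_S)
      then show "((\<lambda>y. G y (?C y v w) z) has_derivative dd (\<lambda>y. G y (?C y v w) z) x) (at x)"
        "((\<lambda>y. G y w (?C y v z)) has_derivative dd (\<lambda>y. G y w (?C y v z)) x) (at x)"
        using x by (auto intro: smooth_on_has_derivative)
    qed
    also have "dd (\<lambda>y. G y (?C y v w) z) x u = dd (\<lambda>y. G y (?C x v w) z) x u
        + G x (dd (\<lambda>y. ?C y v w) x u) z"
      by (subst dd_G_bilinear_apply[OF x diff_christoffel[OF x]])
        (simp_all add: linear_0[OF G_linear(1)[OF x]])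
    also have "dd (\<lambda>y. G y w (?C y v z)) x u = dd (\<lambda>y. G y w (?C x v z)) x u
        + G x w (dd (\<lambda>y. ?C y v z) x u)"
      by (subst dd_G_bilinear_apply[OF x _ diff_christoffel[OF x]])
        (simp_all add: linear_0[OF G_linear(2)[OF x]])
    finally show ?thesis
      unfolding metric_compatible[OF x] nabla_nabla_def
      by (simp add: linear_add[OF G_linear(1)[OF x]] linear_add[OF G_linear(2)[OF x]])
  qed
  have "dd (\<lambda>y. dd (\<lambda>y. G y w z) y v) x u = dd (\<lambda>y. dd (\<lambda>y. G y w z) y u) x v"
    by (rule dd_dd_commute_real[OF smooth_G x])
  \<comment> \<open>The two products of Christoffel terms in \<open>eq\<close> are exchanged by
    swapping u and v, so they drop out when both sides are equated.\<close>
  then have "G x (nabla_nabla x u v w) z + G x w (nabla_nabla x u v z)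
      = G x (nabla_nabla x v u w) z + G x w (nabla_nabla x v u z)"
    unfolding eq[of u v] eq[of v u] by simp
  then show ?thesis
    unfolding Rm4_def Rm_op_eq[OF x] G_sym[OF x, of _ w]
    by (simp add: linear_diff[OF G_linear(1)[OF x]] linear_diff[OF G_linear(2)[OF x]])
qed

text \<open>Adding the first two of the four Bianchi identities and subtracting the last two, the
  antisymmetries cancel everything except
  \<open>2 * Rm4 G x u v w z - 2 * Rm4 G x w z u v\<close>.\<close>

lemma Rm4_pair_sym:
  assumes x: "x \<in> S"
  shows "Rm4 G x u v w z = Rm4 G x w z u v"
  using Rm4_Bianchi[OF x, of u v w z] Rm4_Bianchi[OF x, of v w z u]
    Rm4_Bianchi[OF x, of w z u v] Rm4_Bianchi[OF x, of z u v w]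
    Rm4_antisym[OF x, of u v w z] Rm4_antisym[OF x, of v w u z] Rm4_antisym[OF x, of w u v z]
    Rm4_antisym[OF x, of v w z u] Rm4_antisym[OF x, of w z v u] Rm4_antisym[OF x, of z v w u]
    Rm4_antisym[OF x, of w z u v] Rm4_antisym[OF x, of z u w v] Rm4_antisym[OF x, of u w z v]
    Rm4_antisym[OF x, of z u v w] Rm4_antisym[OF x, of u v z w] Rm4_antisym[OF x, of v z u w]
    Rm4_antisym_last[OF x, of u v w z] Rm4_antisym_last[OF x, of v w u z]
    Rm4_antisym_last[OF x, of w u v z] Rm4_antisym_last[OF x, of w z u v]
    Rm4_antisym_last[OF x, of z v w u] Rm4_antisym_last[OF x, of z u w v]
  by linarith

section \<open>Ricci curvature and the smoothness of derived tensors\<close>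

lemma Ric_sym:
  assumes "x \<in> S"
  shows "Ric G x y z = Ric G x z y"
  unfolding Ric_def Let_def by (rule sum.cong[OF refl]) (rule Rm4_pair_sym[OF assms])

lemma Ric_frame:
  assumes x: "x \<in> S" and e: "orthonormal_frame (G x) e"
  shows "Ric G x y z = (\<Sum>i\<in>UNIV. Rm4 G x (e i) y (e i) z)"
proof -
  interpret inner_form "G x" using form x .
  have "bilinear (\<lambda>p q. Rm4 G x p y q z)"
    by (intro bilinearI Rm4_linear x)
  from frame_trace[OF orthonormal_some_frame this] frame_trace[OF e this] show ?thesis
    unfolding Ric_def Let_def by simp
qed

text \<open>The vectors \<open>dual_axis\<close> of all points gathered into one field on the chart,
  so that their dependence on the point can be differentiated.\<close>

definition dual :: "'n \<Rightarrow> real ^ 'n \<Rightarrow> real ^ 'n" where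
  "dual a x = sharp (G x) (\<lambda>w. w $ a)"

lemma dual_axis_eq: "x \<in> S \<Longrightarrow> inner_form.dual_axis (G x) a = dual a x"
  by (simp add: inner_form.dual_axis_def[OF form] dual_def)

lemma smooth_dual: "smooth_on S (dual a)"
  unfolding dual_def[abs_def]
  by (intro smooth_on_sharp open_S form smooth_G smooth_on_const bounded_linear.linear[OF bounded_linear_vec_nth])

text \<open>Free of the frame chosen by \<open>SOME\<close>, this expression has smooth ingredients
  only; \<open>smooth_Ric\<close> rests on it.\<close>

lemma Ric_coords:
  assumes x: "x \<in> S"
  shows "Ric G x y z = (\<Sum>a\<in>UNIV. Rm4 G x (dual a x) y (axis a 1) z)"
proof -
  interpret inner_form "G x" using form x .
  have "bilinear (\<lambda>p q. Rm4 G x p y q z)"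
    by (intro bilinearI Rm4_linear x)
  from frame_trace[OF orthonormal_some_frame this] show ?thesis
    unfolding Ric_def Let_def dual_axis_eq[OF x] .
qed

lemma bilinear_Ric:
  assumes x: "x \<in> S"
  shows "bilinear (Ric G x)"
proof (rule bilinearI)
  show "linear (Ric G x u)" for u
    unfolding Ric_def[abs_def] Let_def by (rule linear_compose_sum) (use Rm4_linear[OF x] in blast)
  show "linear (\<lambda>u. Ric G x u v)" for v
    unfolding Ric_def[abs_def] Let_def by (rule linear_compose_sum) (use Rm4_linear[OF x] in blast)
qed

lemma smooth_Ric: "smooth_on S (\<lambda>x. Ric G x y z)"
proof (subst smooth_on_cong[OF Ric_coords], assumption)
  show "smooth_on S (\<lambda>x. \<Sum>a\<in>UNIV. Rm4 G x (dual a x) y (axis a 1) z)"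
  proof (rule smooth_on_sum[OF open_S])
    fix a
    show "smooth_on S (\<lambda>x. Rm4 G x (dual a x) y (axis a 1) z)"
      by (rule smooth_on_linear_apply[where L = "\<lambda>x u. Rm4 G x u y (axis a 1) z" and X = "dual a"])
        (use Rm4_linear(4) smooth_Rm4 smooth_dual in blast)+
  qed
qed

lemma nabla_form2_eq:
  "nabla_form2 G T x u v w = dd (\<lambda>y. T y v w) x u - T x (christoffel G x u v) w - T x v (christoffel G x u w)"
  by (simp add: nabla_form2_def nabla_const)

lemma smooth_nabla_form2:
  assumes "\<And>y. y \<in> S \<Longrightarrow> bilinear (T y)" "\<And>v w. smooth_on S (\<lambda>y. T y v w)"
  shows "smooth_on S (\<lambda>x. nabla_form2 G T x u v w)"
  unfolding nabla_form2_eq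
  by (intro smooth_on_diff smooth_on_dd smooth_on_bilinear_apply[OF assms]
      smooth_christoffel smooth_on_const open_S assms)

lemma nabla_form2_linear:
  assumes x: "x \<in> S" and T: "\<And>y. y \<in> S \<Longrightarrow> bilinear (T y)" "\<And>v w. smooth_on S (\<lambda>y. T y v w)"
  shows "linear (nabla_form2 G T x u v)" "linear (\<lambda>v. nabla_form2 G T x u v w)"
    "linear (\<lambda>u. nabla_form2 G T x u v w)"
proof -
  have l: "linear (T y a)" "linear (\<lambda>a. T y a c)" if "y \<in> S" for y a c
    using bilinearD[OF T(1)[OF that]] by auto
  have d: "(\<lambda>y. T y a c) differentiable (at x)" for a c
    using smooth_on_differentiable[OF T(2) x] .
  note D = linear_dd[OF open_S x l(1) d] linear_dd[OF open_S x l(2) d] linear_dd_right[OF d]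
  note \<Gamma> = christoffel_linear[OF x]
  show "linear (nabla_form2 G T x u v)"
    unfolding nabla_form2_eq[abs_def]
    using D(1)[of v u] l[OF x] linear_comp[OF \<Gamma>(1) l(1)[OF x]]
    by (intro linear_compose_sub) auto
  show "linear (\<lambda>v. nabla_form2 G T x u v w)"
    unfolding nabla_form2_eq[abs_def]
    using D(2)[of w u] l[OF x] linear_comp[OF \<Gamma>(1) l(2)[OF x]]
    by (intro linear_compose_sub) auto
  show "linear (\<lambda>u. nabla_form2 G T x u v w)"
    unfolding nabla_form2_eq[abs_def]
    using D(3)[of v w] linear_comp[OF \<Gamma>(2) l(1)[OF x]] linear_comp[OF \<Gamma>(2) l(2)[OF x]]
    by (intro linear_compose_sub) auto
qed

lemmas nabla_Ric_linear = nabla_form2_linear[OF _ bilinear_Ric smooth_Ric]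

lemma dRic_linear:
  assumes "x \<in> S"
  shows "linear (dRic G x u v)" "linear (\<lambda>v. dRic G x u v w)" "linear (\<lambda>u. dRic G x u v w)"
  unfolding dRic_def[abs_def]
  using nabla_Ric_linear[OF assms] by (auto intro!: linear_compose_sub)

lemma smooth_dRic: "smooth_on S (\<lambda>x. dRic G x u v w)"
  unfolding dRic_def by (intro smooth_on_diff smooth_nabla_form2 bilinear_Ric smooth_Ric)

lemma G_dRic_F: "x \<in> S \<Longrightarrow> G x (dRic_F G x u v) w = dRic G x u v w"
  unfolding dRic_F_def by (rule inner_form.sharp_works[OF form dRic_linear(1)])

lemma bilinear_dRic_F:
  assumes x: "x \<in> S"
  shows "bilinear (dRic_F G x)"
  unfolding dRic_F_def
  by (rule bilinearI; rule inner_form.sharp_linear[OF form[OF x]]; rule dRic_linear[OF x])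

lemma smooth_dRic_F: "smooth_on S (\<lambda>x. dRic_F G x u v)"
  unfolding dRic_F_def by (rule smooth_on_sharp[OF open_S form smooth_G dRic_linear(1) smooth_dRic])

lemma bilinear_Rm:
  assumes x: "x \<in> S"
  shows "bilinear (Rm G x w)"
  using Rm_op_linear(2,3)[OF x] unfolding bilinear_def by (simp add: Rm_eq[OF x] Rm_eq[OF x, abs_def])

lemma Rm_linear:
  assumes x: "x \<in> S"
  shows "linear (\<lambda>w. Rm G x w u v)"
  using Rm_op_linear(1)[OF x] by (simp add: Rm_eq[OF x])

lemma smooth_Rm: "smooth_on S (\<lambda>x. Rm G x w u v)"
  by (subst smooth_on_cong[OF Rm_eq], assumption) (rule smooth_Rm_op)

lemma smooth_F_inner:
  assumes P: "\<And>x. x \<in> S \<Longrightarrow> bilinear (P x)" "\<And>u v. smooth_on S (\<lambda>x. P x u v)"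
    and Q: "\<And>x. x \<in> S \<Longrightarrow> bilinear (Q x)" "\<And>u v. smooth_on S (\<lambda>x. Q x u v)"
  shows "smooth_on S (\<lambda>x. F_inner (G x) (P x) (Q x))"
proof (subst smooth_on_cong)
  show "F_inner (G x) (P x) (Q x) = 1 / 2 * (\<Sum>a\<in>UNIV. \<Sum>c\<in>UNIV.
      G x (P x (dual a x) (dual c x)) (Q x (axis a 1) (axis c 1)))" if "x \<in> S" for x
    using inner_form.F_inner_coords[OF form[OF that] P(1)[OF that] Q(1)[OF that]]
    unfolding dual_axis_eq[OF that] .
  have "smooth_on S (\<lambda>x. G x (P x (dual a x) (dual c x)) (Q x (axis a 1) (axis c 1)))" for a c
    by (rule smooth_on_G_apply[where X = "\<lambda>x. P x (dual a x) (dual c x)"])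
      (auto intro: smooth_on_bilinear_apply[where X = "dual a", OF P smooth_dual smooth_dual] Q)
  then show "smooth_on S (\<lambda>x. 1 / 2 * (\<Sum>a\<in>UNIV. \<Sum>c\<in>UNIV.
      G x (P x (dual a x) (dual c x)) (Q x (axis a 1) (axis c 1))))"
    by (intro smooth_on_mult smooth_on_const smooth_on_sum open_S)
qed

section \<open>The Ricci identity and its consequence for solitons\<close>

lemma nabla_oneform_eq:
  "nabla_oneform G a x u v = dd (\<lambda>y. a y v) x u - a x (christoffel G x u v)"
  by (simp add: nabla_oneform_def nabla_const)

text \<open>Second derivatives of a commute and the terms with \<open>christoffel G x u v\<close>
  are symmetric, so the antisymmetrisation leaves a applied to derivatives and quadratic terms of
  the Christoffel symbols, that is to the curvature. The sign is plus because \<open>Rm_op\<close>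
  is \<open>\<nabla>\<^sub>v\<nabla>\<^sub>u - \<nabla>\<^sub>u\<nabla>\<^sub>v\<close> on constant
  fields.\<close>

lemma Ricci_identity:
  assumes x: "x \<in> S" and a: "\<And>y. y \<in> S \<Longrightarrow> linear (a y)" "\<And>v. smooth_on S (\<lambda>y. a y v)"
  shows "nabla_form2 G (nabla_oneform G a) x u v w - nabla_form2 G (nabla_oneform G a) x v u w
    = a x (Rm_op G x u v w)"
proof -
  let ?C = "christoffel G"
  have da: "(\<lambda>y. a y v) differentiable (at x)" for v
    using smooth_on_differentiable[OF a(2) x] .
  have D: "dd (\<lambda>y. nabla_oneform G a y v w) x u =
      dd (\<lambda>y. dd (\<lambda>y. a y w) y v) x u - (dd (\<lambda>y. a y (?C x v w)) x u + a x (dd (\<lambda>y. ?C y v w) x u))"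
    for u v
  proof -
    have 1: "((\<lambda>y. a y (?C y v w)) has_derivative
        (\<lambda>h. dd (\<lambda>y. a y (?C x v w)) x h + a x (dd (\<lambda>y. ?C y v w) x h))) (at x)"
      using has_derivative_linear_apply[OF open_S x a(1) da, of "\<lambda>y. ?C y v w"]
        smooth_on_has_derivative[OF smooth_christoffel x] by blast
    have 2: "((\<lambda>y. dd (\<lambda>y. a y w) y v) has_derivative dd (\<lambda>y. dd (\<lambda>y. a y w) y v) x) (at x)"
      by (rule smooth_on_has_derivative[OF smooth_on_dd[OF a(2)] x])
    show ?thesis
      unfolding nabla_oneform_eq by (rule has_derivative_imp_dd[OF has_derivative_diff[OF 2 1]])
  qed
  have "dd (\<lambda>y. dd (\<lambda>y. a y w) y v) x u = dd (\<lambda>y. dd (\<lambda>y. a y w) y u) x v"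
    by (rule dd_dd_commute_real[OF a(2) x])
  then show ?thesis
    unfolding nabla_form2_eq D unfolding nabla_oneform_eq Rm_op_eq[OF x] nabla_nabla_def christoffel_sym[OF x, of v u]
    by (simp add: linear_diff[OF a(1)[OF x]] linear_add[OF a(1)[OF x]])
qed

lemma nabla_form2_G: "x \<in> S \<Longrightarrow> nabla_form2 G G x u v w = 0"
  by (simp add: nabla_form2_eq metric_compatible)

text \<open>The soliton equation is differentiated, which is why it is required on all of S and not
  just at x. The metric term drops out by \<nabla>g = 0, and the Ricci identity evaluates what is
  left.\<close>

lemma dRic_soliton:
  assumes x: "x \<in> S" and a: "\<And>y. y \<in> S \<Longrightarrow> linear (a y)" "\<And>v. smooth_on S (\<lambda>y. a y v)"
    and sol: "\<And>y u v. y \<in> S \<Longrightarrow> Ric G y u v + nabla_oneform G a y u v = \<mu> * G y u v"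
  shows "dRic G x u v w = - a x (Rm_op G x u v w)"
proof -
  have "nabla_form2 G (Ric G) x u v w = - nabla_form2 G (nabla_oneform G a) x u v w" for u v w
  proof -
    have R: "Ric G y u v = \<mu> * G y u v - nabla_oneform G a y u v" if "y \<in> S" for y u v
      using sol[OF that, of u v] by linarith
    have "smooth_on S (\<lambda>y. nabla_oneform G a y v w)"
      unfolding nabla_oneform_eq
      by (intro smooth_on_diff smooth_on_dd a smooth_on_linear_apply[where L = a] smooth_christoffel)
    then have N: "((\<lambda>y. nabla_oneform G a y v w) has_derivative dd (\<lambda>y. nabla_oneform G a y v w) x) (at x)"
      using x by (rule smooth_on_has_derivative)
    have g: "((\<lambda>y. G y v w) has_derivative dd (\<lambda>y. G y v w) x) (at x)"
      by (rule smooth_on_has_derivative[OF smooth_G x])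
    have "dd (\<lambda>y. Ric G y v w) x u = dd (\<lambda>y. \<mu> * G y v w - nabla_oneform G a y v w) x u"
      by (rule fun_cong[OF frechet_derivative_cong_open[OF open_S x R]])
    also have "\<dots> = \<mu> * dd (\<lambda>y. G y v w) x u - dd (\<lambda>y. nabla_oneform G a y v w) x u"
      by (rule has_derivative_imp_dd[OF has_derivative_diff[OF has_derivative_mult_right[OF g] N]])
    finally have "nabla_form2 G (Ric G) x u v w
        = \<mu> * nabla_form2 G G x u v w - nabla_form2 G (nabla_oneform G a) x u v w"
      unfolding nabla_form2_eq R[OF x] by (simp add: algebra_simps)
    then show ?thesis by (simp add: nabla_form2_G[OF x])
  qed
  then show ?thesis
    using Ricci_identity[OF x a, of u v w] by (simp add: dRic_def)
qed

text \<open>Antisymmetry of the curvature in its last two slots moves the vector dual to a from the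
  last slot to the third and absorbs the minus sign of \<open>dRic_soliton\<close>.\<close>

lemma dRic_F_soliton:
  assumes x: "x \<in> S" and a: "\<And>y. y \<in> S \<Longrightarrow> linear (a y)" "\<And>v. smooth_on S (\<lambda>y. a y v)"
    and sol: "\<And>y u v. y \<in> S \<Longrightarrow> Ric G y u v + nabla_oneform G a y u v = \<mu> * G y u v"
  shows "dRic_F G x = Rm G x (sharp (G x) (a x))"
proof (intro ext)
  fix u v
  interpret inner_form "G x" by (rule form[OF x])
  let ?X = "sharp (G x) (a x)"
  have X: "G x ?X w = a x w" for w by (rule sharp_works[OF a(1)[OF x]])
  show "dRic_F G x u v = Rm G x ?X u v"
  proof (rule nondegenerate)
    fix w
    have "G x (dRic_F G x u v) w = - G x ?X (Rm_op G x u v w)"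
      unfolding G_dRic_F[OF x] X by (rule dRic_soliton[OF x a sol])
    also have "\<dots> = - Rm4 G x u v w ?X"
      unfolding Rm4_def by (simp add: sym)
    also have "\<dots> = Rm4 G x u v ?X w"
      using Rm4_antisym_last[OF x, of u v w ?X] by simp
    finally show "G x (dRic_F G x u v) w = G x (Rm G x ?X u v) w"
      by (simp add: Rm_eq[OF x] Rm4_def)
  qed
qed

end

section \<open>The vector field K in a chart\<close>

locale curved_chart = chart_metric S G
  for S :: "(real ^ 'n::finite) set" and G :: "'n metric" +
  assumes inj_Rm: "x \<in> S \<Longrightarrow> inj (Rm G x)"
begin

text \<open>The bilinear form of the endomorphism \<open>check\<close>, which is the pull-back of
  the metric of F under \<open>Rm\<close>. Injectivity of \<open>Rm\<close> makes it an inner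
  product, so everything proved for \<open>inner_form\<close>, including smoothness of
  \<open>sharp\<close>, applies to it.\<close>

definition Rm_form :: "real ^ 'n \<Rightarrow> 'n bilin" where
  "Rm_form x v w = F_inner (G x) (Rm G x v) (Rm G x w)"

lemma inner_form_Rm_form:
  assumes x: "x \<in> S"
  shows "inner_form (Rm_form x)"
proof -
  interpret inner_form "G x" by (rule form[OF x])
  have sym: "Rm_form x u v = Rm_form x v u" for u v
    unfolding Rm_form_def by (rule F_inner_commute)
  have lin: "linear (Rm_form x u)" for u
    unfolding Rm_form_def[abs_def] by (rule F_inner_linear[OF Rm_linear[OF x]])
  show ?thesis
  proof
    show "bilinear (Rm_form x)"
      using lin sym by (metis bilinearI ext)
    fix v :: "real ^ 'n" assume "v \<noteq> 0"
    show "Rm_form x v v > 0"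
    proof (rule ccontr)
      assume "\<not> Rm_form x v v > 0"
      then have "Rm G x v u w = 0" for u w
        unfolding Rm_form_def by (intro F_inner_pos bilinear_Rm x) simp
      moreover have "Rm G x 0 u w = 0" for u w using linear_0[OF Rm_linear[OF x]] .
      ultimately have "Rm G x v = Rm G x 0" by (intro ext) simp
      then show False using inj_Rm[OF x] \<open>v \<noteq> 0\<close> by (metis injD)
    qed
  qed (rule sym)
qed

lemma smooth_Rm_form: "smooth_on S (\<lambda>x. Rm_form x v w)"
  unfolding Rm_form_def by (rule smooth_F_inner[OF bilinear_Rm smooth_Rm bilinear_Rm smooth_Rm])

text \<open>Substituting \<open>C w\<close> for the argument cancels the inverse in
  \<open>D_field\<close>, and \<open>C w\<close> paired with K is \<open>Rm_form\<close> of w and K.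
  The result no longer mentions the inverse.\<close>

lemma K_field_char:
  assumes x: "x \<in> S"
  shows "Rm_form x (K_field G x) w = F_inner (G x) (dRic_F G x) (Rm G x w)"
proof -
  interpret inner_form "G x" by (rule form[OF x])
  interpret B: inner_form "Rm_form x" by (rule inner_form_Rm_form[OF x])
  define C where "C = check (G x) (Rm G x)"
  have C: "G x (C v) u = Rm_form x v u" for u v
    unfolding C_def check_def vee_def Rm_form_def[symmetric] by (rule sharp_works[OF B.linear_right])
  have linC: "linear C"
    unfolding C_def check_def[abs_def] vee_def Rm_form_def[symmetric]
    by (rule sharp_linear[OF B.linear_right B.linear_left])
  \<comment> \<open>\<open>inv C\<close> is a genuine inverse only if C is bijective: injectivity
    comes from nondegeneracy of \<open>Rm_form\<close>, surjectivity from the dimension.\<close>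
  have "C v = 0 \<Longrightarrow> v = 0" for v
    using C[of v] by (intro B.nondegenerate) (metis bilinear_lzero bilin B.bilin)
  then have "inj C" by (simp add: linear_injective_0[OF linC])
  then have "surj C" using linC linear_injective_imp_surjective by blast
  have CC: "inv C (C v) = v" "C (inv C v) = v" for v
    using \<open>inj C\<close> \<open>surj C\<close> by (simp_all add: surj_f_inv_f)
  have "linear (inv C)"
    by (rule linearI) (metis CC linear_add[OF linC], metis CC linear_cmul[OF linC])
  moreover have "linear (\<lambda>w. F_inner (G x) (dRic_F G x) (Rm G x w))"
    by (rule F_inner_linear[OF Rm_linear[OF x]])
  ultimately have "linear (\<lambda>v. F_inner (G x) (dRic_F G x) (D_field G x v))"
    unfolding D_field_def C_def[symmetric] comp_def by (rule linear_comp)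
  then have "G x (K_field G x) v = F_inner (G x) (dRic_F G x) (D_field G x v)" for v
    unfolding K_field_def by (rule sharp_works)
  from this[of "C w"] have "G x (C w) (K_field G x) = F_inner (G x) (dRic_F G x) (Rm G x w)"
    unfolding D_field_def C_def[symmetric] comp_def CC by (simp add: sym)
  then show ?thesis by (simp add: C B.sym)
qed

text \<open>As a Riesz representative for the smooth inner product \<open>Rm_form\<close>, K is
  smooth by Cramer's rule, without differentiating an inverse operator.\<close>

lemma K_field_sharp:
  assumes "x \<in> S"
  shows "K_field G x = sharp (Rm_form x) (\<lambda>w. F_inner (G x) (dRic_F G x) (Rm G x w))"
  using inner_form.sharp_eqI[OF inner_form_Rm_form[OF assms] K_field_char[OF assms]] by simp

lemma smooth_K_field: "smooth_on S (K_field G)"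
  by (subst smooth_on_cong[OF K_field_sharp], assumption)
    (rule smooth_on_sharp[OF open_S inner_form_Rm_form smooth_Rm_form
        inner_form.F_inner_linear[OF form Rm_linear]
        smooth_F_inner[OF bilinear_dRic_F smooth_dRic_F bilinear_Rm smooth_Rm]])

lemma K_field_soliton:
  assumes x: "x \<in> S" and a: "\<And>y. y \<in> S \<Longrightarrow> linear (a y)" "\<And>v. smooth_on S (\<lambda>y. a y v)"
    and sol: "\<And>y u v. y \<in> S \<Longrightarrow> Ric G y u v + nabla_oneform G a y u v = \<mu> * G y u v"
  shows "flat (G x) (K_field G x) = a x"
proof -
  have eq: "dRic_F G x = Rm G x (sharp (G x) (a x))"
    by (rule dRic_F_soliton[OF x a sol])
  have "K_field G x = sharp (G x) (a x)"
  proof (rule inner_form.nondegenerate[OF inner_form_Rm_form[OF x]])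
    show "Rm_form x (K_field G x) w = Rm_form x (sharp (G x) (a x)) w" for w
      unfolding K_field_char[OF x] eq by (rule Rm_form_def[symmetric])
  qed
  then show ?thesis
    using inner_form.sharp_works[OF form[OF x] a(1)[OF x]] by (auto simp: flat_def)
qed

lemma nabla_oneform_cong:
  assumes "x \<in> S" "\<And>y. y \<in> S \<Longrightarrow> a y = b y"
  shows "nabla_oneform G a x u v = nabla_oneform G b x u v"
  unfolding nabla_oneform_eq
  using fun_cong[OF frechet_derivative_cong_open[OF open_S assms(1)], of "\<lambda>y. a y v" "\<lambda>y. b y v" u]
    assms by simp

lemma nabla_K_eq_Hess:
  assumes x: "x \<in> S" and h: "smooth_on S h"
    and sol: "\<And>y u v. y \<in> S \<Longrightarrow> Ric G y u v + Hess G h y u v = \<mu> * G y u v"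
  shows "nabla_K G x u v = Hess G h x u v"
proof -
  have "flat (G y) (K_field G y) = dd h y" if "y \<in> S" for y
    using sol unfolding Hess_def
    by (intro K_field_soliton[OF that, of "dd h"] smooth_on_dd h
        linear_dd_right smooth_on_differentiable[OF h]) auto
  then show ?thesis
    unfolding nabla_K_def Hess_def by (rule nabla_oneform_cong[OF x])
qed

lemma flat_K_linear: "x \<in> S \<Longrightarrow> linear (flat (G x) (K_field G x))"
  unfolding flat_def by (rule G_linear(1))

lemma smooth_flat_K: "smooth_on S (\<lambda>x. flat (G x) (K_field G x) v)"
  unfolding flat_def by (rule smooth_on_G_apply[OF _ smooth_K_field smooth_on_const[OF open_S]])

text \<open>Because \<open>christoffel\<close> is symmetric, the antisymmetric part of
  \<open>nabla_K\<close> contains derivatives only and is the exterior derivative of the dual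
  form.\<close>

lemma flat_K_closed:
  assumes x: "x \<in> S" and sol: "\<And>u v. 0 = Ric G x u v + nabla_K G x u v - \<mu> * G x u v"
  shows "dd (\<lambda>y. flat (G y) (K_field G y) u) x v = dd (\<lambda>y. flat (G y) (K_field G y) v) x u"
  using sol[of u v] sol[of v u] Ric_sym[OF x, of u v] G_sym[OF x, of u v] christoffel_sym[OF x, of u v]
  unfolding nabla_K_def nabla_oneform_eq by simp

end

section \<open>Naturality under isometric changes of coordinates\<close>

text \<open>In the application W is the overlap seen in the first chart and \<open>\<phi>\<close>
  the transition map. All data are compared through \<open>J\<close>, whose invertibility is derived
  from the isometry.\<close>

locale isometric_charts = A: chart_metric S1 G1 + B: chart_metric S2 G2
  for S1 :: "(real ^ 'n::finite) set" and G1 :: "'n metric"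
    and S2 :: "(real ^ 'n) set" and G2 :: "'n metric" +
  fixes W :: "(real ^ 'n) set" and \<phi> :: "real ^ 'n \<Rightarrow> real ^ 'n"
  assumes W_S1: "W \<subseteq> S1" and \<phi>_S2: "\<phi> ` W \<subseteq> S2"
    and smooth_\<phi>: "smooth_on W \<phi>"
    and isometry: "x \<in> W \<Longrightarrow> G1 x u v = G2 (\<phi> x) (dd \<phi> x u) (dd \<phi> x v)"
begin

abbreviation J :: "real ^ 'n \<Rightarrow> real ^ 'n \<Rightarrow> real ^ 'n" where "J \<equiv> dd \<phi>"

text \<open>The second derivative of \<open>\<phi>\<close>: the inhomogeneous term in the
  transformation law of the Christoffel symbols.\<close>

definition H :: "real ^ 'n \<Rightarrow> real ^ 'n \<Rightarrow> real ^ 'n \<Rightarrow> real ^ 'n" where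
  "H x u v = dd (\<lambda>y. J y v) x u"

lemma open_W: "open W" using smooth_on_open[OF smooth_\<phi>] .

lemma in_S1: "x \<in> W \<Longrightarrow> x \<in> S1" and in_S2: "x \<in> W \<Longrightarrow> \<phi> x \<in> S2"
  using W_S1 \<phi>_S2 by auto

lemma \<phi>_has_derivative: "x \<in> W \<Longrightarrow> (\<phi> has_derivative J x) (at x)"
  by (rule smooth_on_has_derivative[OF smooth_\<phi>])

lemma linear_J: "x \<in> W \<Longrightarrow> linear (J x)"
  using has_derivative_linear[OF \<phi>_has_derivative] .

lemma J_has_derivative: "x \<in> W \<Longrightarrow> ((\<lambda>y. J y v) has_derivative (\<lambda>u. H x u v)) (at x)"
  using smooth_on_has_derivative[OF smooth_on_dd[OF smooth_\<phi>, of v], of x] by (simp add: H_def)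

lemma H_sym: "x \<in> W \<Longrightarrow> H x u v = H x v u"
  unfolding H_def by (rule dd_dd_commute[OF smooth_\<phi>])

text \<open>An isometry of definite forms has trivial kernel, and the dimensions agree.\<close>

lemma surj_J:
  assumes x: "x \<in> W"
  shows "surj (J x)"
proof -
  have "v = 0" if "J x v = 0" for v
  proof -
    have "G1 x v v = 0"
      using isometry[OF x, of v v] that linear_0[OF B.G_linear(1)[OF in_S2[OF x]]] by simp
    then show ?thesis using inner_form.pos[OF A.form[OF in_S1[OF x]], of v] by force
  qed
  then have "inj (J x)" by (simp add: linear_injective_0[OF linear_J[OF x]])
  then show ?thesis using linear_J[OF x] linear_injective_imp_surjective by blast
qed

lemma nondegenerate_J:
  assumes x: "x \<in> W" and b: "inner_form b" and eq: "\<And>w. b u (J x w) = b v (J x w)"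
  shows "u = v"
proof (rule inner_form.nondegenerate[OF b])
  show "b u w = b v w" for w
    using surj_J[OF x] eq by (metis surjD)
qed

text \<open>Chain and product rule for a pulled-back tensor: the base point moves along
  \<open>J x u\<close>, the arguments move by H. Vector values of T are allowed since the rule is
  also applied to the Christoffel symbols.\<close>

lemma pullback_has_derivative:
  fixes T :: "real ^ 'n \<Rightarrow> real ^ 'n \<Rightarrow> real ^ 'n \<Rightarrow> 'b::real_normed_vector"
  assumes x: "x \<in> W" and T: "\<And>y. y \<in> S2 \<Longrightarrow> bilinear (T y)" "\<And>u v. smooth_on S2 (\<lambda>y. T y u v)"
  shows "((\<lambda>y. T (\<phi> y) (J y v) (J y w)) has_derivative
    (\<lambda>u. dd (\<lambda>z. T z (J x v) (J x w)) (\<phi> x) (J x u) + T (\<phi> x) (H x u v) (J x w)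
      + T (\<phi> x) (J x v) (H x u w))) (at x)"
proof -
  have c: "((\<lambda>y. T (\<phi> y) a b) has_derivative (\<lambda>h. dd (\<lambda>z. T z a b) (\<phi> x) (J x h))) (at x)" for a b
    by (rule has_derivative_compose[OF \<phi>_has_derivative[OF x] smooth_on_has_derivative[OF T(2) in_S2[OF x]]])
  show ?thesis
    using has_derivative_bilinear_apply[OF open_W x, of "\<lambda>y. T (\<phi> y)", OF T(1)[OF in_S2] differentiableI[OF c]
        J_has_derivative[OF x] J_has_derivative[OF x], of v w]
    unfolding has_derivative_imp_dd[OF c] .
qed

lemmas dd_pullback = has_derivative_imp_dd[OF pullback_has_derivative]

lemma dd_G1:
  assumes x: "x \<in> W"
  shows "dd (\<lambda>y. G1 y v w) x u = dd (\<lambda>z. G2 z (J x v) (J x w)) (\<phi> x) (J x u)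
    + G2 (\<phi> x) (H x u v) (J x w) + G2 (\<phi> x) (J x v) (H x u w)"
proof -
  have "dd (\<lambda>y. G1 y v w) x u = dd (\<lambda>y. G2 (\<phi> y) (J y v) (J y w)) x u"
    by (rule fun_cong[OF frechet_derivative_cong_open[OF open_W x isometry]])
  also have "\<dots> = dd (\<lambda>z. G2 z (J x v) (J x w)) (\<phi> x) (J x u)
    + G2 (\<phi> x) (H x u v) (J x w) + G2 (\<phi> x) (J x v) (H x u w)"
    by (rule dd_pullback[OF x B.bilinear_G B.smooth_G])
  finally show ?thesis .
qed

text \<open>In the Koszul formula \<open>dd_G1\<close> contributes six terms with H; by symmetry of
  H four cancel and the other two add up to the stated correction.\<close>

lemma J_christoffel:
  assumes x: "x \<in> W"
  shows "J x (christoffel G1 x u v) = H x u v + christoffel G2 (\<phi> x) (J x u) (J x v)"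
proof (rule nondegenerate_J[OF x B.form[OF in_S2[OF x]]])
  fix w
  note sym = B.G_sym[OF in_S2[OF x]]
  have "G2 (\<phi> x) (J x (christoffel G1 x u v)) (J x w) = A.koszul x u v w"
    by (simp add: A.G_christoffel[OF in_S1[OF x]] flip: isometry[OF x])
  also have "\<dots> = B.koszul (\<phi> x) (J x u) (J x v) (J x w) + G2 (\<phi> x) (H x u v) (J x w)"
    unfolding A.koszul_def B.koszul_def dd_G1[OF x]
    using H_sym[OF x, of v u] H_sym[OF x, of w u] H_sym[OF x, of w v]
      sym[of "J x v" "H x u w"] sym[of "J x u" "H x v w"]
    by (simp add: field_simps)
  finally show "G2 (\<phi> x) (J x (christoffel G1 x u v)) (J x w)
      = G2 (\<phi> x) (H x u v + christoffel G2 (\<phi> x) (J x u) (J x v)) (J x w)"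
    by (simp add: linear_add[OF B.G_linear(2)[OF in_S2[OF x]]] B.G_christoffel[OF in_S2[OF x]])
qed

text \<open>The H terms from differentiating the pull-back cancel those from
  \<open>J_christoffel\<close>, so the covariant derivative of a tensor is again a tensor.\<close>

lemma nabla_form2_natural:
  assumes x: "x \<in> W" and T2: "\<And>y. y \<in> S2 \<Longrightarrow> bilinear (T2 y)" "\<And>u v. smooth_on S2 (\<lambda>y. T2 y u v)"
    and T1: "\<And>y u v. y \<in> W \<Longrightarrow> T1 y u v = T2 (\<phi> y) (J y u) (J y v)"
  shows "nabla_form2 G1 T1 x u v w = nabla_form2 G2 T2 (\<phi> x) (J x u) (J x v) (J x w)"
proof -
  have "dd (\<lambda>y. T1 y v w) x u = dd (\<lambda>y. T2 (\<phi> y) (J y v) (J y w)) x u"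
    by (rule fun_cong[OF frechet_derivative_cong_open[OF open_W x T1]])
  also have "\<dots> = dd (\<lambda>z. T2 z (J x v) (J x w)) (\<phi> x) (J x u)
    + T2 (\<phi> x) (H x u v) (J x w) + T2 (\<phi> x) (J x v) (H x u w)"
    by (rule dd_pullback[OF x T2])
  finally show ?thesis
    unfolding A.nabla_form2_eq B.nabla_form2_eq T1[OF x] J_christoffel[OF x]
    by (simp add: bilinear_ladd[OF T2(1)[OF in_S2[OF x]]] bilinear_radd[OF T2(1)[OF in_S2[OF x]]])
qed

text \<open>Obtained by differentiating \<open>J_christoffel\<close>. The four correction terms are
  symmetric in u and v as a whole, so they vanish in the curvature.\<close>

lemma J_nabla_nabla:
  assumes x: "x \<in> W"
  shows "J x (A.nabla_nabla x u v w) = B.nabla_nabla (\<phi> x) (J x u) (J x v) (J x w)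
    + dd (\<lambda>y. H y v w) x u + christoffel G2 (\<phi> x) (H x u v) (J x w)
    + christoffel G2 (\<phi> x) (J x v) (H x u w) + christoffel G2 (\<phi> x) (J x u) (H x v w)"
proof -
  let ?C1 = "christoffel G1" and ?C2 = "christoffel G2"
  have L: "((\<lambda>y. J y (?C1 y v w)) has_derivative
      (\<lambda>h. dd (\<lambda>y. J y (?C1 x v w)) x h + J x (dd (\<lambda>y. ?C1 y v w) x h))) (at x)"
    by (rule has_derivative_linear_apply[OF open_W x linear_J
          smooth_on_differentiable[OF smooth_on_dd[OF smooth_\<phi>] x]
          smooth_on_has_derivative[OF A.smooth_christoffel in_S1[OF x]]])
  have "smooth_on W (\<lambda>y. H y v w)"
    unfolding H_def by (intro smooth_on_dd smooth_\<phi>)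
  from has_derivative_add[OF smooth_on_has_derivative[OF this x]
      pullback_has_derivative[OF x B.bilinear_christoffel B.smooth_christoffel, of v w]]
  have "dd (\<lambda>y. H y v w + ?C2 (\<phi> y) (J y v) (J y w)) x u = dd (\<lambda>y. H y v w) x u
      + (dd (\<lambda>z. ?C2 z (J x v) (J x w)) (\<phi> x) (J x u) + ?C2 (\<phi> x) (H x u v) (J x w)
      + ?C2 (\<phi> x) (J x v) (H x u w))"
    by (rule has_derivative_imp_dd)
  moreover have "dd (\<lambda>y. J y (?C1 y v w)) x u = dd (\<lambda>y. H y v w + ?C2 (\<phi> y) (J y v) (J y w)) x u"
    by (rule fun_cong[OF frechet_derivative_cong_open[OF open_W x J_christoffel]])
  ultimately have "H x u (?C1 x v w) + J x (dd (\<lambda>y. ?C1 y v w) x u) = dd (\<lambda>y. H y v w) x u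
      + (dd (\<lambda>z. ?C2 z (J x v) (J x w)) (\<phi> x) (J x u) + ?C2 (\<phi> x) (H x u v) (J x w)
      + ?C2 (\<phi> x) (J x v) (H x u w))"
    unfolding has_derivative_imp_dd[OF L] by (simp add: H_def)
  then show ?thesis
    unfolding A.nabla_nabla_def B.nabla_nabla_def
    by (simp add: linear_add[OF linear_J[OF x]] J_christoffel[OF x]
        linear_add[OF B.christoffel_linear(1)[OF in_S2[OF x]]] algebra_simps)
qed

lemma Rm_op_natural:
  assumes x: "x \<in> W"
  shows "J x (Rm_op G1 x u v w) = Rm_op G2 (\<phi> x) (J x u) (J x v) (J x w)"
proof -
  have "dd (\<lambda>y. H y v w) x u = dd (\<lambda>y. H y u w) x v"
    unfolding H_def by (rule dd_dd_commute[OF smooth_on_dd[OF smooth_\<phi>] x])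
  then show ?thesis
    unfolding A.Rm_op_eq[OF in_S1[OF x]] B.Rm_op_eq[OF in_S2[OF x]]
      linear_diff[OF linear_J[OF x]] J_nabla_nabla[OF x] H_sym[OF x, of v u]
    by simp
qed

lemma Rm_natural:
  assumes x: "x \<in> W"
  shows "J x (Rm G1 x w u v) = Rm G2 (\<phi> x) (J x w) (J x u) (J x v)"
  unfolding A.Rm_eq[OF in_S1[OF x]] B.Rm_eq[OF in_S2[OF x]] by (rule Rm_op_natural[OF x])

lemma orthonormal_frame_J:
  assumes x: "x \<in> W" and e: "orthonormal_frame (G1 x) e"
  shows "orthonormal_frame (G2 (\<phi> x)) (\<lambda>i. J x (e i))"
  using e isometry[OF x] by (simp add: orthonormal_frame_def)

text \<open>The frames chosen by \<open>SOME\<close> at x and at \<open>\<phi> x\<close> are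
  unrelated; \<open>Ric_frame\<close> permits using a frame at x and its image under J.\<close>

lemma Ric_natural:
  assumes x: "x \<in> W"
  shows "Ric G1 x u v = Ric G2 (\<phi> x) (J x u) (J x v)"
proof -
  obtain e where e: "orthonormal_frame (G1 x) e"
    using inner_form.orthonormal_frame_exists[OF A.form[OF in_S1[OF x]]] by blast
  show ?thesis
    unfolding A.Ric_frame[OF in_S1[OF x] e] B.Ric_frame[OF in_S2[OF x] orthonormal_frame_J[OF x e]]
    by (simp add: Rm4_def isometry[OF x] Rm_op_natural[OF x])
qed

lemma dRic_natural:
  assumes x: "x \<in> W"
  shows "dRic G1 x u v w = dRic G2 (\<phi> x) (J x u) (J x v) (J x w)"
proof -
  have "nabla_form2 G1 (Ric G1) x u v w = nabla_form2 G2 (Ric G2) (\<phi> x) (J x u) (J x v) (J x w)" for u v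
    by (rule nabla_form2_natural[OF x B.bilinear_Ric B.smooth_Ric Ric_natural])
  then show ?thesis by (simp add: dRic_def)
qed

lemma dRic_F_natural:
  assumes x: "x \<in> W"
  shows "J x (dRic_F G1 x u v) = dRic_F G2 (\<phi> x) (J x u) (J x v)"
proof (rule nondegenerate_J[OF x B.form[OF in_S2[OF x]]])
  show "G2 (\<phi> x) (J x (dRic_F G1 x u v)) (J x w) = G2 (\<phi> x) (dRic_F G2 (\<phi> x) (J x u) (J x v)) (J x w)" for w
    using dRic_natural[OF x, of u v w]
    by (simp add: A.G_dRic_F[OF in_S1[OF x]] B.G_dRic_F[OF in_S2[OF x]] flip: isometry[OF x])
qed

lemma F_inner_natural:
  assumes x: "x \<in> W" and P: "bilinear P1" "bilinear P2" "\<And>u v. J x (P1 u v) = P2 (J x u) (J x v)"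
    and Q: "bilinear Q1" "bilinear Q2" "\<And>u v. J x (Q1 u v) = Q2 (J x u) (J x v)"
  shows "F_inner (G1 x) P1 Q1 = F_inner (G2 (\<phi> x)) P2 Q2"
proof -
  obtain e where e: "orthonormal_frame (G1 x) e"
    using inner_form.orthonormal_frame_exists[OF A.form[OF in_S1[OF x]]] by blast
  show ?thesis
    unfolding inner_form.F_inner_frame[OF A.form[OF in_S1[OF x]] e P(1) Q(1)]
      inner_form.F_inner_frame[OF B.form[OF in_S2[OF x]] orthonormal_frame_J[OF x e] P(2) Q(2)]
    by (simp add: isometry[OF x] P Q)
qed

text \<open>Everything in \<open>K_field_char\<close> is natural, and that identity determines K, so
  the inverse of \<open>check\<close> is never transported.\<close>

lemma flat_K_natural:
  assumes x: "x \<in> W" and A: "curved_chart S1 G1" and B: "curved_chart S2 G2"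
  shows "flat (G1 x) (K_field G1 x) v = flat (G2 (\<phi> x)) (K_field G2 (\<phi> x)) (J x v)"
proof -
  interpret A': curved_chart S1 G1 by (rule A)
  interpret B': curved_chart S2 G2 by (rule B)
  note x1 = in_S1[OF x] and x2 = in_S2[OF x]
  have "J x (K_field G1 x) = K_field G2 (\<phi> x)"
  proof (rule nondegenerate_J[OF x B'.inner_form_Rm_form[OF x2]])
    fix w
    have "B'.Rm_form (\<phi> x) (J x (K_field G1 x)) (J x w) = A'.Rm_form x (K_field G1 x) w"
      unfolding A'.Rm_form_def B'.Rm_form_def
      by (rule F_inner_natural[OF x A.bilinear_Rm[OF x1] B.bilinear_Rm[OF x2] Rm_natural[OF x]
            A.bilinear_Rm[OF x1] B.bilinear_Rm[OF x2] Rm_natural[OF x], symmetric])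
    also have "\<dots> = F_inner (G1 x) (dRic_F G1 x) (Rm G1 x w)"
      by (rule A'.K_field_char[OF x1])
    also have "\<dots> = F_inner (G2 (\<phi> x)) (dRic_F G2 (\<phi> x)) (Rm G2 (\<phi> x) (J x w))"
      by (rule F_inner_natural[OF x A.bilinear_dRic_F[OF x1] B.bilinear_dRic_F[OF x2] dRic_F_natural[OF x]
            A.bilinear_Rm[OF x1] B.bilinear_Rm[OF x2] Rm_natural[OF x]])
    also have "\<dots> = B'.Rm_form (\<phi> x) (K_field G2 (\<phi> x)) (J x w)"
      by (rule B'.K_field_char[OF x2, symmetric])
    finally show "B'.Rm_form (\<phi> x) (J x (K_field G1 x)) (J x w)
        = B'.Rm_form (\<phi> x) (K_field G2 (\<phi> x)) (J x w)" .
  qed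
  then show ?thesis by (simp add: flat_def isometry[OF x])
qed

end

section \<open>Potentials on a simply connected manifold\<close>

locale curved_manifold =
  fixes M :: "'a::{t2_space, second_countable_topology} set"
    and A :: "('a, 'n::finite) chart set"
    and g :: "('a, 'n) chart \<Rightarrow> 'n metric"
  assumes riemannian: "riemannian_manifold M A g"
    and inj_Rm: "c \<in> A \<Longrightarrow> x \<in> chart_ran c \<Longrightarrow> inj (Rm (g c) x)"
begin

lemma smooth_manifold: "smooth_manifold M A"
  using riemannian by (simp add: riemannian_manifold_def)

lemma M_cover: "M = (\<Union>c\<in>A. chart_dom c)"
  using smooth_manifold by (simp add: smooth_manifold_def)

lemma openin_dom: "c \<in> A \<Longrightarrow> openin (top_of_set M) (chart_dom c)"
  and open_ran: "c \<in> A \<Longrightarrow> open (chart_ran c)"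
  and homeo: "c \<in> A \<Longrightarrow> homeomorphism (chart_dom c) (chart_ran c) (chart_map c) (chart_inv c)"
  using smooth_manifold unfolding smooth_manifold_def by blast+

lemma chart_inv_map: "c \<in> A \<Longrightarrow> p \<in> chart_dom c \<Longrightarrow> chart_inv c (chart_map c p) = p"
  and chart_map_inv: "c \<in> A \<Longrightarrow> x \<in> chart_ran c \<Longrightarrow> chart_map c (chart_inv c x) = x"
  using homeo unfolding homeomorphism_def by blast+

lemma chart_inv_dom: "c \<in> A \<Longrightarrow> x \<in> chart_ran c \<Longrightarrow> chart_inv c x \<in> chart_dom c"
  using homeo unfolding homeomorphism_def by blast

lemma chart_map_ran: "p \<in> chart_dom c \<Longrightarrow> chart_map c p \<in> chart_ran c"
  by (simp add: chart_ran_def)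

lemma curved_chart: "c \<in> A \<Longrightarrow> curved_chart (chart_ran c) (g c)"
  using riemannian inj_Rm open_ran unfolding riemannian_manifold_def
  by unfold_locales auto

lemma isometric_charts:
  assumes "c \<in> A" "c' \<in> A"
  shows "isometric_charts (chart_ran c) (g c) (chart_ran c') (g c')
    (chart_map c ` (chart_dom c \<inter> chart_dom c')) (transition c c')"
proof -
  interpret A: curved_chart "chart_ran c" "g c" using curved_chart assms(1) .
  interpret B: curved_chart "chart_ran c'" "g c'" using curved_chart assms(2) .
  have tr: "transition c c' (chart_map c p) = chart_map c' p" if "p \<in> chart_dom c" for p
    using chart_inv_map[OF assms(1) that] by (simp add: transition_def)
  show ?thesis
  proof
    show "chart_map c ` (chart_dom c \<inter> chart_dom c') \<subseteq> chart_ran c"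
      by (auto simp: chart_ran_def)
    show "transition c c' ` chart_map c ` (chart_dom c \<inter> chart_dom c') \<subseteq> chart_ran c'"
      using tr by (auto simp: chart_ran_def)
    show "smooth_on (chart_map c ` (chart_dom c \<inter> chart_dom c')) (transition c c')"
      using smooth_manifold assms by (simp add: smooth_manifold_def)
    fix x u v assume "x \<in> chart_map c ` (chart_dom c \<inter> chart_dom c')"
    then obtain p where p: "p \<in> chart_dom c \<inter> chart_dom c'" "x = chart_map c p" by blast
    then have "g c x u v = g c' (chart_map c' p) (dd (transition c c') x u) (dd (transition c c') x v)"
      using riemannian assms unfolding riemannian_manifold_def Let_def by blast
    then show "g c x u v = g c' (transition c c' x) (dd (transition c c') x u) (dd (transition c c') x v)"
      using p tr by simp
  qed
qed

lemma openin_chart_inv_image: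
  assumes c: "c \<in> A" and B: "open B" "B \<subseteq> chart_ran c"
  shows "openin (top_of_set M) (chart_inv c ` B)"
proof -
  have "chart_inv c ` B = chart_dom c \<inter> chart_map c -` B"
    using B chart_inv_map[OF c] chart_map_inv[OF c] chart_inv_dom[OF c] by force
  moreover have "openin (top_of_set (chart_dom c)) (chart_dom c \<inter> chart_map c -` B)"
    using homeo[OF c] B(1) unfolding homeomorphism_def by (blast intro: continuous_openin_preimage_gen)
  ultimately show ?thesis using openin_trans openin_dom[OF c] by metis
qed

lemma open_chart_map_image:
  assumes c: "c \<in> A" and V: "openin (top_of_set M) V"
  shows "open (chart_map c ` (V \<inter> chart_dom c))"
proof -
  have "chart_dom c \<subseteq> M" using openin_dom[OF c] by (rule openin_imp_subset)
  then have "openin (top_of_set (chart_dom c)) (V \<inter> chart_dom c)"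
    using V by (metis Int_absorb1 Int_commute openin_subtopology_Int openin_Int openin_subset_trans openin_dom[OF c] inf_le2)
  then have "openin (top_of_set (chart_ran c)) (chart_map c ` (V \<inter> chart_dom c))"
    using homeo[OF c] homeomorphism_imp_open_map by blast
  then show ?thesis using open_ran[OF c] openin_open_eq by blast
qed

definition K_form :: "('a, 'n) chart \<Rightarrow> real ^ 'n \<Rightarrow> real ^ 'n \<Rightarrow> real" where
  "K_form c x = flat (g c x) (K_field (g c) x)"

text \<open>The derivative is tested in all charts of the atlas, which lets two primitives be
  compared in any chart around a point.\<close>

definition K_primitive :: "'a set \<Rightarrow> ('a \<Rightarrow> real) \<Rightarrow> bool" where
  "K_primitive V F \<longleftrightarrow> openin (top_of_set M) V \<and>
     (\<forall>c\<in>A. \<forall>x\<in>chart_map c ` (V \<inter> chart_dom c). ((F \<circ> chart_inv c) has_derivative K_form c x) (at x))"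

text \<open>The Poincare lemma on a coordinate ball gives a primitive in one chart; the chain rule
  and \<open>flat_K_natural\<close> make it a primitive in all others. The ball also supplies path
  connectedness.\<close>

lemma K_primitive_exists:
  assumes closed: "\<And>c x u v. c \<in> A \<Longrightarrow> x \<in> chart_ran c \<Longrightarrow>
      dd (\<lambda>y. K_form c y u) x v = dd (\<lambda>y. K_form c y v) x u"
    and p: "p \<in> M"
  shows "\<exists>V F. K_primitive V F \<and> p \<in> V \<and> path_connected V"
proof -
  obtain c where c: "c \<in> A" "p \<in> chart_dom c" using p M_cover by blast
  interpret C: curved_chart "chart_ran c" "g c" using curved_chart c(1) .
  define x0 where "x0 = chart_map c p"
  obtain r where r: "r > 0" "ball x0 r \<subseteq> chart_ran c"
    using openE[OF open_ran[OF c(1)] chart_map_ran[OF c(2)]] unfolding x0_def by blast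
  have sm: "smooth_on (ball x0 r) (\<lambda>y. K_form c y v)" for v
    unfolding smooth_on_def
  proof (intro conjI allI)
    show "Ck_on k (\<lambda>y. K_form c y v) (ball x0 r)" for k
      using C.smooth_flat_K[of v] r(2) Ck_on_subset unfolding smooth_on_def K_form_def by blast
  qed simp
  have "\<exists>Q. \<forall>x\<in>ball x0 r. (Q has_derivative K_form c x) (at x)"
    by (rule Poincare_lemma[OF open_ball convex_ball centre_in_ball[THEN iffD2, OF r(1)] _ sm])
      (use r closed[OF c(1)] C.flat_K_linear in \<open>auto simp: K_form_def\<close>)
  then obtain Q where Q: "\<And>x. x \<in> ball x0 r \<Longrightarrow> (Q has_derivative K_form c x) (at x)" by blast
  define V where "V = chart_inv c ` ball x0 r"
  have "K_primitive V (Q \<circ> chart_map c)"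
    unfolding K_primitive_def
  proof (intro conjI ballI)
    show "openin (top_of_set M) V"
      unfolding V_def using openin_chart_inv_image[OF c(1) open_ball r(2)] .
    fix c' x assume c': "c' \<in> A" and "x \<in> chart_map c' ` (V \<inter> chart_dom c')"
    then obtain q where q: "q \<in> V" "q \<in> chart_dom c'" "x = chart_map c' q" by blast
    obtain y where y: "y \<in> ball x0 r" "q = chart_inv c y" using q(1) V_def by blast
    have qc: "q \<in> chart_dom c" "chart_map c q = y"
      using y r(2) chart_inv_dom[OF c(1)] chart_map_inv[OF c(1)] by auto
    let ?\<phi> = "transition c' c"
    interpret I: isometric_charts "chart_ran c'" "g c'" "chart_ran c" "g c"
      "chart_map c' ` (chart_dom c' \<inter> chart_dom c)" ?\<phi>
      using isometric_charts[OF c' c(1)] .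
    have x: "x \<in> chart_map c' ` (chart_dom c' \<inter> chart_dom c)" using q qc by blast
    have \<phi>x: "?\<phi> x = y" using chart_inv_map[OF c' q(2)] q(3) qc(2) by (simp add: transition_def)
    have "(Q has_derivative K_form c (?\<phi> x)) (at (?\<phi> x))" using Q[OF y(1)] \<phi>x by simp
    from has_derivative_compose[OF I.\<phi>_has_derivative[OF x] this]
    have "((\<lambda>z. Q (?\<phi> z)) has_derivative (\<lambda>v. K_form c (?\<phi> x) (dd ?\<phi> x v))) (at x)" .
    moreover have "(\<lambda>v. K_form c (?\<phi> x) (dd ?\<phi> x v)) = K_form c' x"
      unfolding K_form_def
      by (rule ext) (rule I.flat_K_natural[OF x curved_chart[OF c'] curved_chart[OF c(1)], symmetric])
    ultimately show "((Q \<circ> chart_map c) \<circ> chart_inv c' has_derivative K_form c' x) (at x)"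
      by (simp add: transition_def o_def)
  qed
  moreover have "p \<in> V"
    unfolding V_def x0_def
    using r(1) by (intro image_eqI[where x = "chart_map c p"]) (simp_all add: chart_inv_map[OF c])
  moreover have "path_connected V"
    unfolding V_def
  proof (rule path_connected_continuous_image)
    show "continuous_on (ball x0 r) (chart_inv c)"
      using homeo[OF c(1)] r(2) unfolding homeomorphism_def by (blast intro: continuous_on_subset)
  qed (simp add: convex_imp_path_connected)
  ultimately show ?thesis by blast
qed

text \<open>On a coordinate ball inside the overlap the difference of the two primitives has zero
  derivative, so it is constant, and it vanishes at p.\<close>

lemma K_primitive_germ:
  assumes F: "K_primitive V F" and F': "K_primitive V' F'"
    and p: "p \<in> V" "p \<in> V'" "F p = F' p"
  shows "\<exists>W. openin (top_of_set M) W \<and> p \<in> W \<and> W \<subseteq> V \<inter> V' \<and> (\<forall>x\<in>W. F x = F' x)"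
proof -
  have V: "openin (top_of_set M) V" "openin (top_of_set M) V'"
    using F F' by (auto simp: K_primitive_def)
  then have "p \<in> M" using p openin_imp_subset by blast
  then obtain c where c: "c \<in> A" "p \<in> chart_dom c" using M_cover by blast
  define U where "U = chart_map c ` ((V \<inter> V') \<inter> chart_dom c)"
  have "open U" unfolding U_def by (intro open_chart_map_image c openin_Int V)
  moreover have "chart_map c p \<in> U" unfolding U_def using p c by blast
  ultimately obtain r where r: "r > 0" "ball (chart_map c p) r \<subseteq> U" by (rule openE)
  let ?B = "ball (chart_map c p) r"
  let ?d = "\<lambda>x. F (chart_inv c x) - F' (chart_inv c x)"
  have p': "chart_inv c (chart_map c p) = p" using chart_inv_map[OF c] .
  have zero: "?d x = 0" if x: "x \<in> ?B" for x
  proof -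
    have "(?d has_derivative (\<lambda>h. 0)) (at y within ?B)" if "y \<in> ?B" for y
    proof -
      have "y \<in> chart_map c ` (V \<inter> chart_dom c)" "y \<in> chart_map c ` (V' \<inter> chart_dom c)"
        using that r(2) unfolding U_def by blast+
      then have "((F \<circ> chart_inv c) has_derivative K_form c y) (at y)"
        "((F' \<circ> chart_inv c) has_derivative K_form c y) (at y)"
        using F F' c(1) unfolding K_primitive_def by blast+
      from has_derivative_diff[OF this] show ?thesis
        by (simp add: o_def has_derivative_at_withinI)
    qed
    from has_derivative_zero_constant[OF convex_ball this]
    have "\<exists>k. \<forall>x\<in>?B. ?d x = k" .
    then have "?d x = ?d (chart_map c p)"
      using x r(1) by (metis centre_in_ball)
    then show ?thesis using p(3) p' by simp
  qed
  have Ur: "U \<subseteq> chart_ran c" unfolding U_def chart_ran_def by blast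
  show ?thesis
  proof (intro exI conjI)
    show "openin (top_of_set M) (chart_inv c ` ?B)"
      using openin_chart_inv_image[OF c(1) open_ball] r(2) Ur by blast
    show "p \<in> chart_inv c ` ?B" using p' r(1) by (metis centre_in_ball image_eqI)
    show "chart_inv c ` ?B \<subseteq> V \<inter> V'"
      using r(2) chart_inv_map[OF c(1)] unfolding U_def by force
    show "\<forall>x\<in>chart_inv c ` ?B. F x = F' x" using zero by force
  qed
qed

lemma potential_exists:
  assumes sc: "simply_connected M"
    and closed: "\<And>c x u v. c \<in> A \<Longrightarrow> x \<in> chart_ran c \<Longrightarrow>
      dd (\<lambda>y. K_form c y u) x v = dd (\<lambda>y. K_form c y v) x u"
  shows "\<exists>f. \<forall>c\<in>A. \<forall>x\<in>chart_ran c. ((f \<circ> chart_inv c) has_derivative K_form c x) (at x)"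
proof -
  interpret local_primitives M K_primitive
  proof
    show "openin (top_of_set M) V" if "K_primitive V F" for V F
      using that by (simp add: K_primitive_def)
    show "K_primitive V (\<lambda>x. F x + k)" if "K_primitive V F" for V F k
      unfolding K_primitive_def
    proof (intro conjI ballI)
      show "openin (top_of_set M) V" using that by (simp add: K_primitive_def)
      fix c x assume "c \<in> A" "x \<in> chart_map c ` (V \<inter> chart_dom c)"
      then have "((F \<circ> chart_inv c) has_derivative K_form c x) (at x)"
        using that unfolding K_primitive_def by blast
      from has_derivative_add[OF this has_derivative_const[of k]]
      show "((\<lambda>x. F x + k) \<circ> chart_inv c has_derivative K_form c x) (at x)"
        by (simp add: o_def)
    qed
    show "\<exists>V F. K_primitive V F \<and> p \<in> V \<and> path_connected V" if "p \<in> M" for p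
      using K_primitive_exists[OF closed that] .
    show "\<exists>W. openin (top_of_set M) W \<and> p \<in> W \<and> W \<subseteq> V \<inter> V' \<and> (\<forall>x\<in>W. F x = F' x)"
      if "K_primitive V F" "K_primitive V' F'" "p \<in> V" "p \<in> V'" "F p = F' p" for V F V' F' p
      using K_primitive_germ[OF that] .
  qed
  obtain f where f: "\<forall>p\<in>M. \<exists>V F. K_primitive V F \<and> p \<in> V \<and> (\<forall>q\<in>V. f q = F q)"
    using global_primitive[OF sc] by blast
  have "((f \<circ> chart_inv c) has_derivative K_form c x) (at x)"
    if c: "c \<in> A" and x: "x \<in> chart_ran c" for c x
  proof -
    let ?p = "chart_inv c x"
    have p: "?p \<in> chart_dom c" using chart_inv_dom[OF c x] .
    then have "?p \<in> M" using c M_cover by blast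
    then obtain V F where V: "K_primitive V F" "?p \<in> V" "\<forall>q\<in>V. f q = F q"
      using f by blast
    have xV: "x \<in> chart_map c ` (V \<inter> chart_dom c)"
      using V(2) p chart_map_inv[OF c x] by force
    have "((F \<circ> chart_inv c) has_derivative K_form c x) (at x)"
      using V(1) c xV unfolding K_primitive_def by blast
    then show ?thesis
    proof (rule has_derivative_transform_within_open)
      show "open (chart_map c ` (V \<inter> chart_dom c))"
        using V(1) open_chart_map_image[OF c] by (simp add: K_primitive_def)
      show "(F \<circ> chart_inv c) y = (f \<circ> chart_inv c) y" if "y \<in> chart_map c ` (V \<inter> chart_dom c)" for y
        using that V(3) chart_inv_map[OF c] by force
    qed (rule xV)
  qed
  then show ?thesis by blast
qed

end

theorem theorem5p2:
  fixes M :: "'a::{t2_space, second_countable_topology} set"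
    and A :: "('a, 'n::finite) chart set"
    and g :: "('a, 'n) chart \<Rightarrow> 'n metric"
    and \<mu> :: real
  assumes "riemannian_manifold M A g"
    and "simply_connected M"
    and "\<forall>c\<in>A. \<forall>x\<in>chart_ran c. inj (Rm (g c) x)"
  shows "(\<exists>f :: 'a \<Rightarrow> real. smooth_function A f \<and>
            (\<forall>c\<in>A. \<forall>x\<in>chart_ran c. \<forall>u v.
               Ric (g c) x u v + Hess (g c) (f \<circ> chart_inv c) x u v = \<mu> * g c x u v))
         \<longleftrightarrow>
         (\<forall>c\<in>A. \<forall>x\<in>chart_ran c. \<forall>u v.
            0 = Ric (g c) x u v + nabla_K (g c) x u v - \<mu> * g c x u v)"
    (is "(\<exists>f. ?soliton f) \<longleftrightarrow> ?K_equation")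
proof -
  interpret curved_manifold M A g
    using assms by unfold_locales auto
  show ?thesis
  proof
    assume "\<exists>f. ?soliton f"
    then obtain f where f: "smooth_function A f" "\<And>c x u v. c \<in> A \<Longrightarrow> x \<in> chart_ran c \<Longrightarrow>
        Ric (g c) x u v + Hess (g c) (f \<circ> chart_inv c) x u v = \<mu> * g c x u v" by blast
    show ?K_equation
    proof (intro ballI allI)
      fix c x u v assume c: "c \<in> A" and x: "x \<in> chart_ran c"
      interpret C: curved_chart "chart_ran c" "g c" using curved_chart[OF c] .
      \<comment> \<open>The equation holds on the whole chart, hence the dual form of K is the
        differential of f there and the two covariant derivatives agree.\<close>
      have "nabla_K (g c) x u v = Hess (g c) (f \<circ> chart_inv c) x u v"
        using f c by (intro C.nabla_K_eq_Hess[OF x]) (auto simp: smooth_function_def)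
      with f(2)[OF c x, of u v]
      show "0 = Ric (g c) x u v + nabla_K (g c) x u v - \<mu> * g c x u v" by simp
    qed
  next
    assume K: ?K_equation
    have "dd (\<lambda>y. K_form c y u) x v = dd (\<lambda>y. K_form c y v) x u" if "c \<in> A" "x \<in> chart_ran c" for c x u v
      unfolding K_form_def
      using curved_chart.flat_K_closed[OF curved_chart[OF that(1)] that(2)] K that by blast
    then obtain f where f: "\<And>c x. c \<in> A \<Longrightarrow> x \<in> chart_ran c \<Longrightarrow>
        ((f \<circ> chart_inv c) has_derivative K_form c x) (at x)"
      using potential_exists[OF assms(2)] by blast
    \<comment> \<open>The gluing yields only a first derivative of f, but this derivative is
      \<open>K_form\<close>, which is smooth, so f is smooth as well.\<close>
    have "smooth_on (chart_ran c) (f \<circ> chart_inv c)" if c: "c \<in> A" for c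
    proof (rule smooth_onI[OF open_ran[OF c]])
      show "(f \<circ> chart_inv c) differentiable (at x)" if "x \<in> chart_ran c" for x
        using f[OF c that] by (rule differentiableI)
      show "smooth_on (chart_ran c) (\<lambda>x. dd (f \<circ> chart_inv c) x v)" for v
        using curved_chart.smooth_flat_K[OF curved_chart[OF c]]
        by (subst smooth_on_cong[OF has_derivative_imp_dd[OF f[OF c]]]) (auto simp: K_form_def)
    qed
    moreover have "Ric (g c) x u v + Hess (g c) (f \<circ> chart_inv c) x u v = \<mu> * g c x u v"
      if c: "c \<in> A" and x: "x \<in> chart_ran c" for c x u v
    proof -
      interpret C: curved_chart "chart_ran c" "g c" using curved_chart[OF c] .
      have "dd (f \<circ> chart_inv c) y = flat (g c y) (K_field (g c) y)" if "y \<in> chart_ran c" for y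
        using frechet_derivative_at[OF f[OF c that]] by (simp add: K_form_def)
      then have "Hess (g c) (f \<circ> chart_inv c) x u v = nabla_K (g c) x u v"
        unfolding nabla_K_def Hess_def by (rule C.nabla_oneform_cong[OF x])
      moreover have "0 = Ric (g c) x u v + nabla_K (g c) x u v - \<mu> * g c x u v"
        using K c x by blast
      ultimately show ?thesis by linarith
    qed
    ultimately show "\<exists>f. ?soliton f"
      unfolding smooth_function_def by blast
  qed
qed

end
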